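(* Let $C$ be a complete integral curve of arithmetic genus $g\ge 2$ over an algebraically closed field $k$, and let $\bar\kappa\colon\bar C\to C'$ be its canonical map, from the normalization $\bar C$ of $C$ onto the canonical model $C'$ of $C$. If $\deg\bar\kappa=1$, then $C$ is nonhyperelliptic; conversely, if $C$ is nonhyperelliptic, then $\deg\bar\kappa=1$.
   Context: The field $k$ has arbitrary characteristic. $C$ may be singular; $\omega$ denotes its canonical (dualizing) sheaf. Hyperelliptic: $C$ is hyperelliptic if there is a map $\lambda\colon C\to\mathbb P^1$ of degree $2$; otherwise $C$ is nonhyperelliptic. Canonical map and model: let $\nu\colon\bar C\to C$ be the normalization, and put $\mathcal O_{\bar C}\omega:=\nu^*\omega/\mathrm{Torsion}(\nu^*\omega)$. The space $H^0(\omega)$, of dimension $g$, generates $\omega$, so $\mathcal O_{\bar C}\omega$ is an invertible sheaf on $\bar C$ generated by (the image of) $H^0(\omega)$; this defines a nondegenerate map $\bar\kappa\colon\bar C\to\mathbb P^{g-1}$ (after choosing a basis of $H^0(\omega)$). Its image is the canonical model $C'\subset\mathbb P^{g-1}$, and $\bar\kappa$ also denotes the induced map $\bar C\to C'$. *)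

theory Defs
  imports "HOL-Computational_Algebra.Polynomial"
begin

text \<open>
  Integral curves are represented by Chevalley schemata (EGA I, section 8): an integral separated
  scheme \<open>X\<close> of finite type over \<open>k\<close> with function field \<open>K\<close> is given by the set of its local rings
  \<open>O\<^sub>P\<close>, viewed as subrings of \<open>K\<close>; the map from points to local rings is injective, and the generic
  point corresponds to \<open>K\<close> itself.  So a point is a subring of \<open>K\<close> and a curve is a set of points.

  The function field is the type \<open>'a\<close>, the ground field is the type \<open>'k\<close>, and \<open>scale\<close> is the scalar
  multiplication of the \<open>k\<close>-algebra \<open>K\<close>.
\<close>

definition field_algebra :: "('k::field \<Rightarrow> 'a::field \<Rightarrow> 'a) \<Rightarrow> bool" where
  "field_algebra scale \<longleftrightarrow>
     vector_space scale \<and> (\<forall>c x y. scale c (x * y) = scale c x * y)"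

definition subalgebra :: "('k::field \<Rightarrow> 'a::field \<Rightarrow> 'a) \<Rightarrow> 'a set \<Rightarrow> bool" where
  "subalgebra scale A \<longleftrightarrow>
     module.subspace scale A \<and> 1 \<in> A \<and> (\<forall>x\<in>A. \<forall>y\<in>A. x * y \<in> A)"

definition subextension :: "('k::field \<Rightarrow> 'a::field \<Rightarrow> 'a) \<Rightarrow> 'a set \<Rightarrow> bool" where
  "subextension scale F \<longleftrightarrow> subalgebra scale F \<and> (\<forall>x\<in>F. inverse x \<in> F)"

text \<open>\<open>[E : F] = n\<close> for subfields \<open>F\<close> and \<open>E\<close> of \<open>K\<close>: there is an \<open>F\<close>-basis \<open>b\<^sub>0, \<dots>, b\<^bsub>n-1\<^esub>\<close> of \<open>E\<close>.\<close>

definition has_ext_degree :: "'a::field set \<Rightarrow> 'a set \<Rightarrow> nat \<Rightarrow> bool" where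
  "has_ext_degree F E n \<longleftrightarrow> F \<subseteq> E \<and>
     (\<exists>b :: nat \<Rightarrow> 'a. (\<forall>i<n. b i \<in> E) \<and>
        (\<forall>x\<in>E. \<exists>!c. (\<forall>i<n. c i \<in> F) \<and> (\<forall>i\<ge>n. c i = 0) \<and> x = (\<Sum>i<n. c i * b i)))"

text \<open>Since \<open>k\<close> will be algebraically closed, \<open>x\<close> is transcendental iff it is not a constant.\<close>

definition function_field_of_curve :: "('k::alg_closed_field \<Rightarrow> 'a::field \<Rightarrow> 'a) \<Rightarrow> bool" where
  "function_field_of_curve scale \<longleftrightarrow> field_algebra scale \<and>
     (\<exists>x n. x \<notin> range (\<lambda>c. scale c 1) \<and> has_ext_degree (subextension scale hull {x}) UNIV n)"


subsection \<open>Local rings and Chevalley schemata\<close>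

definition prime_ideal_of :: "'a::field set \<Rightarrow> 'a set \<Rightarrow> bool" where
  "prime_ideal_of A p \<longleftrightarrow> p \<subseteq> A \<and> 0 \<in> p \<and> (\<forall>x\<in>p. \<forall>y\<in>p. x + y \<in> p) \<and>
     (\<forall>a\<in>A. \<forall>x\<in>p. a * x \<in> p) \<and> 1 \<notin> p \<and> (\<forall>a\<in>A. \<forall>b\<in>A. a * b \<in> p \<longrightarrow> a \<in> p \<or> b \<in> p)"

definition localization :: "'a::field set \<Rightarrow> 'a set \<Rightarrow> 'a set" where
  "localization A p = {a / b | a b. a \<in> A \<and> b \<in> A \<and> b \<notin> p}"

text \<open>The points of \<open>Spec A\<close>.\<close>

definition local_rings :: "'a::field set \<Rightarrow> 'a set set" where
  "local_rings A = {localization A p | p. prime_ideal_of A p}"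

definition nonunits :: "'a::field set \<Rightarrow> 'a set" where
  "nonunits R = {x \<in> R. x = 0 \<or> inverse x \<notin> R}"

definition dominates :: "'a::field set \<Rightarrow> 'a set \<Rightarrow> bool" where
  "dominates R S \<longleftrightarrow> S \<subseteq> R \<and> nonunits S \<subseteq> nonunits R"

definition valuation_ring :: "('k::field \<Rightarrow> 'a::field \<Rightarrow> 'a) \<Rightarrow> 'a set \<Rightarrow> bool" where
  "valuation_ring scale R \<longleftrightarrow> subalgebra scale R \<and> (\<forall>x. x \<in> R \<or> inverse x \<in> R)"

definition affine_model :: "('k::field \<Rightarrow> 'a::field \<Rightarrow> 'a) \<Rightarrow> 'a set \<Rightarrow> bool" where
  "affine_model scale A \<longleftrightarrow> (\<exists>S. finite S \<and> A = subalgebra scale hull S) \<and>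
     (\<forall>x. \<exists>a\<in>A. \<exists>b\<in>A. b \<noteq> 0 \<and> x = a / b)"

definition affine_cover :: "('k::field \<Rightarrow> 'a::field \<Rightarrow> 'a) \<Rightarrow> 'a set set \<Rightarrow> 'a set set \<Rightarrow> bool" where
  "affine_cover scale C \<A> \<longleftrightarrow> finite \<A> \<and> (\<forall>A\<in>\<A>. affine_model scale A) \<and> C = (\<Union>A\<in>\<A>. local_rings A)"

text \<open>Uniqueness of the dominated point is separatedness and existence is completeness
  (valuative criteria).\<close>

definition complete_integral_curve ::
    "('k::alg_closed_field \<Rightarrow> 'a::field \<Rightarrow> 'a) \<Rightarrow> 'a set set \<Rightarrow> bool" where
  "complete_integral_curve scale C \<longleftrightarrow> function_field_of_curve scale \<and>
     (\<exists>\<A>. affine_cover scale C \<A>) \<and>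
     (\<forall>R. valuation_ring scale R \<longrightarrow> (\<exists>!P. P \<in> C \<and> dominates R P))"

definition closed_points :: "'a::field set set \<Rightarrow> 'a set set" where
  "closed_points C = C - {UNIV}"

text \<open>A dominant map \<open>Y \<rightarrow> X\<close> of integral schemes, together with the resulting inclusion of function
  fields, is the same as the statement that every local ring of \<open>Y\<close> dominates one of \<open>X\<close>.  The
  function field of \<open>X\<close>, being its largest local ring, is \<open>\<Union>X\<close>.\<close>

definition dominant_map :: "'a::field set set \<Rightarrow> 'a set set \<Rightarrow> bool" where
  "dominant_map Y X \<longleftrightarrow> (\<forall>Q\<in>Y. \<exists>P\<in>X. dominates Q P)"

definition has_map_degree :: "'a::field set set \<Rightarrow> 'a set set \<Rightarrow> nat \<Rightarrow> bool" where
  "has_map_degree Y X n \<longleftrightarrow> has_ext_degree (\<Union>X) (\<Union>Y) n"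

text \<open>The projective line with coordinate \<open>f\<close> (\<open>f\<close> not constant), glued from \<open>Spec k[f]\<close> and
  \<open>Spec k[1/f]\<close>.\<close>

definition projective_line :: "('k::field \<Rightarrow> 'a::field \<Rightarrow> 'a) \<Rightarrow> 'a \<Rightarrow> 'a set set" where
  "projective_line scale f =
     local_rings (subalgebra scale hull {f}) \<union> local_rings (subalgebra scale hull {inverse f})"

text \<open>A nonconstant map from \<open>C\<close> to the projective line is given by the nonconstant rational
  function \<open>f\<close> that is the pullback of the coordinate.\<close>

definition hyperelliptic :: "('k::field \<Rightarrow> 'a::field \<Rightarrow> 'a) \<Rightarrow> 'a set set \<Rightarrow> bool" where
  "hyperelliptic scale C \<longleftrightarrow>
     (\<exists>f. f \<notin> range (\<lambda>c. scale c 1) \<and> dominant_map C (projective_line scale f) \<and>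
          has_map_degree C (projective_line scale f) 2)"


subsection \<open>Normalization\<close>

definition integral_closure :: "'a::field set \<Rightarrow> 'a set" where
  "integral_closure A = {x. \<exists>p :: 'a poly. lead_coeff p = 1 \<and> (\<forall>i. coeff p i \<in> A) \<and> poly p x = 0}"

definition normalization :: "'a::field set set \<Rightarrow> 'a set set" where
  "normalization C = (\<Union>P\<in>C. local_rings (integral_closure P))"

definition normalization_map :: "'a::field set set \<Rightarrow> 'a set \<Rightarrow> 'a set" where
  "normalization_map C Q = (THE P. P \<in> C \<and> dominates Q P)"


subsection \<open>Coherent sheaves and their first cohomology\<close>

text \<open>
  A torsion-free coherent sheaf of rank \<open>r\<close> embeds in its generic stalk \<open>K\<^sup>r\<close>, and is given by its
  stalks \<open>F P\<close>, which are \<open>O\<^sub>P\<close>-submodules of \<open>K\<^sup>r\<close>.  Elements of \<open>K\<^sup>r\<close> are functions on \<open>nat\<close> that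
  vanish from \<open>r\<close> on.  The values \<open>F P\<close> with \<open>P\<close> not in \<open>C\<close> are irrelevant.
\<close>

definition vectors :: "nat \<Rightarrow> (nat \<Rightarrow> 'a::field) set" where
  "vectors r = {v. \<forall>i\<ge>r. v i = 0}"

definition coherent_sheaf ::
    "('k::field \<Rightarrow> 'a::field \<Rightarrow> 'a) \<Rightarrow> 'a set set \<Rightarrow> nat \<Rightarrow> ('a set \<Rightarrow> (nat \<Rightarrow> 'a) set) \<Rightarrow> bool" where
  "coherent_sheaf scale C r F \<longleftrightarrow> F UNIV = vectors r \<and>
     (\<exists>\<A>. affine_cover scale C \<A> \<and>
        (\<forall>A\<in>\<A>. \<exists>G. finite G \<and> G \<subseteq> vectors r \<and>
           (\<forall>P\<in>local_rings A. F P = {(\<lambda>i. \<Sum>g\<in>G. c g * g i) | c. \<forall>g\<in>G. c g \<in> P})))"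

text \<open>The sheaf of rank one with stalks \<open>L P \<subseteq> K\<close>; the structure sheaf is \<open>line_sheaf (\<lambda>P. P)\<close>.\<close>

definition line_sheaf :: "('a set \<Rightarrow> 'a set) \<Rightarrow> 'a set \<Rightarrow> (nat \<Rightarrow> 'a::field) set" where
  "line_sheaf L P = {v \<in> vectors 1. v 0 \<in> L P}"

definition global_sections :: "'a::field set set \<Rightarrow> ('a set \<Rightarrow> 'a set) \<Rightarrow> 'a set" where
  "global_sections C L = (\<Inter>P\<in>C. L P)"

text \<open>
  In the flasque resolution \<open>0 \<rightarrow> F \<rightarrow> K\<^sup>r \<rightarrow> K\<^sup>r/F \<rightarrow> 0\<close> the quotient is the direct sum of the skyscraper
  sheaves \<open>K\<^sup>r / F P\<close> at the closed points.  So \<open>H\<^sup>1(C, F)\<close> is the cokernel of the map from \<open>K\<^sup>r\<close> to the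
  direct sum of the \<open>K\<^sup>r / F P\<close>, that is, the quotient of \<open>adeles C r\<close> by \<open>coboundaries C r F\<close>
  (where \<open>F P\<close> is \<open>O\<^sub>P\<^sup>r\<close> for almost all \<open>P\<close>).
\<close>

definition adeles :: "'a::field set set \<Rightarrow> nat \<Rightarrow> ('a set \<Rightarrow> nat \<Rightarrow> 'a) set" where
  "adeles C r = {a. (\<forall>P. a P \<in> vectors r) \<and> (\<forall>P. P \<notin> closed_points C \<longrightarrow> a P = (\<lambda>i. 0)) \<and>
     finite {P \<in> closed_points C. \<exists>i. a P i \<notin> P}}"

definition coboundaries ::
    "'a::field set set \<Rightarrow> nat \<Rightarrow> ('a set \<Rightarrow> (nat \<Rightarrow> 'a) set) \<Rightarrow> ('a set \<Rightarrow> nat \<Rightarrow> 'a) set" where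
  "coboundaries C r F =
     {a \<in> adeles C r. \<exists>x\<in>vectors r. \<forall>P\<in>closed_points C. (\<lambda>i. a P i - x i) \<in> F P}"

definition has_h1 ::
    "('k::field \<Rightarrow> 'a::field \<Rightarrow> 'a) \<Rightarrow> 'a set set \<Rightarrow> nat \<Rightarrow> ('a set \<Rightarrow> (nat \<Rightarrow> 'a) set) \<Rightarrow> nat \<Rightarrow> bool" where
  "has_h1 scale C r F n \<longleftrightarrow>
     (\<exists>b :: nat \<Rightarrow> 'a set \<Rightarrow> nat \<Rightarrow> 'a. (\<forall>j<n. b j \<in> adeles C r) \<and>
        (\<forall>a\<in>adeles C r. \<exists>!c :: nat \<Rightarrow> 'k. (\<forall>j\<ge>n. c j = 0) \<and>
           (\<lambda>P i. a P i - (\<Sum>j<n. scale (c j) (b j P i))) \<in> coboundaries C r F))"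

text \<open>As \<open>H\<^sup>0(C, O\<^sub>C) = k\<close>, the arithmetic genus \<open>1 - \<chi>(O\<^sub>C)\<close> is \<open>dim H\<^sup>1(C, O\<^sub>C)\<close>.\<close>

definition has_arithmetic_genus ::
    "('k::field \<Rightarrow> 'a::field \<Rightarrow> 'a) \<Rightarrow> 'a set set \<Rightarrow> nat \<Rightarrow> bool" where
  "has_arithmetic_genus scale C g \<longleftrightarrow> has_h1 scale C 1 (line_sheaf (\<lambda>P. P)) g"

text \<open>\<open>\<phi>\<close> is (the lift to the adeles of) a \<open>k\<close>-linear form on \<open>H\<^sup>1(C, F)\<close>.\<close>

definition h1_functional ::
    "('k::field \<Rightarrow> 'a::field \<Rightarrow> 'a) \<Rightarrow> 'a set set \<Rightarrow> nat \<Rightarrow> ('a set \<Rightarrow> (nat \<Rightarrow> 'a) set) \<Rightarrow>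
     (('a set \<Rightarrow> nat \<Rightarrow> 'a) \<Rightarrow> 'k) \<Rightarrow> bool" where
  "h1_functional scale C r F \<phi> \<longleftrightarrow>
     (\<forall>a\<in>adeles C r. \<forall>b\<in>adeles C r. \<phi> (\<lambda>P i. a P i + b P i) = \<phi> a + \<phi> b) \<and>
     (\<forall>c. \<forall>a\<in>adeles C r. \<phi> (\<lambda>P i. scale c (a P i)) = c * \<phi> a) \<and>
     (\<forall>a\<in>coboundaries C r F. \<phi> a = 0)"

text \<open>
  A dualizing sheaf with trace map \<open>t : H\<^sup>1(C, \<omega>) \<rightarrow> k\<close>: for every coherent \<open>F\<close>, sending \<open>h : F \<rightarrow> \<omega>\<close> to
  \<open>t \<circ> H\<^sup>1(h)\<close> is a bijection from \<open>Hom(F, \<omega>)\<close> to the dual of \<open>H\<^sup>1(C, F)\<close>.  The dualizing sheaf of an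
  integral curve is torsion-free of rank one, so up to isomorphism it has stalks in \<open>K\<close>.  A torsion
  sheaf has no \<open>H\<^sup>1\<close> and no nonzero map to \<open>\<omega>\<close>, so \<open>F\<close> may be replaced by its quotient by torsion.
  A map \<open>F \<rightarrow> \<omega>\<close> is then a linear form \<open>h\<close> on \<open>K\<^sup>r\<close> that carries each \<open>F P\<close> into \<open>\<omega> P\<close>.
\<close>

definition dualizing_sheaf ::
    "('k::field \<Rightarrow> 'a::field \<Rightarrow> 'a) \<Rightarrow> 'a set set \<Rightarrow> ('a set \<Rightarrow> 'a set) \<Rightarrow>
     (('a set \<Rightarrow> nat \<Rightarrow> 'a) \<Rightarrow> 'k) \<Rightarrow> bool" where
  "dualizing_sheaf scale C \<omega> t \<longleftrightarrow>
     coherent_sheaf scale C 1 (line_sheaf \<omega>) \<and> h1_functional scale C 1 (line_sheaf \<omega>) t \<and>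
     (\<forall>r F \<phi>. coherent_sheaf scale C r F \<and> h1_functional scale C r F \<phi> \<longrightarrow>
        (\<exists>!h. h \<in> vectors r \<and> (\<forall>P\<in>C. \<forall>v\<in>F P. (\<Sum>j<r. h j * v j) \<in> \<omega> P) \<and>
           (\<forall>a\<in>adeles C r. \<phi> a = t (\<lambda>P i. if i = 0 then \<Sum>j<r. h j * a P j else 0))))"


subsection \<open>The canonical map and the canonical model\<close>

definition generated_module :: "'a::field set \<Rightarrow> 'a set \<Rightarrow> 'a set" where
  "generated_module R M = {(\<Sum>m\<in>T. c m * m) | T c. finite T \<and> T \<subseteq> M \<and> (\<forall>m\<in>T. c m \<in> R)}"

text \<open>The stalk at \<open>Q\<close> of \<open>\<nu>\<^sup>*\<omega> / Torsion(\<nu>\<^sup>*\<omega>)\<close>, the image of \<open>\<nu>\<^sup>*\<omega>\<close> in its generic stalk \<open>K\<close>.\<close>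

definition pullback_mod_torsion ::
    "'a::field set set \<Rightarrow> ('a set \<Rightarrow> 'a set) \<Rightarrow> 'a set \<Rightarrow> 'a set" where
  "pullback_mod_torsion C \<omega> Q = generated_module Q (\<omega> (normalization_map C Q))"

text \<open>Let \<open>s 0, \<dots>, s (g - 1)\<close> be sections generating the above invertible sheaf.  If \<open>s j\<close>
  generates its stalk at \<open>Q\<close>, then the map to projective space sends \<open>Q\<close> into the chart where the
  \<open>j\<close>-th coordinate is nonzero; that chart of the image has coordinate ring
  \<open>k[s 0 / s j, \<dots>, s (g - 1) / s j]\<close>, and the image of \<open>Q\<close> is the prime ideal of the functions
  that are nonunits at \<open>Q\<close>.  The local ring obtained does not depend on the choice of \<open>j\<close>.\<close>

definition canonical_map ::
    "('k::field \<Rightarrow> 'a::field \<Rightarrow> 'a) \<Rightarrow> 'a set set \<Rightarrow> ('a set \<Rightarrow> 'a set) \<Rightarrow> nat \<Rightarrow> (nat \<Rightarrow> 'a) \<Rightarrow>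
     'a set \<Rightarrow> 'a set" where
  "canonical_map scale C \<omega> g s Q =
     (let j = (SOME j. j < g \<and> pullback_mod_torsion C \<omega> Q = generated_module Q {s j});
          A = subalgebra scale hull ((\<lambda>i. s i / s j) ` {..<g})
      in localization A (A \<inter> nonunits Q))"

definition canonical_model ::
    "('k::field \<Rightarrow> 'a::field \<Rightarrow> 'a) \<Rightarrow> 'a set set \<Rightarrow> ('a set \<Rightarrow> 'a set) \<Rightarrow> nat \<Rightarrow> (nat \<Rightarrow> 'a) \<Rightarrow>
     'a set set" where
  "canonical_model scale C \<omega> g s = canonical_map scale C \<omega> g s ` normalization C"

definition basis_of :: "('k::field \<Rightarrow> 'a::field \<Rightarrow> 'a) \<Rightarrow> 'a set \<Rightarrow> nat \<Rightarrow> (nat \<Rightarrow> 'a) \<Rightarrow> bool" where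
  "basis_of scale V n s \<longleftrightarrow> inj_on s {..<n} \<and> \<not> module.dependent scale (s ` {..<n}) \<and>
     module.span scale (s ` {..<n}) = V"

end

theory Submission
  imports Defs "HOL-Library.Function_Algebras"
begin

text \<open>
  Write \<open>K\<close> for the function field, \<open>V = H\<^sup>0(\<omega>)\<close>, and \<open>F = k(s\<^sub>i / s\<^sub>j)\<close>.  The sheaf \<open>\<omega>\<close> is generated by
  \<open>V\<close> (\<open>globally_generated\<close>), so \<open>F\<close> is the function field of the canonical model, and the canonical
  map has degree one iff \<open>F = K\<close> (\<open>canonical_map_birational_iff\<close>).  What has to be shown is that
  \<open>F \<noteq> K\<close> iff \<open>C\<close> is hyperelliptic.

  The classical arguments by degrees of line bundles are replaced by residues.  For a closed point
  \<open>P\<close> and \<open>y \<in> K\<close> the residue of \<open>y\<close> at \<open>P\<close> is the trace of the adele that is \<open>y\<close> at \<open>P\<close> and \<open>0\<close>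
  elsewhere.  Applying the universal property of \<open>\<omega>\<close> to the sheaf that is \<open>\<omega>\<close> with its stalk at \<open>P\<close>
  enlarged by \<open>y\<close> gives local duality: if all \<open>c y\<close> with \<open>c \<in> O\<^sub>P\<close> have residue \<open>0\<close> at \<open>P\<close>, then
  \<open>y \<in> \<omega>\<^sub>P\<close> (\<open>local_duality\<close>).

  Suppose that \<open>f\<close> gives a map of degree two to the projective line.  Modulo \<open>1/f\<close> the functions that
  are regular at the poles of \<open>f\<close> are spanned by \<open>1\<close> and some \<open>u\<close>.  By local duality, \<open>f\<^sup>g\<^sup>-\<^sup>1 h\<close> is a
  section, for \<open>h \<in> V\<close>, as soon as the traces of \<open>f\<^sup>i h\<close> and of \<open>f\<^sup>i h u\<close>, taken over the poles of \<open>f\<close>,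
  vanish for \<open>0 < i < g\<close>.  The first do by the residue theorem; the others are \<open>g - 1\<close> linear
  conditions on \<open>V\<close>, which has dimension \<open>g\<close>.  So there is a nonzero \<open>h\<close>, the \<open>g\<close> elements \<open>f\<^sup>i h\<close>
  with \<open>i < g\<close> form a basis of \<open>V\<close>, and \<open>F \<subseteq> k(f) \<noteq> K\<close> (\<open>hyperelliptic_not_birational\<close>).

  Suppose conversely that \<open>F \<noteq> K\<close>.  Counting dimensions over \<open>k(x)\<close> for a suitable \<open>x \<in> F\<close> shows that
  among the poles of \<open>x\<close>, which are smooth points at which \<open>s\<^sub>0\<close> generates \<open>\<omega>\<close>, there are two with the
  same trace on \<open>F\<close> or one that is ramified over \<open>F\<close> (\<open>no_unramified_subfield\<close>).  In other words,
  there are points \<open>P\<close> and \<open>Q\<close>, possibly equal, such that every section that vanishes at \<open>P\<close> vanishes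
  on \<open>P + Q\<close>.  Then the linear forms on \<open>V\<close> that two polar parts at \<open>P\<close> and \<open>Q\<close> define by residues
  are proportional, and by duality for the structure sheaf there is a function with precisely the
  poles \<open>P + Q\<close> (\<open>function_with_polar_parts\<close>).  It is a map of degree two to the projective line.

  The tools are elementary.  Finiteness of the first cohomology of the structure sheaf bounds the
  distance between a local ring and the valuation rings above it (\<open>conductor\<close>,
  \<open>finite_nonvaluation_points\<close>), and for \<open>x\<close> with smooth poles \<open>[K : k(x)]\<close> is the dimension, modulo
  \<open>1/x\<close>, of the ring of functions regular at these poles (\<open>dep_bound_from_residues\<close>,
  \<open>independent_from_residues\<close>).
\<close>

section \<open>Linear algebra over a subfield\<close>

text \<open>Elimination does not leave the subfield \<open>F\<close> that contains the coefficients.\<close>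

lemma homogeneous_system_solution:
  fixes a :: "'i \<Rightarrow> 'j \<Rightarrow> 'f::field"
  assumes F: "1 \<in> F" "\<And>x y. x \<in> F \<Longrightarrow> y \<in> F \<Longrightarrow> x - y \<in> F"
      "\<And>x y. x \<in> F \<Longrightarrow> y \<in> F \<Longrightarrow> x * y \<in> F" "\<And>x. x \<in> F \<Longrightarrow> inverse x \<in> F"
    and "finite I" "finite J" "card I < card J" "\<And>i j. i \<in> I \<Longrightarrow> j \<in> J \<Longrightarrow> a i j \<in> F"
  shows "\<exists>c. (\<forall>j\<in>J. c j \<in> F) \<and> (\<exists>j\<in>J. c j \<noteq> 0) \<and> (\<forall>i\<in>I. (\<Sum>j\<in>J. c j * a i j) = 0)"
  using assms(5-8)
proof (induction I arbitrary: J a rule: finite_induct)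
  case empty
  then have "J \<noteq> {}" by auto
  then show ?case by (intro exI[of _ "\<lambda>_. 1"]) (auto simp: F)
next
  case (insert i0 I)
  have z: "0 \<in> F" using F(2)[OF F(1) F(1)] by simp
  have neg: "- x \<in> F" if "x \<in> F" for x using F(2)[OF z that] by simp
  have plus: "x + y \<in> F" if "x \<in> F" "y \<in> F" for x y using F(2)[OF that(1) neg[OF that(2)]] by simp
  have sum: "sum h S \<in> F" if "\<And>x. x \<in> S \<Longrightarrow> h x \<in> F" for h and S :: "'j set"
    using that by (induction S rule: infinite_finite_induct) (auto simp: z plus)
  show ?case
  proof (cases "\<forall>j\<in>J. a i0 j = 0")
    case True
    have "card I < card J" using insert by simp
    then obtain c where "\<forall>j\<in>J. c j \<in> F" "\<exists>j\<in>J. c j \<noteq> 0" "\<forall>i\<in>I. (\<Sum>j\<in>J. c j * a i j) = 0"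
      using insert.IH[of J a] insert.prems by auto
    then show ?thesis using True by (intro exI[of _ c]) auto
  next
    case False
    then obtain j0 where j0: "j0 \<in> J" "a i0 j0 \<noteq> 0" by auto
    define J' where "J' = J - {j0}"
    define a' where "a' i j = a i j - a i j0 * a i0 j * inverse (a i0 j0)" for i j
    have fin: "finite J'" and J: "J = insert j0 J'" "j0 \<notin> J'"
      using insert.prems j0 by (auto simp: J'_def)
    have "card I < card J'" using insert.hyps insert.prems J fin by simp
    moreover have "a' i j \<in> F" if "i \<in> I" "j \<in> J'" for i j
      using insert.prems(3) that J unfolding a'_def by (intro F) auto
    ultimately obtain c where c: "\<forall>j\<in>J'. c j \<in> F" "\<exists>j\<in>J'. c j \<noteq> 0"
        "\<forall>i\<in>I. (\<Sum>j\<in>J'. c j * a' i j) = 0"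
      using insert.IH[of J' a'] fin by auto
    define d where "d = c(j0 := - (\<Sum>j\<in>J'. c j * a i0 j) * inverse (a i0 j0))"
    have dc: "d j = c j" if "j \<in> J'" for j using that J by (auto simp: d_def)
    have "d j0 \<in> F" unfolding d_def fun_upd_same using c(1) insert.prems(3) J
      by (intro F neg sum) auto
    then have "\<forall>j\<in>J. d j \<in> F" using c(1) dc J by auto
    moreover have "\<exists>j\<in>J. d j \<noteq> 0" using c(2) dc J by auto
    moreover have "(\<Sum>j\<in>J. d j * a i j) = 0" if i: "i \<in> insert i0 I" for i
    proof -
      have "(\<Sum>j\<in>J. d j * a i j) = d j0 * a i j0 + (\<Sum>j\<in>J'. c j * a i j)"
        using J fin dc by simp
      also have "\<dots> = (\<Sum>j\<in>J'. c j * a' i j)"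
        by (simp add: d_def a'_def right_diff_distrib sum_subtractf sum_distrib_left sum_distrib_right
              sum_negf mult_ac)
      also have "\<dots> = 0"
      proof (cases "i = i0")
        case True
        then have "a' i j = 0" for j using j0 by (simp add: a'_def)
        then show ?thesis by simp
      qed (use i c(3) in auto)
      finally show ?thesis .
    qed
    ultimately show ?thesis by blast
  qed
qed

section \<open>Constants and polynomials in the function field\<close>

locale curve_function_field =
  fixes scale :: "'k::alg_closed_field \<Rightarrow> 'a::field \<Rightarrow> 'a"
  assumes function_field: "function_field_of_curve scale"
begin

sublocale vector_space scale
  using function_field by (simp add: function_field_of_curve_def field_algebra_def)

definition emb :: "'k \<Rightarrow> 'a" where "emb c = scale c 1"

definition constants :: "'a set" where "constants = range emb"

lemma scale_eq: "scale c x = emb c * x"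
proof -
  have "scale c (1 * x) = scale c 1 * x"
    using function_field unfolding function_field_of_curve_def field_algebra_def by blast
  then show ?thesis by (simp add: emb_def)
qed

lemma emb_0 [simp]: "emb 0 = 0" and emb_1 [simp]: "emb 1 = 1"
  by (simp_all add: emb_def)

lemma emb_add: "emb (a + b) = emb a + emb b"
  by (simp add: emb_def scale_left_distrib)

lemma emb_diff: "emb (a - b) = emb a - emb b"
  by (simp add: emb_def scale_left_diff_distrib)

lemma emb_minus: "emb (- a) = - emb a"
  using emb_diff[of 0 a] by simp

lemma emb_mult: "emb (a * b) = emb a * emb b"
  by (metis emb_def scale_eq scale_scale)

lemma emb_sum: "emb (sum f S) = (\<Sum>x\<in>S. emb (f x))"
  by (induction S rule: infinite_finite_induct) (auto simp: emb_add)

lemma emb_eq_0_iff [simp]: "emb a = 0 \<longleftrightarrow> a = 0"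
  by (simp add: emb_def)


lemma emb_eq_iff [simp]: "emb a = emb b \<longleftrightarrow> a = b"
  using emb_eq_0_iff[of "a - b"] by (simp add: emb_diff del: emb_eq_0_iff)

lemma emb_inverse: "emb (inverse a) = inverse (emb a)"
proof (cases "a = 0")
  case False
  then have "emb a * emb (inverse a) = 1" by (simp flip: emb_mult)
  then show ?thesis by (simp add: inverse_unique)
qed simp

lemma constants_iff: "x \<in> constants \<longleftrightarrow> (\<exists>c. x = emb c)"
  by (auto simp: constants_def)

lemma emb_in_constants [simp]: "emb c \<in> constants"
  by (simp add: constants_def)

lemma range_scale_one: "range (\<lambda>c. scale c 1) = constants"
  by (simp add: constants_def emb_def)

definition peval :: "'k poly \<Rightarrow> 'a \<Rightarrow> 'a" where "peval p x = poly (map_poly emb p) x"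

lemma peval_0 [simp]: "peval 0 x = 0" and peval_1 [simp]: "peval 1 x = 1"
  by (simp_all add: peval_def)

lemma peval_pCons [simp]: "peval (pCons c p) x = emb c + x * peval p x"
  by (simp add: peval_def map_poly_pCons)

lemma peval_add: "peval (p + q) x = peval p x + peval q x"
proof -
  have "map_poly emb (p + q) = map_poly emb p + map_poly emb q"
    by (intro poly_eqI) (simp add: coeff_map_poly emb_add)
  then show ?thesis by (simp add: peval_def)
qed

lemma peval_smult: "peval (smult c p) x = emb c * peval p x"
  by (simp add: peval_def map_poly_smult emb_mult)

lemma peval_mult: "peval (p * q) x = peval p x * peval q x"
  by (induction p) (simp_all add: peval_add peval_smult algebra_simps)

lemma peval_diff: "peval (p - q) x = peval p x - peval q x"
  using peval_add[of "p - q" q x] by simp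

lemma peval_power: "peval (p ^ n) x = peval p x ^ n"
  by (induction n) (simp_all add: peval_mult)

lemma peval_prod: "peval (prod f S) x = (\<Prod>i\<in>S. peval (f i) x)"
  by (induction S rule: infinite_finite_induct) (simp_all add: peval_mult)

lemma peval_sum: "peval (sum f S) x = (\<Sum>i\<in>S. peval (f i) x)"
  by (induction S rule: infinite_finite_induct) (simp_all add: peval_add)

lemma peval_monom: "peval (monom c n) x = emb c * x ^ n"
  by (simp add: peval_def map_poly_monom poly_monom)

lemma peval_altdef: "degree p \<le> n \<Longrightarrow> peval p x = (\<Sum>i\<le>n. emb (coeff p i) * x ^ i)"
  using arg_cong[OF poly_as_sum_of_monoms'[of p n], of "\<lambda>q. peval q x"]
  by (simp add: peval_sum peval_monom)

subsection \<open>Subalgebras\<close>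

lemma subalgebraI:
  assumes "\<And>c. emb c \<in> A" "\<And>x y. x \<in> A \<Longrightarrow> y \<in> A \<Longrightarrow> x + y \<in> A"
    "\<And>x y. x \<in> A \<Longrightarrow> y \<in> A \<Longrightarrow> x * y \<in> A"
  shows "subalgebra scale A"
  unfolding subalgebra_def
proof (intro conjI subspaceI ballI)
  show "0 \<in> A" "1 \<in> A" using assms(1)[of 0] assms(1)[of 1] by auto
qed (auto simp: scale_eq assms)

context
  fixes A :: "'a set" assumes A: "subalgebra scale A"
begin

lemma subalgebra_subspace: "subspace A"
  and subalgebra_1: "1 \<in> A"
  and subalgebra_mult: "x \<in> A \<Longrightarrow> y \<in> A \<Longrightarrow> x * y \<in> A"
  using A by (auto simp: subalgebra_def)

lemma subalgebra_0: "0 \<in> A"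
  and subalgebra_add: "x \<in> A \<Longrightarrow> y \<in> A \<Longrightarrow> x + y \<in> A"
  and subalgebra_diff: "x \<in> A \<Longrightarrow> y \<in> A \<Longrightarrow> x - y \<in> A"
  and subalgebra_uminus: "x \<in> A \<Longrightarrow> - x \<in> A"
  and subalgebra_sum: "(\<And>i. i \<in> S \<Longrightarrow> f i \<in> A) \<Longrightarrow> sum f S \<in> A"
  using subspace_0[OF subalgebra_subspace] subspace_add[OF subalgebra_subspace]
    subspace_diff[OF subalgebra_subspace] subspace_neg[OF subalgebra_subspace]
    subspace_sum[OF subalgebra_subspace] by blast+

lemma subalgebra_emb: "emb c \<in> A"
  using subalgebra_subspace subalgebra_1 by (auto simp: emb_def intro: subspace_scale)

lemma subalgebra_power: "x \<in> A \<Longrightarrow> x ^ n \<in> A"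
  by (induction n) (auto intro: subalgebra_1 subalgebra_mult)

lemma subalgebra_prod: "(\<And>i. i \<in> S \<Longrightarrow> f i \<in> A) \<Longrightarrow> prod f S \<in> A"
  by (induction S rule: infinite_finite_induct) (auto intro: subalgebra_1 subalgebra_mult)

lemma subalgebra_peval: "x \<in> A \<Longrightarrow> peval p x \<in> A"
  by (induction p) (auto intro: subalgebra_0 subalgebra_add subalgebra_mult subalgebra_emb)

lemmas subalgebra_closed = subalgebra_0 subalgebra_1 subalgebra_add subalgebra_diff
  subalgebra_uminus subalgebra_mult subalgebra_emb subalgebra_power subalgebra_peval

end

lemma subalgebra_UNIV: "subalgebra scale UNIV"
  by (rule subalgebraI) auto

lemma subalgebra_Inter: "(\<And>A. A \<in> S \<Longrightarrow> subalgebra scale A) \<Longrightarrow> subalgebra scale (\<Inter>S)"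
  by (intro subalgebraI) (auto intro: subalgebra_emb subalgebra_add subalgebra_mult)

lemma subalgebra_hull: "subalgebra scale (subalgebra scale hull S)"
  by (rule hull_in) (auto intro: subalgebra_Inter)

lemma subalgebra_hull_singleton: "subalgebra scale hull {x} = range (\<lambda>p. peval p x)"
proof (rule hull_unique)
  show "{x} \<subseteq> range (\<lambda>p. peval p x)" by (auto intro!: range_eqI[of _ _ "[:0, 1:]"])
  show "subalgebra scale (range (\<lambda>p. peval p x))"
  proof (rule subalgebraI)
    fix c show "emb c \<in> range (\<lambda>p. peval p x)" by (auto intro!: range_eqI[of _ _ "[:c:]"])
  qed (auto simp flip: peval_add peval_mult)
qed (auto intro: subalgebra_peval)

lemma subextension_UNIV: "subextension scale UNIV"
  by (simp add: subextension_def subalgebra_UNIV)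

lemma subextension_subalgebra: "subextension scale F \<Longrightarrow> subalgebra scale F"
  by (simp add: subextension_def)

lemma subextension_inverse: "subextension scale F \<Longrightarrow> x \<in> F \<Longrightarrow> inverse x \<in> F"
  by (simp add: subextension_def)

lemma subextension_divide: "subextension scale F \<Longrightarrow> x \<in> F \<Longrightarrow> y \<in> F \<Longrightarrow> x / y \<in> F"
  by (simp add: divide_inverse subextension_inverse subextension_subalgebra subalgebra_mult)

lemma subextension_hull: "subextension scale (subextension scale hull S)"
  by (rule hull_in) (auto simp: subextension_def intro!: subalgebra_Inter)

lemma subextensionI:
  assumes "subalgebra scale A"
  shows "subextension scale {a / b | a b. a \<in> A \<and> b \<in> A \<and> b \<noteq> 0}" (is "subextension scale ?F")
  unfolding subextension_def
proof (intro conjI subalgebraI ballI)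
  note [intro] = subalgebra_closed[OF assms]
  have I: "a / b \<in> ?F" if "a \<in> A" "b \<in> A" "b \<noteq> 0" for a b using that by blast
  show "emb c \<in> ?F" for c using I[of "emb c" 1] by auto
  fix x assume "x \<in> ?F"
  then obtain a b where x: "x = a / b" "a \<in> A" "b \<in> A" "b \<noteq> 0" by blast
  show "inverse x \<in> ?F"
  proof (cases "a = 0")
    case True then show ?thesis using I[of 0 1] x by auto
  next
    case False then show ?thesis using I[of b a] x by simp
  qed
  fix y assume "y \<in> ?F"
  then obtain c d where y: "y = c / d" "c \<in> A" "d \<in> A" "d \<noteq> 0" by blast
  have "x + y = (a * d + c * b) / (b * d)" "x * y = (a * c) / (b * d)"
    using x y by (auto simp: field_simps)
  then show "x + y \<in> ?F" "x * y \<in> ?F"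
    using I[of "a * d + c * b" "b * d"] I[of "a * c" "b * d"] x y by auto
qed

lemma subextension_hull_singleton:
  "subextension scale hull {x} = {peval p x / peval q x | p q. peval q x \<noteq> 0}"
proof -
  let ?A = "range (\<lambda>p. peval p x)"
  have eq: "{peval p x / peval q x | p q. peval q x \<noteq> 0} = {a / b | a b. a \<in> ?A \<and> b \<in> ?A \<and> b \<noteq> 0}"
    by auto
  have A: "subalgebra scale ?A" using subalgebra_hull[of "{x}"] by (simp add: subalgebra_hull_singleton)
  show ?thesis unfolding eq
  proof (rule hull_unique)
    have "\<exists>a b. x = a / b \<and> a \<in> ?A \<and> b \<in> ?A \<and> b \<noteq> 0"
      by (rule exI[of _ x], rule exI[of _ 1])
        (auto intro!: range_eqI[of _ _ "[:0, 1:]"] range_eqI[of 1 _ 1])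
    then show "{x} \<subseteq> {a / b | a b. a \<in> ?A \<and> b \<in> ?A \<and> b \<noteq> 0}" by simp
  qed (auto simp: A subextensionI intro!: subextension_divide subalgebra_peval[OF subextension_subalgebra])
qed

lemma subextension_hull_inverse:
  "subextension scale hull {inverse x} = subextension scale hull {x}"
proof (rule antisym)
  show "subextension scale hull {inverse x} \<subseteq> subextension scale hull {x}"
    by (intro hull_minimal) (auto intro: subextension_inverse[OF subextension_hull] hull_inc simp: subextension_hull)
  have "inverse (inverse x) \<in> subextension scale hull {inverse x}"
    by (intro subextension_inverse[OF subextension_hull] hull_inc) simp
  then show "subextension scale hull {x} \<subseteq> subextension scale hull {inverse x}"
    by (intro hull_minimal) (auto simp: subextension_hull)
qed

subsection \<open>Algebraic dependence\<close>

text \<open>The field \<open>k\<close> is algebraically closed, so a prime ideal that contains \<open>q(y)\<close> contains \<open>y - r\<close>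
  for some root \<open>r\<close> of \<open>q\<close>; this gives residue classes in \<open>k\<close>, and algebraic elements of \<open>k\<close>.\<close>

lemma prime_contains_root:
  assumes prime: "\<And>x y. x \<in> A \<Longrightarrow> y \<in> A \<Longrightarrow> x * y \<in> m \<Longrightarrow> x \<in> m \<or> y \<in> m"
    and const: "\<And>c. emb c \<in> m \<Longrightarrow> c = 0"
    and "subalgebra scale A" "y \<in> A" "q \<noteq> 0" "peval q y \<in> m"
  shows "\<exists>r. y - emb r \<in> m"
  using assms(5,6)
proof (induction "degree q" arbitrary: q)
  case 0
  then obtain c where "q = [:c:]" by (metis degree_eq_zeroE)
  with 0 show ?case by (auto dest: const)
next
  case (Suc n)
  then obtain r where "poly q r = 0" using alg_closed_imp_poly_has_root[of q] by auto
  then obtain q' where q: "q = [:- r, 1:] * q'" by (metis dvdE poly_eq_0_iff_dvd)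
  then have "q' \<noteq> 0" using Suc by auto
  then have "degree q = Suc (degree q')" unfolding q by (subst degree_mult_eq) auto
  moreover have "peval q y = (y - emb r) * peval q' y"
    by (simp only: q peval_mult) (simp add: emb_minus)
  ultimately show ?case
    using Suc prime[of "y - emb r" "peval q' y"] \<open>q' \<noteq> 0\<close> assms(3,4)
    by (auto intro: subalgebra_diff subalgebra_emb subalgebra_peval)
qed

lemma peval_nonconstant:
  assumes "x \<notin> constants" "p \<noteq> 0"
  shows "peval p x \<noteq> 0"
  using prime_contains_root[of UNIV "{0}" x p] assms subalgebra_UNIV
  by (auto simp: constants_iff)

lemma peval_eq_0_iff: "x \<notin> constants \<Longrightarrow> peval p x = 0 \<longleftrightarrow> p = 0"
  using peval_nonconstant by auto

lemma inverse_nonconstant: "x \<notin> constants \<Longrightarrow> inverse x \<notin> constants"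
  by (metis constants_iff emb_inverse inverse_inverse_eq)

lemma nonconstant_nonzero: "x \<notin> constants \<Longrightarrow> x \<noteq> 0"
  by (metis constants_iff emb_0)

lemma constants_subextension: "subextension scale constants"
  unfolding subextension_def
  by (intro conjI subalgebraI) (auto simp: constants_iff simp flip: emb_add emb_mult emb_inverse)

text \<open>This says \<open>[K : k(x)] \<le> n\<close>.  The coefficients of the relation are taken in \<open>k[x]\<close>, so that it
  can be reduced modulo \<open>x\<close>.\<close>

definition dep_bound :: "'a \<Rightarrow> nat \<Rightarrow> bool" where
  "dep_bound x n \<longleftrightarrow> (\<forall>w :: nat \<Rightarrow> 'a. \<exists>p. (\<exists>j\<le>n. p j \<noteq> 0) \<and> (\<Sum>j\<le>n. peval (p j) x * w j) = 0)"

lemma clear_denominators: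
  assumes "finite J" and c: "\<And>j. j \<in> J \<Longrightarrow> c j \<in> subextension scale hull {x}"
    and "(\<Sum>j\<in>J. c j * w j) = 0" "j0 \<in> J" "c j0 \<noteq> 0"
  shows "\<exists>p. (\<exists>j\<in>J. p j \<noteq> 0) \<and> (\<Sum>j\<in>J. peval (p j) x * w j) = 0"
proof -
  have "\<forall>j\<in>J. \<exists>p q. c j = peval p x / peval q x \<and> peval q x \<noteq> 0"
    using c unfolding subextension_hull_singleton by blast
  then obtain p q where pq: "c j = peval (p j) x / peval (q j) x" "peval (q j) x \<noteq> 0" if "j \<in> J" for j
    by metis
  define d where "d = (\<Prod>j\<in>J. peval (q j) x)"
  have d: "d \<noteq> 0" unfolding d_def using assms(1) pq by simp
  define p' where "p' j = p j * (\<Prod>i\<in>J - {j}. q i)" for j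
  have p': "peval (p' j) x = d * c j" if "j \<in> J" for j
    using pq[OF that] by (simp add: p'_def peval_mult peval_prod d_def prod.remove[OF assms(1) that])
  have "p' j0 \<noteq> 0" using p'[OF assms(4)] assms(5) d by auto
  moreover have "(\<Sum>j\<in>J. peval (p' j) x * w j) = d * (\<Sum>j\<in>J. c j * w j)"
    by (simp add: p' sum_distrib_left mult_ac)
  ultimately show ?thesis using assms(3,4) by auto
qed

lemma subextension_homogeneous_system:
  fixes a :: "'i \<Rightarrow> 'j \<Rightarrow> 'a"
  assumes F: "subextension scale F"
    and "finite I" "finite J" "card I < card J" "\<And>i j. i \<in> I \<Longrightarrow> j \<in> J \<Longrightarrow> a i j \<in> F"
  shows "\<exists>c. (\<forall>j\<in>J. c j \<in> F) \<and> (\<exists>j\<in>J. c j \<noteq> 0) \<and> (\<forall>i\<in>I. (\<Sum>j\<in>J. c j * a i j) = 0)"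
  using assms subextension_subalgebra[OF F]
  by (intro homogeneous_system_solution)
     (auto intro: subextension_inverse subalgebra_1 subalgebra_diff subalgebra_mult)

lemma dependent_if_spanned:
  assumes F: "subextension scale F" and "finite I" "finite J" "card I < card J"
    and a: "\<And>i j. i \<in> I \<Longrightarrow> j \<in> J \<Longrightarrow> a i j \<in> F"
    and w: "\<And>j. j \<in> J \<Longrightarrow> w j = (\<Sum>i\<in>I. a i j * b i)"
  shows "\<exists>c. (\<forall>j\<in>J. c j \<in> F) \<and> (\<exists>j\<in>J. c j \<noteq> 0) \<and> (\<Sum>j\<in>J. c j * w j) = 0"
proof -
  obtain c where c: "\<forall>j\<in>J. c j \<in> F" "\<exists>j\<in>J. c j \<noteq> 0" "\<forall>i\<in>I. (\<Sum>j\<in>J. c j * a i j) = 0"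
    using subextension_homogeneous_system[of F I J a] assms by blast
  have "(\<Sum>j\<in>J. c j * w j) = (\<Sum>j\<in>J. \<Sum>i\<in>I. c j * a i j * b i)"
    by (intro sum.cong) (auto simp: w sum_distrib_left mult_ac)
  also have "\<dots> = (\<Sum>i\<in>I. (\<Sum>j\<in>J. c j * a i j) * b i)"
    by (subst sum.swap) (simp add: sum_distrib_right)
  also have "\<dots> = 0" using c(3) by simp
  finally show ?thesis using c by blast
qed

lemma dep_bound_degree:
  assumes "has_ext_degree (subextension scale hull {x}) UNIV n"
  shows "dep_bound x n"
  unfolding dep_bound_def
proof
  fix w :: "nat \<Rightarrow> 'a"
  let ?F = "subextension scale hull {x}"
  obtain b :: "nat \<Rightarrow> 'a" where "\<forall>y. \<exists>c. (\<forall>i<n. c i \<in> ?F) \<and> y = (\<Sum>i<n. c i * b i)"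
    using assms unfolding has_ext_degree_def by (metis UNIV_I)
  then obtain a where a: "a y i \<in> ?F" "y = (\<Sum>i<n. a y i * b i)" if "i < n" for y i
    by metis
  have a2: "y = (\<Sum>i<n. a y i * b i)" for y
  proof (cases "n = 0")
    case True then show ?thesis using \<open>\<forall>y. _ y\<close> by auto
  qed (use a(2)[of 0] in auto)
  obtain c where c: "\<forall>j\<in>{..n}. c j \<in> ?F" "\<exists>j\<in>{..n}. c j \<noteq> 0" "(\<Sum>j\<le>n. c j * w j) = 0"
    using dependent_if_spanned[OF subextension_hull, of "{..<n}" "{..n}" "\<lambda>i j. a (w j) i" "{x}" w b]
      a(1) a2 by auto
  then show "\<exists>p. (\<exists>j\<le>n. p j \<noteq> 0) \<and> (\<Sum>j\<le>n. peval (p j) x * w j) = 0"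
    using clear_denominators[of "{..n}" c x w] by (auto simp: Bex_def)
qed

end

context curve_function_field
begin

lemma swap_polynomial_sum:
  fixes p :: "nat \<Rightarrow> 'k poly"
  assumes "\<And>j. j \<le> n \<Longrightarrow> degree (p j) \<le> D"
  shows "(\<Sum>j\<le>n. peval (p j) y * x ^ j) = (\<Sum>i\<le>D. peval (\<Sum>j\<le>n. monom (coeff (p j) i) j) x * y ^ i)"
proof -
  have "(\<Sum>j\<le>n. peval (p j) y * x ^ j) = (\<Sum>j\<le>n. \<Sum>i\<le>D. emb (coeff (p j) i) * y ^ i * x ^ j)"
    by (intro sum.cong refl) (simp add: peval_altdef[OF assms] sum_distrib_right)
  also have "\<dots> = (\<Sum>i\<le>D. \<Sum>j\<le>n. emb (coeff (p j) i) * y ^ i * x ^ j)"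
    by (rule sum.swap)
  finally show ?thesis
    by (simp add: peval_sum peval_monom sum_distrib_left sum_distrib_right mult_ac)
qed

text \<open>Let \<open>[K : k(x\<^sub>0)]\<close> be finite.  A relation between \<open>x\<close> and \<open>x\<^sub>0\<close> involves both, so \<open>x\<^sub>0\<close> is
  algebraic over \<open>k(x)\<close>.\<close>

lemma dep_bound_exists:
  assumes x: "x \<notin> constants"
  obtains N where "dep_bound x N"
proof -
  obtain x0 n where x0: "x0 \<notin> constants"
      and deg: "has_ext_degree (subextension scale hull {x0}) UNIV n"
    using function_field unfolding function_field_of_curve_def range_scale_one by blast
  let ?E = "subextension scale hull {x}"
  have E: "subextension scale ?E" by (rule subextension_hull)
  note Esub = subextension_subalgebra[OF E]
  have xE: "x \<in> ?E" by (rule hull_inc) simp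
  obtain p where p: "\<exists>j\<le>n. p j \<noteq> 0" "(\<Sum>j\<le>n. peval (p j) x0 * x ^ j) = 0"
    using dep_bound_degree[OF deg] unfolding dep_bound_def by blast
  define D where "D = (\<Sum>j\<le>n. degree (p j))"
  have D: "degree (p j) \<le> D" if "j \<le> n" for j
    unfolding D_def using that by (intro member_le_sum) auto
  define q where "q i = (\<Sum>j\<le>n. monom (coeff (p j) i) j)" for i
  have q0: "(\<Sum>i\<le>D. peval (q i) x * x0 ^ i) = 0"
    using p(2) swap_polynomial_sum[of n p D x0 x] D by (simp add: q_def)
  obtain j0 where j0: "j0 \<le> n" "p j0 \<noteq> 0" using p(1) by blast
  have "coeff (q i) j = coeff (p j) i" if "j \<le> n" for i j
    using that by (simp add: q_def coeff_sum)
  then have "coeff (q (degree (p j0))) j0 \<noteq> 0" using j0 by simp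
  then have qne: "q (degree (p j0)) \<noteq> 0" by auto
  define d where "d = Max {i. i \<le> D \<and> q i \<noteq> 0}"
  have "d \<in> {i. i \<le> D \<and> q i \<noteq> 0}"
    unfolding d_def using qne D[OF j0(1)] by (intro Max_in) auto
  then have d: "d \<le> D" "q d \<noteq> 0" by auto
  have dmax: "q i = 0" if "d < i" "i \<le> D" for i
  proof (rule ccontr)
    assume "q i \<noteq> 0"
    then have "i \<le> d" unfolding d_def using that by (intro Max_ge) auto
    then show False using that by simp
  qed
  have "(\<Sum>i\<le>D. peval (q i) x * x0 ^ i) = (\<Sum>i\<le>d. peval (q i) x * x0 ^ i)"
    using d(1) dmax by (intro sum.mono_neutral_right) auto
  then have rel: "peval (q d) x * x0 ^ d = - (\<Sum>i<d. peval (q i) x * x0 ^ i)"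
    using q0 by (simp add: lessThan_Suc_atMost[symmetric] eq_neg_iff_add_eq_0 add.commute)
  have qd: "peval (q d) x \<noteq> 0" using d(2) x by (simp add: peval_eq_0_iff)
  define S where "S = {y. \<exists>e. (\<forall>i. e i \<in> ?E) \<and> y = (\<Sum>i<d. e i * x0 ^ i)}"
  have S0: "0 \<in> S" unfolding S_def by (auto intro!: exI[of _ "\<lambda>_. 0"] subalgebra_0 Esub)
  have Sadd: "y + z \<in> S" if yz: "y \<in> S" "z \<in> S" for y z
  proof -
    obtain e e' where "\<forall>i. e i \<in> ?E" "y = (\<Sum>i<d. e i * x0 ^ i)" "\<forall>i. e' i \<in> ?E" "z = (\<Sum>i<d. e' i * x0 ^ i)"
      using yz unfolding S_def by blast
    then show ?thesis unfolding S_def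
      by (intro CollectI exI[of _ "\<lambda>i. e i + e' i"]) (auto simp: sum.distrib algebra_simps intro: subalgebra_add[OF Esub])
  qed
  have Smult: "c * y \<in> S" if cy: "c \<in> ?E" "y \<in> S" for c y
  proof -
    obtain e where "\<forall>i. e i \<in> ?E" "y = (\<Sum>i<d. e i * x0 ^ i)"
      using cy unfolding S_def by blast
    then show ?thesis unfolding S_def using cy
      by (intro CollectI exI[of _ "\<lambda>i. c * e i"]) (auto simp: sum_distrib_left mult_ac intro: subalgebra_mult[OF Esub])
  qed
  have Ssum: "sum f T \<in> S" if "\<And>i. i \<in> T \<Longrightarrow> f i \<in> S" for f and T :: "nat set"
    using that by (induction T rule: infinite_finite_induct) (auto simp: S0 Sadd)
  have Sgen: "x0 ^ i \<in> S" if "i < d" for i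
    unfolding S_def
    using that by (intro CollectI exI[of _ "\<lambda>j. if j = i then 1 else 0"])
      (auto intro: subalgebra_0[OF Esub] subalgebra_1[OF Esub] simp: if_distrib[of "\<lambda>u. u * _"] cong: if_cong)
  have Sd: "x0 ^ d \<in> S"
  proof -
    have "x0 ^ d = (\<Sum>i<d. (- peval (q i) x / peval (q d) x) * x0 ^ i)"
      using rel qd by (simp add: field_simps sum_negf flip: sum_divide_distrib)
    also have "\<dots> \<in> S"
      by (intro Ssum Smult Sgen subextension_divide[OF E] subalgebra_uminus[OF Esub] subalgebra_peval[OF Esub] xE) auto
    finally show ?thesis .
  qed
  have Spow: "x0 ^ i \<in> S" for i
  proof (induction i rule: less_induct)
    case (less i)
    show ?case
    proof (cases "i \<le> d")
      case True then show ?thesis using Sgen Sd by (cases "i = d") auto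
    next
      case False
      then obtain i' where i: "i = Suc i'" "d \<le> i'" by (cases i) auto
      obtain e where e: "\<forall>j. e j \<in> ?E" "x0 ^ i' = (\<Sum>j<d. e j * x0 ^ j)"
        using less[of i'] i unfolding S_def by blast
      have "x0 ^ i = (\<Sum>j<d. e j * x0 ^ Suc j)"
        by (simp add: i e(2) sum_distrib_left mult_ac)
      moreover have "x0 ^ Suc j \<in> S" if "j < d" for j
        using that i by (intro less) auto
      ultimately show ?thesis using e(1) by (auto intro!: Ssum Smult simp del: power_Suc)
    qed
  qed
  have Speval: "peval r x0 \<in> S" for r
    unfolding peval_altdef[OF order_refl]
    by (intro Ssum Smult Spow subalgebra_emb[OF Esub])
  obtain b :: "nat \<Rightarrow> 'a"
    where "\<forall>y. \<exists>c. (\<forall>i<n. c i \<in> subextension scale hull {x0}) \<and> y = (\<Sum>i<n. c i * b i)"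
    using deg unfolding has_ext_degree_def by (metis UNIV_I)
  then obtain a where a: "\<And>y i. i < n \<Longrightarrow> a y i \<in> subextension scale hull {x0}"
      "\<And>y. y = (\<Sum>i<n. a y i * b i)"
    by metis
  have "\<forall>y. \<forall>i<n. \<exists>u v. a y i = peval u x0 / peval v x0 \<and> peval v x0 \<noteq> 0"
    using a(1) unfolding subextension_hull_singleton by blast
  then obtain u v where uv: "\<And>y i. i < n \<Longrightarrow> a y i = peval (u y i) x0 / peval (v y i) x0"
     "\<And>y i. i < n \<Longrightarrow> peval (v y i) x0 \<noteq> 0"
    by metis
  define N where "N = n * d"
  have "dep_bound x N"
    unfolding dep_bound_def
  proof
    fix w :: "nat \<Rightarrow> 'a"
    define Q where "Q = (\<Prod>(j,l)\<in>{..N} \<times> {..<n}. peval (v (w j) l) x0)"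
    have Q: "Q \<noteq> 0" unfolding Q_def using uv(2) by auto
    have QS: "Q * a (w j) l \<in> S" if "j \<le> N" "l < n" for j l
    proof -
      let ?T = "{..N} \<times> {..<n} - {(j,l)}"
      have "Q = peval (v (w j) l) x0 * (\<Prod>(j,l)\<in>?T. peval (v (w j) l) x0)"
        unfolding Q_def using that by (subst prod.remove[of _ "(j,l)"]) auto
      then have "Q * a (w j) l = peval (u (w j) l * (\<Prod>(j,l)\<in>?T. v (w j) l)) x0"
        using uv[OF that(2), of "w j"] by (simp add: peval_mult peval_prod case_prod_beta)
      then show ?thesis using Speval by simp
    qed
    then have "\<forall>j l. \<exists>e. j \<le> N \<longrightarrow> l < n \<longrightarrow> (\<forall>i. e i \<in> ?E) \<and> Q * a (w j) l = (\<Sum>i<d. e i * x0 ^ i)"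
      unfolding S_def by blast
    then obtain e where e: "\<And>j l i. j \<le> N \<Longrightarrow> l < n \<Longrightarrow> e j l i \<in> ?E"
        "\<And>j l. j \<le> N \<Longrightarrow> l < n \<Longrightarrow> Q * a (w j) l = (\<Sum>i<d. e j l i * x0 ^ i)"
      by metis
    have Qw: "Q * w j = (\<Sum>(l,i)\<in>{..<n} \<times> {..<d}. e j l i * (x0 ^ i * b l))" if "j \<le> N" for j
    proof -
      have "Q * w j = (\<Sum>l<n. Q * a (w j) l * b l)"
        by (subst a(2)[of "w j"]) (simp add: sum_distrib_left mult_ac)
      also have "\<dots> = (\<Sum>l<n. \<Sum>i<d. e j l i * (x0 ^ i * b l))"
        using e(2) that by (intro sum.cong) (auto simp: sum_distrib_left mult_ac)
      finally show ?thesis by (simp add: sum.cartesian_product)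
    qed
    have "\<exists>c. (\<forall>j\<in>{..N}. c j \<in> ?E) \<and> (\<exists>j\<in>{..N}. c j \<noteq> 0) \<and> (\<Sum>j\<le>N. c j * (Q * w j)) = 0"
      by (rule dependent_if_spanned[OF E, where I = "{..<n} \<times> {..<d}"
            and a = "\<lambda>(l,i) j. e j l i" and b = "\<lambda>(l,i). x0 ^ i * b l"])
        (auto simp: N_def e(1) Qw case_prod_beta)
    then obtain c where c: "\<forall>j\<in>{..N}. c j \<in> ?E" "\<exists>j\<in>{..N}. c j \<noteq> 0" "(\<Sum>j\<le>N. c j * (Q * w j)) = 0"
      by blast
    have "(\<Sum>j\<le>N. c j * (Q * w j)) = Q * (\<Sum>j\<le>N. c j * w j)"
      by (simp add: sum_distrib_left mult_ac)
    then have "(\<Sum>j\<le>N. c j * w j) = 0" using c(3) Q by simp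
    then show "\<exists>p. (\<exists>j\<le>N. p j \<noteq> 0) \<and> (\<Sum>j\<le>N. peval (p j) x * w j) = 0"
      using c(1,2) clear_denominators[of "{..N}" c x w] by (auto simp: Bex_def)
  qed
  then show ?thesis by (rule that)
qed

text \<open>A relation over \<open>k[b]\<close> can be divided by a power of \<open>b\<close> until its value at \<open>b = 0\<close> is not
  trivial; that value is a relation modulo \<open>b\<close>.\<close>

lemma relation_not_divisible:
  assumes "b \<noteq> 0" "(\<Sum>j\<in>J. peval (p j) b * w j) = 0" "j0 \<in> J" "p j0 \<noteq> 0"
  shows "\<exists>p'. (\<exists>j\<in>J. coeff (p' j) 0 \<noteq> 0) \<and> (\<Sum>j\<in>J. peval (p' j) b * w j) = 0"
  using assms(2,4)
proof (induction "degree (p j0)" arbitrary: p rule: less_induct)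
  case less
  show ?case
  proof (cases "\<exists>j\<in>J. coeff (p j) 0 \<noteq> 0")
    case False
    define p' where "p' j = poly_shift 1 (p j)" for j
    have p: "p j = pCons 0 (p' j)" if "j \<in> J" for j
      using that False by (intro poly_eqI) (auto simp: p'_def coeff_poly_shift coeff_pCons split: nat.split)
    have "(\<Sum>j\<in>J. peval (p j) b * w j) = b * (\<Sum>j\<in>J. peval (p' j) b * w j)"
      by (simp add: p sum_distrib_left mult_ac)
    moreover have "p' j0 \<noteq> 0" "degree (p' j0) < degree (p j0)" using p[OF assms(3)] less.prems(2) by auto
    ultimately show ?thesis using less.hyps[of p'] less.prems assms(1) by auto
  qed (use less.prems in blast)
qed

lemma dependent_mod:
  assumes b: "b \<noteq> 0" and J: "subspace J" "\<And>x. x \<in> J \<Longrightarrow> b * x \<in> J"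
    and w: "\<And>j. j \<in> T \<Longrightarrow> w j \<in> J"
    and rel: "(\<Sum>j\<in>T. peval (p j) b * w j) = 0" "j0 \<in> T" "p j0 \<noteq> 0"
  shows "\<exists>c. (\<exists>j\<in>T. c j \<noteq> 0) \<and> (\<exists>y\<in>J. (\<Sum>j\<in>T. emb (c j) * w j) = b * y)"
proof -
  obtain p' where p': "\<exists>j\<in>T. coeff (p' j) 0 \<noteq> 0" "(\<Sum>j\<in>T. peval (p' j) b * w j) = 0"
    using relation_not_divisible[OF b rel] by blast
  define r where "r j = poly_shift 1 (p' j)" for j
  have r: "p' j = pCons (coeff (p' j) 0) (r j)" for j
    by (intro poly_eqI) (auto simp: r_def coeff_poly_shift coeff_pCons split: nat.split)
  have in_J: "peval q b * x \<in> J" if "x \<in> J" for q x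
    using that
  proof (induction q)
    case (pCons c q)
    have "peval (pCons c q) b * x = scale c x + b * (peval q b * x)"
      by (simp add: scale_eq algebra_simps)
    then show ?case using pCons J by (simp add: subspace_add subspace_scale)
  qed (auto intro: subspace_0 J)
  have "0 = (\<Sum>j\<in>T. peval (pCons (coeff (p' j) 0) (r j)) b * w j)"
    using p'(2) r by simp
  also have "\<dots> = (\<Sum>j\<in>T. emb (coeff (p' j) 0) * w j) + b * (\<Sum>j\<in>T. peval (r j) b * w j)"
    by (simp add: algebra_simps sum.distrib sum_distrib_left)
  finally have "(\<Sum>j\<in>T. emb (coeff (p' j) 0) * w j) = b * (- (\<Sum>j\<in>T. peval (r j) b * w j))"
    by (simp add: eq_neg_iff_add_eq_0)
  moreover have "- (\<Sum>j\<in>T. peval (r j) b * w j) \<in> J"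
    by (intro subspace_neg subspace_sum J in_J w)
  ultimately show ?thesis using p'(1) by (intro exI[of _ "\<lambda>j. coeff (p' j) 0"]) blast
qed

text \<open>The upper bound for residue dimensions: if \<open>[K : k(b)] \<le> N\<close> then \<open>dim J / b J \<le> N\<close>.\<close>

lemma dep_bound_mod:
  assumes "dep_bound b N" "b \<noteq> 0" "subspace J" "\<And>x. x \<in> J \<Longrightarrow> b * x \<in> J" "\<And>j. j \<le> N \<Longrightarrow> w j \<in> J"
  shows "\<exists>c. (\<exists>j\<le>N. c j \<noteq> 0) \<and> (\<exists>y\<in>J. (\<Sum>j\<le>N. emb (c j) * w j) = b * y)"
proof -
  obtain p where "\<exists>j\<le>N. p j \<noteq> 0" "(\<Sum>j\<le>N. peval (p j) b * w j) = 0"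
    using assms(1) unfolding dep_bound_def by blast
  then obtain j0 where "j0 \<in> {..N}" "p j0 \<noteq> 0" "(\<Sum>j\<le>N. peval (p j) b * w j) = 0" by auto
  then show ?thesis
    using dependent_mod[OF assms(2-4), of "{..N}" w p j0] assms(5) by (simp add: Bex_def)
qed

section \<open>Valuation rings\<close>


definition valuation :: "'a set \<Rightarrow> bool" where
  "valuation R \<longleftrightarrow> valuation_ring scale R \<and> R \<noteq> UNIV"

lemma valuation_subalgebra: "valuation R \<Longrightarrow> subalgebra scale R"
  and valuation_cases: "valuation R \<Longrightarrow> x \<in> R \<or> inverse x \<in> R"
  by (auto simp: valuation_def valuation_ring_def)

lemma nonunits_iff: "x \<in> nonunits R \<longleftrightarrow> x \<in> R \<and> (x = 0 \<or> inverse x \<notin> R)"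
  by (simp add: nonunits_def)

lemma subalgebra_adjoin:
  assumes "subalgebra scale A"
  shows "subalgebra scale {poly p x | p. \<forall>i. coeff p i \<in> A}"
proof (rule subalgebraI)
  let ?B = "{poly p x | p. \<forall>i. coeff p i \<in> A}"
  note cl = subalgebra_closed[OF assms]
  show "emb c \<in> ?B" for c
    by (intro CollectI exI[of _ "[:emb c:]"]) (auto simp: coeff_pCons cl split: nat.split)
  fix y z assume "y \<in> ?B" "z \<in> ?B"
  then obtain p q where p: "y = poly p x" "\<forall>i. coeff p i \<in> A" and q: "z = poly q x" "\<forall>i. coeff q i \<in> A"
    by blast
  show "y + z \<in> ?B" using p q by (intro CollectI exI[of _ "p + q"]) (auto intro: cl)
  show "y * z \<in> ?B" using p q
    by (intro CollectI exI[of _ "p * q"]) (auto simp: coeff_mult intro: cl subalgebra_sum[OF assms])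
qed

lemma adjoin_contains:
  assumes "subalgebra scale A"
  shows "A \<subseteq> {poly p x | p. \<forall>i. coeff p i \<in> A}" "x \<in> {poly p x | p. \<forall>i. coeff p i \<in> A}"
proof -
  note cl = subalgebra_closed[OF assms]
  show "A \<subseteq> {poly p x | p. \<forall>i. coeff p i \<in> A}"
  proof
    fix a assume "a \<in> A"
    then show "a \<in> {poly p x | p. \<forall>i. coeff p i \<in> A}"
      by (intro CollectI exI[of _ "[:a:]"]) (auto simp: coeff_pCons cl split: nat.split)
  qed
  show "x \<in> {poly p x | p. \<forall>i. coeff p i \<in> A}"
    by (intro CollectI exI[of _ "[:0, 1:]"]) (auto simp: coeff_pCons cl split: nat.split)
qed

text \<open>Adjoin to \<open>A\<close> as much as possible without making \<open>c\<close> invertible.  If neither \<open>x\<close> nor \<open>1/x\<close> is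
  in the resulting ring, then \<open>1/c\<close> is a polynomial in \<open>x\<close> and one in \<open>1/x\<close>; of the two expressions,
  the one of smaller degree lowers the degree of the other.\<close>

lemma valuation_extension:
  assumes A: "subalgebra scale A" and c: "c \<in> A" "c \<noteq> 0" "inverse c \<notin> A"
  obtains R where "valuation R" "A \<subseteq> R" "c \<in> nonunits R"
proof -
  let ?S = "{B. subalgebra scale B \<and> A \<subseteq> B \<and> inverse c \<notin> B}"
  have "\<exists>B\<in>?S. \<forall>X\<in>?S. B \<subseteq> X \<longrightarrow> X = B"
  proof (rule subset_Zorn_nonempty)
    show "?S \<noteq> {}" using A c by auto
    fix \<C> assume C: "\<C> \<noteq> {}" "subset.chain ?S \<C>"
    then have sub: "\<C> \<subseteq> ?S" and ch: "\<And>X Y. X \<in> \<C> \<Longrightarrow> Y \<in> \<C> \<Longrightarrow> X \<subseteq> Y \<or> Y \<subseteq> X"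
      by (auto simp: subset.chain_def subset_chain_def)
    have "subalgebra scale (\<Union>\<C>)"
    proof (rule subalgebraI)
      fix d obtain X where "X \<in> \<C>" using C(1) by blast
      then show "emb d \<in> \<Union>\<C>" using sub subalgebra_emb by blast
    next
      fix x y assume "x \<in> \<Union>\<C>" "y \<in> \<Union>\<C>"
      then obtain X where X: "X \<in> \<C>" "x \<in> X" "y \<in> X" using ch by blast
      then have "subalgebra scale X" using sub by blast
      then show "x + y \<in> \<Union>\<C>" "x * y \<in> \<Union>\<C>" using X subalgebra_add subalgebra_mult by blast+
    qed
    then show "\<Union>\<C> \<in> ?S" using sub C(1) by blast
  qed
  then obtain B where "B \<in> ?S" and max': "\<forall>X\<in>?S. B \<subseteq> X \<longrightarrow> X = B" by (rule bexE)
  then have B: "subalgebra scale B" "A \<subseteq> B" "inverse c \<notin> B" by simp_all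
  have max: "X = B" if "subalgebra scale X" "B \<subseteq> X" "inverse c \<notin> X" for X
    using max' that B(2) by simp
  have cB: "c \<in> B" using B c by blast
  note cl = subalgebra_closed[OF B(1)]
  let ?P = "\<lambda>p. \<forall>i. coeff p i \<in> B"
  have adj: "\<exists>p. ?P p \<and> inverse c = poly p y" if "y \<notin> B" for y
    using max[OF subalgebra_adjoin[OF B(1)] adjoin_contains(1)[OF B(1)], of y]
      adjoin_contains(2)[OF B(1), of y] that by blast
  have unit: "inverse (1 - c * b) \<in> B" if b: "b \<in> B" for b
  proof (rule ccontr)
    assume "inverse (1 - c * b) \<notin> B"
    then obtain p where p: "?P p" "inverse c = poly p (inverse (1 - c * b))" using adj by blast
    have ne: "1 - c * b \<noteq> 0" using B(3) b inverse_unique[of c b] by auto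
    define n where "n = degree p"
    have "(1 - c * b) ^ n * inverse c = (\<Sum>i\<le>n. coeff p i * (1 - c * b) ^ (n - i))"
      unfolding p(2) poly_altdef n_def sum_distrib_left
      by (intro sum.cong refl) (use ne in \<open>auto simp: power_diff field_simps\<close>)
    also have "\<dots> \<in> B" using p b cB by (intro subalgebra_sum[OF B(1)] cl) auto
    finally have 1: "(1 - c * b) ^ n * inverse c \<in> B" .
    have "\<exists>b'\<in>B. (1 - c * b) ^ n = 1 - c * b'" for n
    proof (induction n)
      case 0 show ?case by (auto intro!: bexI[of _ 0] cl)
    next
      case (Suc n)
      then obtain b' where "b' \<in> B" "(1 - c * b) ^ n = 1 - c * b'" by blast
      then have "(1 - c * b) ^ Suc n = 1 - c * (b + b' - c * b * b')"
        by (simp only: power_Suc) (simp add: algebra_simps)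
      moreover have "b + b' - c * b * b' \<in> B" using b cB \<open>b' \<in> B\<close> by (intro cl)
      ultimately show ?case by blast
    qed
    then obtain b' where b': "b' \<in> B" "(1 - c * b) ^ n = 1 - c * b'" by blast
    have "inverse c = (1 - c * b) ^ n * inverse c + b'" using c(2) b'(2) by (simp add: field_simps)
    then have "inverse c \<in> B" using 1 b' cl by metis
    then show False using B(3) by simp
  qed
  have lower: "\<exists>r. ?P r \<and> degree r < degree p \<and> inverse c = poly r y"
    if p: "?P p" "inverse c = poly p y" and q: "?P q" "inverse c = poly q (inverse y)"
      and le: "degree q \<le> degree p" and y: "y \<noteq> 0" for p q y
  proof -
    define n m where "n = degree p" and "m = degree q"
    have m0: "m \<noteq> 0"
    proof
      assume "m = 0"
      then obtain a where "q = [:a:]" unfolding m_def by (metis degree_eq_zeroE)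
      then show False using q B(3) by (auto simp: coeff_pCons split: nat.splits)
    qed
    have n0: "n \<noteq> 0" using m0 le by (simp add: n_def m_def)
    define u where "u = inverse (1 - c * coeff q 0)"
    have uB: "u \<in> B" unfolding u_def using unit q by blast
    have ne: "1 - c * coeff q 0 \<noteq> 0" using B(3) q inverse_unique[of c "coeff q 0"] by auto
    have "poly q (inverse y) = coeff q 0 + (\<Sum>i=1..m. coeff q i * inverse y ^ i)"
      unfolding poly_altdef m_def atMost_atLeast0 by (subst sum.atLeast_Suc_atMost) auto
    then have "inverse c - coeff q 0 = (\<Sum>i=1..m. coeff q i * inverse y ^ i)"
      using q(2) by (metis add_diff_cancel_left')
    moreover have "inverse c * (1 - c * coeff q 0) = inverse c - coeff q 0"
      using c(2) by (simp add: algebra_simps)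
    ultimately have "inverse c * (1 - c * coeff q 0) = (\<Sum>i=1..m. coeff q i * inverse y ^ i)"
      by metis
    then have ic: "inverse c = u * (\<Sum>i=1..m. coeff q i * inverse y ^ i)"
      using ne unfolding u_def by (simp add: field_simps)
    \<comment> \<open>the leading term of \<open>p\<close> at \<open>y\<close>, rewritten with smaller exponents\<close>
    define s where "s = (\<Sum>i=1..m. monom (c * coeff p n * u * coeff q i) (n - i))"
    define r where "r = p - monom (coeff p n) n + s"
    have "coeff p n * y ^ n = c * coeff p n * y ^ n * inverse c" using c(2) by simp
    also have "\<dots> = (\<Sum>i=1..m. c * coeff p n * u * coeff q i * y ^ (n - i))"
      unfolding ic using y le
      by (auto simp: sum_distrib_left n_def m_def power_diff power_inverse divide_inverse mult_ac intro!: sum.cong)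
    also have "\<dots> = poly s y" by (simp add: s_def poly_sum poly_monom)
    finally have "poly r y = inverse c" using p(2) by (simp add: r_def poly_monom)
    moreover have "?P r" unfolding r_def s_def
      using p(1) q(1) uB cB by (auto simp: coeff_sum intro!: cl subalgebra_sum[OF B(1)])
    moreover have "degree r < n"
    proof -
      have "degree s \<le> n - 1" unfolding s_def
        by (intro degree_sum_le) (auto intro: order_trans[OF degree_monom_le])
      moreover have "degree (p - monom (coeff p n) n) \<le> n - 1"
      proof (intro degree_le allI impI)
        fix i assume "n - 1 < i"
        then show "coeff (p - monom (coeff p n) n) i = 0"
          by (cases "i = n") (auto simp: n_def coeff_eq_0)
      qed
      ultimately have "degree r \<le> n - 1" unfolding r_def by (intro degree_add_le)
      then show ?thesis using n0 by simp
    qed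
    ultimately show ?thesis by (auto simp: n_def)
  qed
  have val: "x \<in> B \<or> inverse x \<in> B" for x
  proof (rule ccontr)
    assume "\<not> (x \<in> B \<or> inverse x \<in> B)"
    then have x: "x \<notin> B" "inverse x \<notin> B" by auto
    then have x0: "x \<noteq> 0" using cl by auto
    have "\<not> (?P p \<and> ?P q \<and> inverse c = poly p x \<and> inverse c = poly q (inverse x))" for p q
    proof (induction "degree p + degree q" arbitrary: p q rule: less_induct)
      case less
      show ?case
      proof
        assume A: "?P p \<and> ?P q \<and> inverse c = poly p x \<and> inverse c = poly q (inverse x)"
        show False
        proof (cases "degree q \<le> degree p")
          case True
          then obtain r where "?P r" "degree r < degree p" "inverse c = poly r x"
            using lower[of p x q] A x0 by blast
          then show False using less[of r q] A by auto
        next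
          case False
          then obtain r where "?P r" "degree r < degree q" "inverse c = poly r (inverse x)"
            using lower[of q "inverse x" p] A x0 by auto
          then show False using less[of p r] A by auto
        qed
      qed
    qed
    then show False using adj[OF x(1)] adj[OF x(2)] by (elim exE) blast
  qed
  have "valuation B" using B val by (auto simp: valuation_def valuation_ring_def)
  then show ?thesis using that[of B] B cB by (auto simp: nonunits_iff)
qed

end

lemma infinite_alg_closed: "infinite (UNIV :: 'k::alg_closed_field set)"
proof
  assume fin: "finite (UNIV :: 'k set)"
  define p where "p = (\<Prod>s\<in>(UNIV :: 'k set). [:- s, 1:]) + 1"
  have "degree (\<Prod>s\<in>(UNIV :: 'k set). [:- s, 1:]) = card (UNIV :: 'k set)"
    by (subst degree_prod_eq_sum_degree) auto
  moreover have "card (UNIV :: 'k set) > 0" using fin by (simp add: card_gt_0_iff)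
  ultimately have "degree p > 0" unfolding p_def by (subst degree_add_eq_left) auto
  then obtain r where "poly p r = 0" using alg_closed_imp_poly_has_root by blast
  moreover have "poly (\<Prod>s\<in>(UNIV :: 'k set). [:- s, 1:]) r = 0"
    using fin by (simp add: poly_prod)
  ultimately show False by (simp add: p_def)
qed

context curve_function_field
begin

subsection \<open>Local rings with residue field \<open>k\<close>\<close>

text \<open>What the closed points of a curve and the valuation rings have in common: they are local
  \<open>k\<close>-algebras, different from their quotient field \<open>K\<close>, with residue field \<open>k\<close>.\<close>

definition point_ring :: "'a set \<Rightarrow> bool" where
  "point_ring P \<longleftrightarrow> subalgebra scale P \<and> P \<noteq> UNIV \<and>
     (\<forall>x\<in>nonunits P. \<forall>y\<in>nonunits P. x + y \<in> nonunits P) \<and>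
     (\<forall>x\<in>P. \<exists>c. x - emb c \<in> nonunits P) \<and> (\<forall>x. \<exists>a\<in>P. \<exists>d\<in>P. d \<noteq> 0 \<and> x = a / d)"

lemma nonunits_subset: "nonunits R \<subseteq> R" and zero_in_nonunits: "0 \<in> R \<Longrightarrow> 0 \<in> nonunits R"
  by (auto simp: nonunits_def)

lemma nonunits_mult:
  assumes "subalgebra scale P" "a \<in> P" "x \<in> nonunits P"
  shows "a * x \<in> nonunits P"
proof -
  have "inverse (a * x) \<notin> P" if "a * x \<noteq> 0"
  proof
    assume "inverse (a * x) \<in> P"
    then have "a * inverse (a * x) \<in> P" using assms subalgebra_mult by blast
    moreover have "a * inverse (a * x) = inverse x" using that by (simp add: field_simps)
    ultimately have "inverse x \<in> P" by metis
    then show False using assms that by (auto simp: nonunits_iff)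
  qed
  then show ?thesis using assms by (auto simp: nonunits_iff intro: subalgebra_mult)
qed

lemma unit_inverse: "x \<in> P \<Longrightarrow> x \<notin> nonunits P \<Longrightarrow> inverse x \<in> P"
  by (auto simp: nonunits_iff)

lemma nonunits_emb: "subalgebra scale P \<Longrightarrow> emb c \<in> nonunits P \<Longrightarrow> c = 0"
  by (auto simp: nonunits_iff subalgebra_emb simp flip: emb_inverse)

lemma one_not_nonunit: "subalgebra scale P \<Longrightarrow> 1 \<notin> nonunits P"
  using nonunits_emb[of P 1] by auto

lemma nonunits_nonconstant: "subalgebra scale P \<Longrightarrow> x \<in> nonunits P \<Longrightarrow> x \<noteq> 0 \<Longrightarrow> x \<notin> constants"
  by (auto simp: constants_iff dest: nonunits_emb)

lemma nonunits_prime: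
  assumes "subalgebra scale P" "x \<in> P" "y \<in> P" "x * y \<in> nonunits P"
  shows "x \<in> nonunits P \<or> y \<in> nonunits P"
proof (rule ccontr)
  assume "\<not> (x \<in> nonunits P \<or> y \<in> nonunits P)"
  then have "inverse x \<in> P" "inverse y \<in> P" "x \<noteq> 0" "y \<noteq> 0"
    using assms by (auto simp: nonunits_iff)
  then show False using assms subalgebra_mult[of P "inverse x" "inverse y"]
    by (auto simp: nonunits_iff)
qed

lemma nonunits_power: "subalgebra scale P \<Longrightarrow> x \<in> nonunits P \<Longrightarrow> n > 0 \<Longrightarrow> x ^ n \<in> nonunits P"
  using nonunits_mult[of P "x ^ (n - 1)" x] nonunits_subset[of P]
  by (cases n) (auto intro: subalgebra_power simp: mult.commute)

context
  fixes P assumes P: "point_ring P"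
begin

lemma point_ring_subalgebra: "subalgebra scale P"
  and point_ring_proper: "P \<noteq> UNIV"
  and point_ring_add: "x \<in> nonunits P \<Longrightarrow> y \<in> nonunits P \<Longrightarrow> x + y \<in> nonunits P"
  and point_ring_residue: "x \<in> P \<Longrightarrow> \<exists>c. x - emb c \<in> nonunits P"
  and point_ring_fraction: "\<exists>a\<in>P. \<exists>d\<in>P. d \<noteq> 0 \<and> x = a / d"
  using P unfolding point_ring_def by blast+

lemma point_ring_uminus: "x \<in> nonunits P \<Longrightarrow> - x \<in> nonunits P"
  using nonunits_mult[OF point_ring_subalgebra, of "-1" x] point_ring_subalgebra
    by (auto intro: subalgebra_uminus subalgebra_1)

lemma point_ring_diff: "x \<in> nonunits P \<Longrightarrow> y \<in> nonunits P \<Longrightarrow> x - y \<in> nonunits P"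
  using point_ring_add[of x "- y"] point_ring_uminus[of y] by simp

lemma point_ring_sum: "(\<And>i. i \<in> S \<Longrightarrow> f i \<in> nonunits P) \<Longrightarrow> sum f S \<in> nonunits P"
  by (induction S rule: infinite_finite_induct)
    (auto intro: point_ring_add zero_in_nonunits subalgebra_0[OF point_ring_subalgebra])

lemma point_ring_unit_add:
  assumes "x \<in> nonunits P" "c \<noteq> 0"
  shows "x + emb c \<in> P" "x + emb c \<noteq> 0" "inverse (x + emb c) \<in> P" "x + emb c \<notin> nonunits P"
proof -
  note sub = point_ring_subalgebra
  show 1: "x + emb c \<in> P"
    using assms nonunits_subset sub by (blast intro: subalgebra_add subalgebra_emb)
  show 2: "x + emb c \<notin> nonunits P"
  proof
    assume "x + emb c \<in> nonunits P"
    then have "emb c \<in> nonunits P" using point_ring_diff[of "x + emb c" x] assms by simp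
    then show False using assms sub nonunits_emb by blast
  qed
  show "x + emb c \<noteq> 0" using 2 zero_in_nonunits[OF subalgebra_0[OF sub]] by auto
  show "inverse (x + emb c) \<in> P" using 1 2 by (rule unit_inverse)
qed

lemma point_ring_nonunit_exists: obtains z where "z \<in> nonunits P" "z \<noteq> 0"
proof -
  obtain x where x: "x \<notin> P" using point_ring_proper by auto
  obtain a d where "a \<in> P" "d \<in> P" "d \<noteq> 0" "x = a / d" using point_ring_fraction by blast
  then have "inverse d \<notin> P"
    using x subalgebra_mult[OF point_ring_subalgebra, of a "inverse d"] by (auto simp: divide_inverse)
  then show ?thesis using that[of d] \<open>d \<in> P\<close> \<open>d \<noteq> 0\<close> by (simp add: nonunits_iff)
qed

end

text \<open>An element \<open>y\<close> and a nonunit \<open>b\<close> satisfy an algebraic equation whose value at \<open>b = 0\<close> is not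
  trivial, so the residue of \<open>y\<close> is algebraic over \<open>k\<close>.\<close>

lemma valuation_point_ring:
  assumes R: "valuation R"
  shows "point_ring R"
  unfolding point_ring_def
proof (intro conjI ballI allI)
  note sub = valuation_subalgebra[OF R]
  note cl = subalgebra_closed[OF sub]
  show "subalgebra scale R" by (rule sub)
  show "R \<noteq> UNIV" using R by (simp add: valuation_def)
  show add: "x + y \<in> nonunits R" if xy: "x \<in> nonunits R" "y \<in> nonunits R" for x y
  proof -
    have *: "x + y \<in> nonunits R" if "x \<in> nonunits R" "y \<in> nonunits R" "x / y \<in> R" "y \<noteq> 0" for x y
    proof -
      have "(x / y + 1) * y \<in> nonunits R" using that by (intro nonunits_mult[OF sub] cl)
      moreover have "(x / y + 1) * y = x + y" using that(4) by (simp add: distrib_right)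
      ultimately show ?thesis by metis
    qed
    show ?thesis
    proof (cases "x = 0 \<or> y = 0")
      case False
      moreover have "inverse (x / y) = y / x" by simp
      ultimately show ?thesis
        using valuation_cases[OF R, of "x / y"] *[of x y] *[of y x] xy by (auto simp: add.commute)
    qed (use xy in auto)
  qed
  show "\<exists>c. x - emb c \<in> nonunits R" if x: "x \<in> R" for x
  proof -
    obtain z where z: "z \<notin> R" using R by (auto simp: valuation_def)
    define b where "b = inverse z"
    have b: "b \<in> nonunits R" "b \<noteq> 0"
      using z valuation_cases[OF R, of z] cl by (auto simp: nonunits_iff b_def)
    obtain N where N: "dep_bound b N" using dep_bound_exists nonunits_nonconstant[OF sub b] by blast
    obtain c y where c: "\<exists>j\<le>N. c j \<noteq> 0" "y \<in> R" "(\<Sum>j\<le>N. emb (c j) * x ^ j) = b * y"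
      using dep_bound_mod[OF N b(2) subalgebra_subspace[OF sub], of "\<lambda>j. x ^ j"] x
        b(1) nonunits_subset[of R] by (auto intro!: cl)
    define q where "q = (\<Sum>j\<le>N. monom (c j) j)"
    have "coeff q j = c j" if "j \<le> N" for j using that by (simp add: q_def coeff_sum)
    then have "q \<noteq> 0" using c(1) by auto
    moreover have "peval q x = y * b" using c(3) by (simp add: q_def peval_sum peval_monom mult.commute)
    ultimately show ?thesis
      using prime_contains_root[of R "nonunits R" x q] nonunits_prime[OF sub] nonunits_emb[OF sub]
        sub x nonunits_mult[OF sub c(2) b(1)] by auto
  qed
  show "\<exists>a\<in>R. \<exists>d\<in>R. d \<noteq> 0 \<and> x = a / d" for x
  proof (cases "x \<in> R")
    case True then show ?thesis using cl by (intro bexI[of _ x] bexI[of _ 1]) auto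
  next
    case False
    then have "x \<noteq> 0" "inverse x \<in> R" using cl valuation_cases[OF R, of x] by auto
    moreover have "x = 1 / inverse x" by (simp add: divide_inverse)
    ultimately show ?thesis using cl(2) by (metis nonzero_imp_inverse_nonzero)
  qed
qed

text \<open>A nonunit \<open>y\<close> of \<open>P\<close> has a residue in \<open>R\<close>, and \<open>y - \<beta>\<close> is a unit of \<open>P\<close> unless \<open>\<beta> = 0\<close>.
  So rings with residue field \<open>k\<close> dominate as soon as they contain.\<close>

lemma dominates_if_subset:
  assumes P: "point_ring P" and R: "point_ring R" and "P \<subseteq> R"
  shows "dominates R P"
  unfolding dominates_def
proof (intro conjI subsetI)
  fix y assume y: "y \<in> nonunits P"
  then have "y \<in> R" using nonunits_subset assms(3) by blast
  then obtain \<beta> where b: "y - emb \<beta> \<in> nonunits R" using point_ring_residue[OF R] by blast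
  have "\<beta> = 0"
  proof (rule ccontr)
    assume "\<beta> \<noteq> 0"
    then have "inverse (y - emb \<beta>) \<in> P" "y - emb \<beta> \<noteq> 0"
      using point_ring_unit_add[OF P y, of "- \<beta>"] by (auto simp: emb_minus)
    then show False using b assms(3) by (auto simp: nonunits_iff)
  qed
  then show "y \<in> nonunits R" using b by simp
qed (use assms in auto)

lemma dominating_valuation_exists:
  assumes P: "point_ring P"
  obtains R where "valuation R" "dominates R P"
proof -
  obtain z where "z \<in> nonunits P" "z \<noteq> 0" using point_ring_nonunit_exists[OF P] .
  then obtain R where "valuation R" "P \<subseteq> R"
    using valuation_extension[OF point_ring_subalgebra[OF P], of z] by (auto simp: nonunits_iff)
  then show ?thesis using that[of R] dominates_if_subset P valuation_point_ring by blast
qed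

text \<open>Dimension one: if \<open>1/c\<close> were not in \<open>P[1/b]\<close>, some valuation ring would contain \<open>P[1/b]\<close> and
  have \<open>c\<close> as a nonunit; it dominates \<open>P\<close>, although the nonunit \<open>b\<close> of \<open>P\<close> is a unit in it.\<close>

lemma nonunit_power_absorbs:
  assumes P: "point_ring P" and b: "b \<in> nonunits P"
  obtains N where "\<And>n. n \<ge> N \<Longrightarrow> b ^ n * u \<in> P"
proof (cases "b = 0")
  case True
  have "b ^ n * u \<in> P" if "n \<ge> 1" for n
    using True that subalgebra_0[OF point_ring_subalgebra[OF P]] by (cases n) auto
  then show ?thesis using that[of 1] by blast
next
  case b0: False
  note sub = point_ring_subalgebra[OF P]
  note cl = subalgebra_closed[OF sub]
  have bP: "b \<in> P" using b nonunits_subset by blast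
  define A where "A = {y. \<exists>N. b ^ N * y \<in> P}"
  have up: "b ^ n * y \<in> P" if "b ^ N * y \<in> P" "N \<le> n" for N n y
  proof -
    have "b ^ n * y = b ^ (n - N) * (b ^ N * y)"
      using that(2) by (simp add: mult.assoc[symmetric] power_add[symmetric])
    also have "\<dots> \<in> P" using subalgebra_mult[OF sub cl(8)[OF bP] that(1)] .
    finally show ?thesis .
  qed
  have A: "subalgebra scale A"
  proof (rule subalgebraI)
    show "emb c \<in> A" for c unfolding A_def using cl(7) by (auto intro!: exI[of _ 0])
    fix y z assume "y \<in> A" "z \<in> A"
    then obtain N M where N: "b ^ N * y \<in> P" and M: "b ^ M * z \<in> P" unfolding A_def by blast
    have "b ^ (N + M) * y \<in> P" "b ^ (N + M) * z \<in> P" using up[OF N] up[OF M] by auto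
    then have "b ^ (N + M) * y + b ^ (N + M) * z \<in> P" by (rule cl)
    then show "y + z \<in> A" unfolding A_def by (auto simp: algebra_simps)
    have "(b ^ N * y) * (b ^ M * z) \<in> P" using N M by (rule cl)
    moreover have "(b ^ N * y) * (b ^ M * z) = b ^ (N + M) * (y * z)" by (simp add: power_add mult_ac)
    ultimately show "y * z \<in> A" unfolding A_def by auto
  qed
  have PA: "P \<subseteq> A" unfolding A_def by (auto intro: exI[of _ 0])
  have bA: "inverse b \<in> A" unfolding A_def using b0 cl(2) by (auto intro!: exI[of _ 1])
  have inv: "inverse c \<in> A" if c: "c \<in> P" "c \<noteq> 0" for c
  proof (rule ccontr)
    assume "inverse c \<notin> A"
    then obtain R where R: "valuation R" "A \<subseteq> R" using valuation_extension[OF A, of c] c PA by blast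
    then have "dominates R P" using dominates_if_subset[OF P valuation_point_ring] PA by blast
    then have "b \<in> nonunits R" using b by (auto simp: dominates_def)
    then show False using bA R b0 by (auto simp: nonunits_iff)
  qed
  obtain a d where "a \<in> P" "d \<in> P" "d \<noteq> 0" "u = a / d" using point_ring_fraction[OF P] by blast
  then have "u \<in> A" using subalgebra_mult[OF A, of a "inverse d"] PA inv by (auto simp: divide_inverse)
  then obtain N where "b ^ N * u \<in> P" unfolding A_def by blast
  then show ?thesis using that[of N] up by blast
qed

subsection \<open>Approximation\<close>

text \<open>Approximation takes place in a subfield \<open>F\<close>: the valuation rings need only have different
  traces on \<open>F\<close>, and then the approximating element is found in \<open>F\<close>.\<close>

lemma trace_incomparable:
  assumes F: "subextension scale F" and R: "valuation R" and R': "valuation R'"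
    and ne: "R \<inter> F \<noteq> R' \<inter> F"
  shows "\<exists>y\<in>F. y \<in> nonunits R \<and> y \<notin> R'"
proof -
  note Fsub = subextension_subalgebra[OF F]
  \<comment> \<open>valuation rings with residue field \<open>k\<close> have rank one: a proper inclusion is impossible\<close>
  have no: "\<not> (S \<inter> F \<subseteq> S' \<inter> F)" if S: "valuation S" and S': "valuation S'" and ne': "S \<inter> F \<noteq> S' \<inter> F" for S S'
  proof
    assume sub: "S \<inter> F \<subseteq> S' \<inter> F"
    then obtain y where y: "y \<in> S'" "y \<in> F" "y \<notin> S" using ne' by blast
    have y0: "y \<noteq> 0" using y(3) subalgebra_0[OF valuation_subalgebra[OF S]] by auto
    have iy: "inverse y \<in> S" "inverse y \<in> F"
      using y valuation_cases[OF S, of y] subextension_inverse[OF F] by auto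
    then have m: "inverse y \<in> nonunits S" using y y0 by (auto simp: nonunits_iff)
    obtain c where c: "inverse y - emb c \<in> nonunits S'"
      using iy sub point_ring_residue[OF valuation_point_ring[OF S']] by blast
    define z where "z = inverse y - emb c"
    have zF: "z \<in> F" unfolding z_def using iy by (intro subalgebra_diff[OF Fsub] subalgebra_emb[OF Fsub])
    have c0: "c \<noteq> 0"
    proof
      assume "c = 0"
      then have "inverse y \<in> nonunits S'" using c by simp
      then show False using y y0 by (auto simp: nonunits_iff)
    qed
    have "z \<in> nonunits S"
    proof (cases "z = 0")
      case True then show ?thesis using zero_in_nonunits subalgebra_0[OF valuation_subalgebra[OF S]] by blast
    next
      case False
      then have "inverse z \<notin> S'" using c by (auto simp: nonunits_iff z_def)
      then have "inverse z \<notin> S" using sub zF subextension_inverse[OF F] by blast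
      then show ?thesis using valuation_cases[OF S, of z] by (auto simp: nonunits_iff)
    qed
    then have "inverse y - z \<in> nonunits S" using m point_ring_diff[OF valuation_point_ring[OF S]] by blast
    then show False using c0 nonunits_emb[OF valuation_subalgebra[OF S], of c] by (simp add: z_def)
  qed
  then obtain x where x: "x \<in> R" "x \<in> F" "x \<notin> R'" using R R' ne by blast
  obtain c where c: "x - emb c \<in> nonunits R" using x point_ring_residue[OF valuation_point_ring[OF R]] by blast
  have "x - emb c \<notin> R'"
  proof
    assume "x - emb c \<in> R'"
    then have "(x - emb c) + emb c \<in> R'" by (intro subalgebra_add subalgebra_emb valuation_subalgebra[OF R'])
    then show False using x by simp
  qed
  then show ?thesis using c x by (intro bexI[of _ "x - emb c"]) (auto intro: subalgebra_diff[OF Fsub] subalgebra_emb[OF Fsub])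
qed

text \<open>Along \<open>L\<close> the element \<open>1/(1 + c y)\<close> has a zero if \<open>y\<close> has a pole, and otherwise it is a unit
  unless \<open>c = - 1/r\<close>, where \<open>r\<close> is the residue of \<open>y\<close>.  So almost every \<open>c\<close> will do.\<close>

lemma pole_free_inverse:
  assumes "finite \<L>" "\<And>L. L \<in> \<L> \<Longrightarrow> valuation L"
  obtains c where "c \<noteq> 0"
    "\<And>L. L \<in> \<L> \<Longrightarrow> 1 + emb c * y \<noteq> 0 \<and> inverse (1 + emb c * y) \<in> L"
    "\<And>L. L \<in> \<L> \<Longrightarrow> y \<notin> L \<Longrightarrow> inverse (1 + emb c * y) \<in> nonunits L"
proof -
  have "\<forall>L. \<exists>r. L \<in> \<L> \<longrightarrow> y \<in> L \<longrightarrow> y - emb r \<in> nonunits L"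
    using point_ring_residue[OF valuation_point_ring[OF assms(2)]] by blast
  then obtain r where r: "\<And>L. L \<in> \<L> \<Longrightarrow> y \<in> L \<Longrightarrow> y - emb (r L) \<in> nonunits L" by metis
  have "finite (insert 0 ((\<lambda>L. - inverse (r L)) ` \<L>))" using assms(1) by auto
  then obtain c where c: "c \<notin> insert 0 ((\<lambda>L. - inverse (r L)) ` \<L>)"
    using ex_new_if_finite[OF infinite_alg_closed] by blast
  then have c0: "c \<noteq> 0" by auto
  have in_case: "1 + emb c * y \<noteq> 0 \<and> inverse (1 + emb c * y) \<in> L" if L: "L \<in> \<L>" "y \<in> L" for L
  proof -
    note P = valuation_point_ring[OF assms(2)[OF L(1)]]
    have "1 + c * r L \<noteq> 0"
    proof
      assume e: "1 + c * r L = 0"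
      then have "r L \<noteq> 0" by auto
      then have "c = - inverse (r L)" using e by (simp add: field_simps eq_neg_iff_add_eq_0)
      then show False using c L by auto
    qed
    moreover have "emb c * (y - emb (r L)) \<in> nonunits L"
      using nonunits_mult[OF point_ring_subalgebra[OF P] subalgebra_emb[OF point_ring_subalgebra[OF P]] r[OF L]] .
    moreover have "emb c * (y - emb (r L)) + emb (1 + c * r L) = 1 + emb c * y"
      by (simp add: emb_add emb_mult algebra_simps)
    ultimately show ?thesis using point_ring_unit_add[OF P] by metis
  qed
  have out_case: "1 + emb c * y \<noteq> 0 \<and> inverse (1 + emb c * y) \<in> nonunits L" if L: "L \<in> \<L>" "y \<notin> L" for L
  proof -
    note P = valuation_point_ring[OF assms(2)[OF L(1)]]
    note sub = point_ring_subalgebra[OF P]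
    have y0: "y \<noteq> 0" using L subalgebra_0[OF sub] by auto
    have iy: "inverse y \<in> nonunits L" using L valuation_cases[OF assms(2)[OF L(1)], of y] y0 by (auto simp: nonunits_iff)
    have 1: "inverse y + emb c \<noteq> 0" "inverse (inverse y + emb c) \<in> L"
      using point_ring_unit_add[OF P iy c0] by auto
    have eq: "1 + emb c * y = (inverse y + emb c) * y" using y0 by (simp add: field_simps)
    have "inverse (inverse y + emb c) * inverse y \<in> nonunits L"
      using nonunits_mult[OF sub 1(2) iy] .
    then show ?thesis using 1 y0 unfolding eq by (simp add: mult.commute)
  qed
  show ?thesis
  proof (rule that[OF c0])
    fix L assume "L \<in> \<L>"
    then show "1 + emb c * y \<noteq> 0 \<and> inverse (1 + emb c * y) \<in> L"
      using in_case out_case nonunits_subset by (cases "y \<in> L") blast+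
  qed (use out_case in blast)
qed

text \<open>For each \<open>L\<close> there is \<open>y \<in> F\<close> with a zero along \<open>R\<close> and a pole along \<open>L\<close>; then \<open>1/(1 + c y)\<close> is
  \<open>1\<close> along \<open>R\<close> and \<open>0\<close> along \<open>L\<close>, and for almost all constants \<open>c\<close> it is regular along the other
  rings.  The product of these elements separates.\<close>

lemma separating_element:
  assumes F: "subextension scale F" and fin: "finite \<L>" and val: "\<And>L. L \<in> \<L> \<Longrightarrow> valuation L"
    and R: "valuation R" and ne: "\<And>L. L \<in> \<L> \<Longrightarrow> L \<inter> F \<noteq> R \<inter> F"
  obtains w where "w \<in> F" "w - 1 \<in> nonunits R" "\<And>L. L \<in> \<L> \<Longrightarrow> w \<in> nonunits L"
proof -
  note Fsub = subextension_subalgebra[OF F]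
  note P = valuation_point_ring[OF R]
  note sub = point_ring_subalgebra[OF P]
  have "\<exists>w\<in>F. w - 1 \<in> nonunits R \<and> w \<in> nonunits L \<and> (\<forall>L'\<in>\<L>. w \<in> L')" if L: "L \<in> \<L>" for L
  proof -
    obtain y where y: "y \<in> F" "y \<in> nonunits R" "y \<notin> L"
      using trace_incomparable[OF F R val[OF L]] ne[OF L] by blast
    have "finite (insert R \<L>)" "\<And>L. L \<in> insert R \<L> \<Longrightarrow> valuation L" using fin val R by auto
    then obtain c where c: "c \<noteq> 0"
      "\<And>L. L \<in> insert R \<L> \<Longrightarrow> 1 + emb c * y \<noteq> 0 \<and> inverse (1 + emb c * y) \<in> L"
      "\<And>L. L \<in> insert R \<L> \<Longrightarrow> y \<notin> L \<Longrightarrow> inverse (1 + emb c * y) \<in> nonunits L"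
      using pole_free_inverse[of "insert R \<L>" y] by metis
    define w where "w = inverse (1 + emb c * y)"
    have "w - 1 = (- emb c * w) * y" using c(2)[of R] by (simp add: w_def field_simps)
    moreover have "(- emb c * w) * y \<in> nonunits R"
      using c(2)[of R] by (intro nonunits_mult[OF sub] y subalgebra_closed[OF sub]) (auto simp: w_def)
    moreover have "w \<in> F" unfolding w_def
      using y(1) by (intro subextension_inverse[OF F] subalgebra_closed[OF Fsub])
    ultimately show ?thesis using c(2,3) L y(3) by (intro bexI[of _ w]) (auto simp: w_def)
  qed
  then obtain w where w: "\<And>L. L \<in> \<L> \<Longrightarrow> w L \<in> F" "\<And>L. L \<in> \<L> \<Longrightarrow> w L - 1 \<in> nonunits R"
      "\<And>L. L \<in> \<L> \<Longrightarrow> w L \<in> nonunits L" "\<And>L L'. L \<in> \<L> \<Longrightarrow> L' \<in> \<L> \<Longrightarrow> w L \<in> L'"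
    by metis
  define v where "v = prod w \<L>"
  show ?thesis
  proof (rule that[of v])
    show "v \<in> F" unfolding v_def using w(1) by (rule subalgebra_prod[OF Fsub])
    have prod1: "prod w S - 1 \<in> nonunits R" if "S \<subseteq> \<L>" for S
      using finite_subset[OF that fin] that
    proof (induction S rule: finite_induct)
      case (insert L S)
      have "prod w (insert L S) - 1 = w L * (prod w S - 1) + (w L - 1)"
        using insert by (simp add: algebra_simps)
      moreover have "w L \<in> R"
        using subalgebra_add[OF sub, of "w L - 1" 1] w(2)[of L] insert nonunits_subset[of R] subalgebra_1[OF sub]
        by auto
      moreover have "w L * (prod w S - 1) + (w L - 1) \<in> nonunits R"
        using insert w(2) \<open>w L \<in> R\<close> by (intro point_ring_add[OF P] nonunits_mult[OF sub]) auto
      ultimately show ?case by metis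
    qed (simp add: zero_in_nonunits subalgebra_0[OF sub])
    then show "v - 1 \<in> nonunits R" by (simp add: v_def)
    show "v \<in> nonunits L" if L: "L \<in> \<L>" for L
    proof -
      have "v = prod w (\<L> - {L}) * w L"
        unfolding v_def using prod.remove[OF fin L, of w] by (simp add: mult.commute)
      then show ?thesis using w L valuation_subalgebra[OF val[OF L]]
        by (auto intro!: nonunits_mult subalgebra_prod)
    qed
  qed
qed

text \<open>The element \<open>1 - (1 - w\<^sup>N)\<^sup>M\<close> sharpens the congruences that \<open>w\<close> satisfies.\<close>

lemma valuation_approximation:
  assumes F: "subextension scale F" and fin: "finite \<L>" and val: "\<And>L. L \<in> \<L> \<Longrightarrow> valuation L"
    and inj: "inj_on (\<lambda>L. L \<inter> F) \<L>" and R: "R \<in> \<L>"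
  obtains e where "e \<in> F" "(e - 1) / z \<in> R" "\<And>L. L \<in> \<L> - {R} \<Longrightarrow> e / z \<in> L"
proof -
  note Fsub = subextension_subalgebra[OF F]
  note P = valuation_point_ring[OF val[OF R]]
  note sub = point_ring_subalgebra[OF P]
  obtain w where w: "w \<in> F" "w - 1 \<in> nonunits R" "\<And>L. L \<in> \<L> - {R} \<Longrightarrow> w \<in> nonunits L"
  proof -
    have "L \<inter> F \<noteq> R \<inter> F" if "L \<in> \<L> - {R}" for L using inj R that by (auto dest: inj_onD)
    then show thesis
      using separating_element[OF F, of "\<L> - {R}" R] fin val R that by (metis DiffD1 finite_Diff)
  qed
  have wR: "w \<in> R"
    using subalgebra_add[OF sub, of "w - 1" 1] w(2) nonunits_subset[of R] subalgebra_1[OF sub] by auto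
  have "\<forall>L. \<exists>N. L \<in> \<L> - {R} \<longrightarrow> (\<forall>n\<ge>N. w ^ n * inverse z \<in> L)"
    using nonunit_power_absorbs[OF valuation_point_ring[OF val] w(3)] by (metis DiffD1)
  then obtain N where N: "\<And>L n. L \<in> \<L> - {R} \<Longrightarrow> n \<ge> N L \<Longrightarrow> w ^ n * inverse z \<in> L" by metis
  define n where "n = sum N \<L> + 1"
  have n: "n \<ge> N L" if "L \<in> \<L>" for L
    using member_le_sum[OF that, of N] fin by (simp add: n_def)
  have "1 - w ^ n = (\<Sum>i<n. w ^ i) * (- (w - 1))"
    using power_diff_1_eq[of w n] by (simp add: algebra_simps)
  also have "\<dots> \<in> nonunits R"
    using wR w(2) by (intro nonunits_mult[OF sub] point_ring_uminus[OF P] subalgebra_sum[OF sub] subalgebra_power[OF sub])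
  finally have v: "1 - w ^ n \<in> nonunits R" .
  obtain M where M: "(1 - w ^ n) ^ M * inverse z \<in> R"
    using nonunit_power_absorbs[OF P v, of "inverse z"] by blast
  define e where "e = 1 - (1 - w ^ n) ^ M"
  show ?thesis
  proof (rule that[of e])
    show "e \<in> F" unfolding e_def using w(1) by (intro subalgebra_closed[OF Fsub])
    have "(e - 1) / z = - ((1 - w ^ n) ^ M * inverse z)" by (simp add: e_def divide_inverse)
    then show "(e - 1) / z \<in> R" using M by (auto intro: subalgebra_uminus[OF sub])
    fix L assume L: "L \<in> \<L> - {R}"
    have Lsub: "subalgebra scale L" using valuation_subalgebra[OF val, of L] L by blast
    have wL: "w \<in> L" using w(3)[OF L] nonunits_subset by blast
    have "e = w ^ n * (\<Sum>i<M. (1 - w ^ n) ^ i)"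
      unfolding e_def using power_diff_1_eq[of "1 - w ^ n" M] by (simp add: algebra_simps)
    then have "e / z = (w ^ n * inverse z) * (\<Sum>i<M. (1 - w ^ n) ^ i)" by (simp add: divide_inverse)
    also have "\<dots> \<in> L"
      using N[OF L n] L wL Lsub
      by (intro subalgebra_mult[OF Lsub, of "w ^ n * inverse z"] subalgebra_sum subalgebra_power subalgebra_diff subalgebra_1) auto
    finally show "e / z \<in> L" .
  qed
qed

subsection \<open>Finiteness\<close>

text \<open>Elements that separate \<open>N + 1\<close> valuation rings in which \<open>b\<close> is a nonunit are independent
  modulo \<open>b\<close>.\<close>

lemma finite_zeros:
  assumes b: "b \<notin> constants"
  shows "finite {R. valuation R \<and> b \<in> nonunits R}"
proof (rule ccontr)
  assume inf: "infinite {R. valuation R \<and> b \<in> nonunits R}"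
  obtain N where N: "dep_bound b N" using dep_bound_exists b by blast
  obtain \<L> where L: "finite \<L>" "card \<L> = Suc N" "\<L> \<subseteq> {R. valuation R \<and> b \<in> nonunits R}"
    using infinite_arbitrarily_large[OF inf] by blast
  then obtain h where h: "bij_betw h {..N} \<L>"
    using ex_bij_betw_nat_finite[of \<L>] by (auto simp: lessThan_Suc_atMost atLeast0LessThan)
  have "\<exists>w. w - 1 \<in> nonunits R \<and> (\<forall>L\<in>\<L> - {R}. w \<in> nonunits L)" if "R \<in> \<L>" for R
  proof -
    have "finite (\<L> - {R})" "valuation R" "\<And>L. L \<in> \<L> - {R} \<Longrightarrow> valuation L"
      "\<And>L. L \<in> \<L> - {R} \<Longrightarrow> L \<inter> UNIV \<noteq> R \<inter> UNIV" using L that by auto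
    then obtain w where "w - 1 \<in> nonunits R" "\<And>L. L \<in> \<L> - {R} \<Longrightarrow> w \<in> nonunits L"
      using separating_element[OF subextension_UNIV, of "\<L> - {R}" R] by metis
    then show ?thesis by blast
  qed
  then obtain w where w: "\<And>R. R \<in> \<L> \<Longrightarrow> w R - 1 \<in> nonunits R"
      "\<And>R L. R \<in> \<L> \<Longrightarrow> L \<in> \<L> - {R} \<Longrightarrow> w R \<in> nonunits L" by metis
  have pt: "point_ring R" if "R \<in> \<L>" for R using that L valuation_point_ring by blast
  have wJ: "w R \<in> L" if "R \<in> \<L>" "L \<in> \<L>" for R L
  proof (cases "L = R")
    case True
    then show ?thesis
      using w(1)[OF that(1)] pt[OF that(1)] nonunits_subset[of R]
        subalgebra_add[of R "w R - 1" 1] point_ring_subalgebra subalgebra_1 by auto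
  qed (use w(2)[of R L] that nonunits_subset in auto)
  have sub: "subalgebra scale (\<Inter>\<L>)" using L by (intro subalgebra_Inter) (auto intro: valuation_subalgebra)
  have hL: "h j \<in> \<L>" if "j \<le> N" for j using h that by (auto simp: bij_betw_def)
  have bJ: "b * x \<in> \<Inter>\<L>" if "x \<in> \<Inter>\<L>" for x
  proof -
    have "b \<in> \<Inter>\<L>" using L(3) nonunits_subset by blast
    then show ?thesis using subalgebra_mult[OF sub] that by blast
  qed
  have whJ: "w (h j) \<in> \<Inter>\<L>" if "j \<le> N" for j using wJ hL[OF that] by simp
  from dep_bound_mod[OF N nonconstant_nonzero[OF b] subalgebra_subspace[OF sub] bJ, of "\<lambda>j. w (h j)", OF _ whJ]
  obtain c y where c: "\<exists>j\<le>N. c j \<noteq> 0" "y \<in> \<Inter>\<L>" "(\<Sum>j\<le>N. emb (c j) * w (h j)) = b * y"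
    by auto
  then obtain j where j: "j \<le> N" "c j \<noteq> 0" by blast
  define R where "R = h j"
  have R: "R \<in> \<L>" unfolding R_def using hL j by blast
  note sR = point_ring_subalgebra[OF pt[OF R]]
  have "emb (c i) * w (h i) \<in> nonunits R" if "i \<in> {..N} - {j}" for i
  proof -
    have "h i \<noteq> h j" using h that j(1) by (auto simp: bij_betw_def inj_on_def)
    then show ?thesis
      using that R by (intro nonunits_mult[OF sR] subalgebra_emb[OF sR] w hL) (auto simp: R_def)
  qed
  then have 1: "(\<Sum>i\<in>{..N} - {j}. emb (c i) * w (h i)) \<in> nonunits R"
    using point_ring_sum[OF pt[OF R], of "{..N} - {j}" "\<lambda>i. emb (c i) * w (h i)"] by simp
  have 2: "y * b \<in> nonunits R" using c(2) R L(3) by (intro nonunits_mult[OF sR]) auto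
  have 3: "emb (c j) * (w R - 1) \<in> nonunits R" using R by (intro nonunits_mult[OF sR] subalgebra_emb[OF sR] w)
  have "emb (c j) = y * b - (\<Sum>i\<in>{..N} - {j}. emb (c i) * w (h i)) - emb (c j) * (w R - 1)"
    using c(3) j(1) by (simp add: sum.remove[of "{..N}" j] R_def algebra_simps)
  then have "emb (c j) \<in> nonunits R"
    using point_ring_diff[OF pt[OF R] point_ring_diff[OF pt[OF R] 2 1] 3] by (simp only:)
  then show False using j(2) nonunits_emb[OF sR] by blast
qed

definition uniformizer :: "'a set \<Rightarrow> 'a \<Rightarrow> bool" where
  "uniformizer R \<pi> \<longleftrightarrow> \<pi> \<in> nonunits R \<and> \<pi> \<noteq> 0 \<and> (\<forall>y\<in>nonunits R. y / \<pi> \<in> R)"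

text \<open>A valuation ring is discrete: the partial products of a factorization of \<open>b\<close> into nonunits are
  independent modulo \<open>b\<close>, so a longest factorization exists, and its factors are irreducible.\<close>

lemma uniformizer_exists:
  assumes R: "valuation R"
  obtains \<pi> where "uniformizer R \<pi>"
proof -
  note P = valuation_point_ring[OF R]
  note sub = valuation_subalgebra[OF R]
  note cl = subalgebra_closed[OF sub]
  obtain b where b: "b \<in> nonunits R" "b \<noteq> 0" using point_ring_nonunit_exists[OF P] .
  obtain N where N: "dep_bound b N" using dep_bound_exists nonunits_nonconstant[OF sub b] by blast
  define M :: "nat set" where "M = {n. \<exists>y. (\<forall>i<n. y i \<in> nonunits R) \<and> b = (\<Prod>i<n. y i)}"
  have bound: "n \<le> N" if nM: "n \<in> M" for n :: nat
  proof (rule ccontr)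
    assume nN: "\<not> n \<le> N"
    obtain y where y: "\<forall>i<n. y i \<in> nonunits R" "b = (\<Prod>i<n. y i)" using nM unfolding M_def by blast
    define w where "w j = (\<Prod>i<j. y i)" for j
    have yR: "y i \<in> R" if "i < n" for i using y(1) that nonunits_subset by blast
    have wR: "w j \<in> R" if "j \<le> N" for j
      unfolding w_def using that nN by (intro subalgebra_prod[OF sub] yR) auto
    obtain c r where c: "\<exists>j\<le>N. c j \<noteq> 0" "r \<in> R" "(\<Sum>j\<le>N. emb (c j) * w j) = b * r"
      using dep_bound_mod[OF N b(2) subalgebra_subspace[OF sub], of w] wR b(1) nonunits_subset[of R] cl(6) by blast
    define j where "j = (LEAST j. c j \<noteq> 0)"
    obtain j' where j': "j' \<le> N" "c j' \<noteq> 0" using c(1) by blast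
    have j: "c j \<noteq> 0" "j \<le> N" unfolding j_def using j' LeastI[of "\<lambda>j. c j \<noteq> 0" j'] Least_le[of "\<lambda>j. c j \<noteq> 0" j'] by auto
    have jz: "c i = 0" if "i < j" for i using not_less_Least that unfolding j_def by blast
    define v where "v i = (\<Prod>l\<in>{j..<i}. y l)" for i
    have wv: "w i = w j * v i" if "j \<le> i" for i
      unfolding w_def v_def using that by (simp add: prod.atLeastLessThan_concat flip: atLeast0LessThan)
    have vm: "v i \<in> nonunits R" if "j < i" "i \<le> n" for i
    proof -
      have "v i = (\<Prod>l\<in>{j..<i} - {j}. y l) * y j"
        unfolding v_def using that by (subst prod.remove[of _ j]) (auto simp: mult.commute)
      then show ?thesis using that y(1)
        by (auto intro!: nonunits_mult[OF sub] subalgebra_prod[OF sub] yR)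
    qed
    have bw: "b = w j * v n" unfolding y(2) using wv[of n] j(2) nN by (simp add: w_def)
    then have wj: "w j \<noteq> 0" using b(2) by auto
    have "(\<Sum>i\<le>N. emb (c i) * w i) = (\<Sum>i\<in>{j..N}. emb (c i) * w i)"
      using jz by (intro sum.mono_neutral_right) auto
    also have "\<dots> = w j * (\<Sum>i\<in>{j..N}. emb (c i) * v i)"
      unfolding sum_distrib_left by (intro sum.cong refl) (subst wv, auto)
    finally have "w j * (\<Sum>i\<in>{j..N}. emb (c i) * v i) = b * r" using c(3) by (rule trans[OF sym])
    also have "b * r = w j * (r * v n)" by (subst bw) (simp add: mult_ac)
    finally have "(\<Sum>i\<in>{j..N}. emb (c i) * v i) = r * v n" using wj by simp
    then have "emb (c j) = r * v n - (\<Sum>i\<in>{j..N} - {j}. emb (c i) * v i)"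
      using j(2) by (simp add: sum.remove[of "{j..N}" j] v_def algebra_simps)
    moreover have "(\<Sum>i\<in>{j..N} - {j}. emb (c i) * v i) \<in> nonunits R"
      using nN by (intro point_ring_sum[OF P] nonunits_mult[OF sub] vm cl) auto
    moreover have "r * v n \<in> nonunits R" using c(2) j(2) nN by (intro nonunits_mult[OF sub] vm) auto
    ultimately have "emb (c j) \<in> nonunits R" using point_ring_diff[OF P] by (simp only:)
    then show False using nonunits_emb[OF sub] j(1) by blast
  qed
  have "1 \<in> M" unfolding M_def using b(1) by (auto intro!: exI[of _ "\<lambda>_. b"])
  define n where "n = Max M"
  have finM: "finite M" using bound finite_subset[of M "{..N}"] by auto
  have "n \<in> M" unfolding n_def using finM \<open>1 \<in> M\<close> by (intro Max_in) auto
  moreover have n1: "n \<ge> 1" unfolding n_def using finM \<open>1 \<in> M\<close> by (intro Max_ge)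
  ultimately obtain y where y: "\<forall>i<n. y i \<in> nonunits R" "b = (\<Prod>i<n. y i)" unfolding M_def by blast
  have y0: "y 0 \<noteq> 0" using y(2) b(2) n1 by (metis finite_lessThan lessThan_iff less_le_trans prod_zero zero_less_one)
  have "q / y 0 \<in> R" if q: "q \<in> nonunits R" for q
  proof (rule ccontr)
    assume nq: "q / y 0 \<notin> R"
    then have q0: "q \<noteq> 0" using cl by auto
    have "y 0 / q \<in> nonunits R" using nq valuation_cases[OF R, of "q / y 0"] by (auto simp: nonunits_iff)
    moreover define z where "z = (y(n := y 0 / q))(0 := q)"
    ultimately have zm: "\<forall>i<Suc n. z i \<in> nonunits R" using y(1) q by (auto simp: less_Suc_eq)
    have "(\<Prod>i<Suc n. z i) = (\<Prod>i<n. z i) * (y 0 / q)" using n1 by (simp add: z_def)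
    also have "(\<Prod>i<n. z i) = q * (\<Prod>i\<in>{..<n} - {0}. z i)" using n1 by (subst prod.remove[of _ 0]) (auto simp: z_def)
    also have "(\<Prod>i\<in>{..<n} - {0}. z i) = (\<Prod>i\<in>{..<n} - {0}. y i)" by (intro prod.cong) (auto simp: z_def)
    also have "q * (\<Prod>i\<in>{..<n} - {0}. y i) * (y 0 / q) = (\<Prod>i<n. y i)"
      using n1 q0 by (subst (2) prod.remove[of _ 0]) auto
    finally have "Suc n \<in> M" unfolding M_def using zm y(2) by auto
    then have "Suc n \<le> n" unfolding n_def using finM by (intro Max_ge)
    then show False by simp
  qed
  then show ?thesis using that[of "y 0"] y(1) n1 y0 by (auto simp: uniformizer_def)
qed

text \<open>A nonconstant function has a pole: \<open>1/x\<close> is not invertible in \<open>k[1/x]\<close>.\<close>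

lemma constant_if_no_pole:
  assumes "\<And>R. valuation R \<Longrightarrow> x \<in> R"
  shows "x \<in> constants"
proof (rule ccontr)
  assume x: "x \<notin> constants"
  note x0 = nonconstant_nonzero[OF x]
  let ?A = "subalgebra scale hull {inverse x}"
  have "x \<notin> ?A"
  proof
    assume "x \<in> ?A"
    then obtain p where p: "x = peval p (inverse x)" by (auto simp: subalgebra_hull_singleton)
    have "peval (pCons (-1) p) (inverse x) = 0" using p x0 by (simp add: emb_minus flip: p)
    then show False using peval_nonconstant[OF inverse_nonconstant[OF x], of "pCons (-1) p"] by simp
  qed
  then obtain R where "valuation R" "inverse x \<in> nonunits R"
    using valuation_extension[OF subalgebra_hull, of "inverse x" "{inverse x}"] x0 by (auto intro: hull_inc)
  then show False using assms[of R] x0 by (auto simp: nonunits_iff)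
qed

end

section \<open>Points of a complete curve\<close>

context curve_function_field
begin

lemma prime_ideal_ofD:
  assumes "prime_ideal_of A p"
  shows "p \<subseteq> A" "0 \<in> p" "x \<in> p \<Longrightarrow> y \<in> p \<Longrightarrow> x + y \<in> p" "a \<in> A \<Longrightarrow> x \<in> p \<Longrightarrow> a * x \<in> p"
    "1 \<notin> p" "a \<in> A \<Longrightarrow> b \<in> A \<Longrightarrow> a * b \<in> p \<Longrightarrow> a \<in> p \<or> b \<in> p"
  using assms unfolding prime_ideal_of_def by blast+

context
  fixes A p assumes A: "subalgebra scale A" and p: "prime_ideal_of A p"
begin

lemma localizationI: "a \<in> A \<Longrightarrow> b \<in> A \<Longrightarrow> b \<notin> p \<Longrightarrow> a / b \<in> localization A p"
  by (auto simp: localization_def)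

lemma subset_localization: "A \<subseteq> localization A p"
  using localizationI[OF _ subalgebra_1[OF A]] prime_ideal_ofD(5)[OF p] by fastforce

lemma subalgebra_localization: "subalgebra scale (localization A p)"
proof (rule subalgebraI)
  note cl = subalgebra_closed[OF A]
  show "emb c \<in> localization A p" for c using subset_localization cl(7) by blast
  fix x y assume "x \<in> localization A p" "y \<in> localization A p"
  then obtain a b c d where x: "x = a / b" "a \<in> A" "b \<in> A" "b \<notin> p" and y: "y = c / d" "c \<in> A" "d \<in> A" "d \<notin> p"
    unfolding localization_def by blast
  have bd: "b * d \<in> A" "b * d \<notin> p"
      using x y cl(6)[of b d] prime_ideal_ofD(6)[OF p, of b d] by auto
  have ne: "b \<noteq> 0" "d \<noteq> 0" using x y prime_ideal_ofD(2)[OF p] by auto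
  have "x + y = (a * d + c * b) / (b * d)" "x * y = (a * c) / (b * d)" using x y ne by (auto simp: field_simps)
  moreover have "a * d + c * b \<in> A" "a * c \<in> A" using x y by (auto intro!: cl)
  ultimately show "x + y \<in> localization A p" "x * y \<in> localization A p" using localizationI bd by auto
qed

lemma nonunits_localization: "nonunits (localization A p) = {a / b | a b. a \<in> p \<and> b \<in> A \<and> b \<notin> p}"
proof (intro equalityI subsetI)
  fix x assume x: "x \<in> nonunits (localization A p)"
  then obtain a b where ab: "x = a / b" "a \<in> A" "b \<in> A" "b \<notin> p"
    unfolding nonunits_def localization_def by blast
  have "a \<in> p"
  proof (rule ccontr)
    assume na: "a \<notin> p"
    then have "b / a \<in> localization A p" "a \<noteq> 0" using ab localizationI prime_ideal_ofD(2)[OF p] by auto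
    then show False using x ab prime_ideal_ofD(2)[OF p] by (auto simp: nonunits_iff)
  qed
  then show "x \<in> {a / b | a b. a \<in> p \<and> b \<in> A \<and> b \<notin> p}" using ab by blast
next
  fix x assume "x \<in> {a / b | a b. a \<in> p \<and> b \<in> A \<and> b \<notin> p}"
  then obtain a b where ab: "x = a / b" "a \<in> p" "b \<in> A" "b \<notin> p" by blast
  have b0: "b \<noteq> 0" using ab prime_ideal_ofD(2)[OF p] by auto
  have "inverse x \<notin> localization A p" if "x \<noteq> 0"
  proof
    assume "inverse x \<in> localization A p"
    then obtain e f where ef: "inverse x = e / f" "e \<in> A" "f \<in> A" "f \<notin> p" unfolding localization_def by blast
    then have "f \<noteq> 0" using prime_ideal_ofD(2)[OF p] by auto
    then have "b * f = e * a" using ef ab that by (auto simp: field_simps)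
    moreover have "e * a \<in> p" using prime_ideal_ofD(4)[OF p] ef ab by blast
    ultimately show False using prime_ideal_ofD(6)[OF p, of b f] ab ef by auto
  qed
  then show "x \<in> nonunits (localization A p)"
    using ab localizationI prime_ideal_ofD(1)[OF p] by (auto simp: nonunits_iff)
qed

lemma in_nonunits_localization: "x \<in> A \<Longrightarrow> x \<in> nonunits (localization A p) \<longleftrightarrow> x \<in> p"
proof
  assume "x \<in> A" "x \<in> nonunits (localization A p)"
  then obtain a b where ab: "x = a / b" "a \<in> p" "b \<in> A" "b \<notin> p" unfolding nonunits_localization by blast
  then have "x * b \<in> p" using prime_ideal_ofD(2)[OF p] by auto
  then show "x \<in> p" using prime_ideal_ofD(6)[OF p] ab \<open>x \<in> A\<close> by blast
next
  assume "x \<in> p"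
  then have "\<exists>a b. x = a / b \<and> a \<in> p \<and> b \<in> A \<and> b \<notin> p"
    using subalgebra_1[OF A] prime_ideal_ofD(5)[OF p] by (intro exI[of _ x] exI[of _ 1]) auto
  then show "x \<in> nonunits (localization A p)" by (simp add: nonunits_localization)
qed

lemma point_ring_localization:
  assumes frac: "\<And>x. \<exists>a\<in>A. \<exists>b\<in>A. b \<noteq> 0 \<and> x = a / b" and proper: "localization A p \<noteq> UNIV"
  shows "point_ring (localization A p)"
  unfolding point_ring_def
proof (intro conjI ballI allI)
  let ?P = "localization A p"
  note cl = subalgebra_closed[OF A]
  show "subalgebra scale ?P" "?P \<noteq> UNIV" by (fact subalgebra_localization proper)+
  show fr: "\<exists>a\<in>?P. \<exists>d\<in>?P. d \<noteq> 0 \<and> x = a / d" for x using frac[of x] subset_localization by blast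
  show "x + y \<in> nonunits ?P" if xy: "x \<in> nonunits ?P" "y \<in> nonunits ?P" for x y
  proof -
    obtain a b c d where x: "x = a / b" "a \<in> p" "b \<in> A" "b \<notin> p" and y: "y = c / d" "c \<in> p" "d \<in> A" "d \<notin> p"
      using xy unfolding nonunits_localization by blast
    have bd: "b * d \<in> A" "b * d \<notin> p"
      using x y cl(6)[of b d] prime_ideal_ofD(6)[OF p, of b d] by auto
    have ne: "b \<noteq> 0" "d \<noteq> 0" using x y prime_ideal_ofD(2)[OF p] by auto
    have "x + y = (d * a + b * c) / (b * d)" using x y ne by (auto simp: field_simps)
    moreover have "d * a + b * c \<in> p" using prime_ideal_ofD(3,4)[OF p] x y by blast
    ultimately show ?thesis using bd unfolding nonunits_localization by blast
  qed
  show "\<exists>c. x - emb c \<in> nonunits ?P" if x: "x \<in> ?P" for x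
  proof -
    obtain z where z: "z \<in> nonunits ?P" "z \<noteq> 0"
    proof -
      obtain y where y: "y \<notin> ?P" using proper by auto
      obtain a d where "a \<in> ?P" "d \<in> ?P" "d \<noteq> 0" "y = a / d" using fr by blast
      then have "inverse d \<notin> ?P"
        using y subalgebra_mult[OF subalgebra_localization, of a "inverse d"] by (auto simp: divide_inverse)
      then show ?thesis using that[of d] \<open>d \<in> ?P\<close> \<open>d \<noteq> 0\<close> by (simp add: nonunits_iff)
    qed
    then obtain R where R: "valuation R" "?P \<subseteq> R"
      using valuation_extension[OF subalgebra_localization, of z] by (auto simp: nonunits_iff)
    then obtain c where "x - emb c \<in> nonunits R" using x point_ring_residue[OF valuation_point_ring] by blast
    moreover have "x - emb c \<in> ?P"
      using x subalgebra_localization by (intro subalgebra_diff subalgebra_emb)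
    ultimately show ?thesis using R(2) by (auto simp: nonunits_iff)
  qed
qed

end

lemma affine_modelD:
  assumes "affine_model scale A"
  shows "subalgebra scale A" "\<exists>a\<in>A. \<exists>b\<in>A. b \<noteq> 0 \<and> x = a / b"
  using assms subalgebra_hull unfolding affine_model_def by auto

lemma prime_ideal_zero: "subalgebra scale A \<Longrightarrow> prime_ideal_of A {0}"
  by (auto simp: prime_ideal_of_def subalgebra_0)

lemma UNIV_in_local_rings:
  assumes "affine_model scale A"
  shows "UNIV \<in> local_rings A"
proof -
  have "localization A {0} = UNIV"
    using affine_modelD(2)[OF assms] unfolding localization_def by (auto simp: set_eq_iff) blast
  then show ?thesis
    using prime_ideal_zero[OF affine_modelD(1)[OF assms]] unfolding local_rings_def by blast
qed

lemma local_rings_cases: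
  assumes "affine_model scale A" "P \<in> local_rings A"
  shows "A \<subseteq> P" "P = UNIV \<or> point_ring P" "P = localization A (A \<inter> nonunits P)"
    "prime_ideal_of A (A \<inter> nonunits P)"
proof -
  obtain p where p: "prime_ideal_of A p" "P = localization A p" using assms(2) unfolding local_rings_def by blast
  note sub = affine_modelD(1)[OF assms(1)]
  show "A \<subseteq> P" unfolding p(2) by (rule subset_localization[OF sub p(1)])
  show "P = UNIV \<or> point_ring P"
    using point_ring_localization[OF sub p(1)] affine_modelD(2)[OF assms(1)] unfolding p(2) by blast
  have "A \<inter> nonunits P = p"
    using in_nonunits_localization[OF sub p(1)] prime_ideal_ofD(1)[OF p(1)] unfolding p(2) by blast
  then show "P = localization A (A \<inter> nonunits P)" "prime_ideal_of A (A \<inter> nonunits P)" using p by auto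
qed

end

locale complete_curve = curve_function_field scale
  for scale :: "'k::alg_closed_field \<Rightarrow> 'a::field \<Rightarrow> 'a" +
  fixes C :: "'a set set"
  assumes complete: "complete_integral_curve scale C"
begin

lemma affine_cover_exists: obtains \<A> where "affine_cover scale C \<A>"
  using complete unfolding complete_integral_curve_def by blast

lemma affine_coverD:
  assumes "affine_cover scale C \<A>"
  shows "finite \<A>" "A \<in> \<A> \<Longrightarrow> affine_model scale A" "A \<in> \<A> \<Longrightarrow> local_rings A \<subseteq> C"
    "P \<in> C \<Longrightarrow> \<exists>A\<in>\<A>. P \<in> local_rings A"
  using assms unfolding affine_cover_def by auto

lemma center_unique: "valuation_ring scale R \<Longrightarrow> \<exists>!P. P \<in> C \<and> dominates R P"
  using complete unfolding complete_integral_curve_def by blast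

lemma UNIV_in_C: "UNIV \<in> C"
proof -
  have "valuation_ring scale UNIV" by (simp add: valuation_ring_def subalgebra_UNIV)
  then obtain P where "P \<in> C" using center_unique by blast
  then show ?thesis using affine_cover_exists affine_coverD UNIV_in_local_rings by (metis subsetD)
qed

lemma closed_point_ring: "P \<in> closed_points C \<Longrightarrow> point_ring P"
  using affine_cover_exists affine_coverD(2,4) local_rings_cases(2) unfolding closed_points_def
  by (metis DiffD1 DiffD2 singletonI)

lemma closed_point_in_C: "P \<in> closed_points C \<Longrightarrow> P \<in> C"
  by (simp add: closed_points_def)

lemma in_C_cases: "P \<in> C \<Longrightarrow> P = UNIV \<or> P \<in> closed_points C"
  by (simp add: closed_points_def)

lemma C_subalgebra: "P \<in> C \<Longrightarrow> subalgebra scale P"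
  using in_C_cases closed_point_ring point_ring_subalgebra subalgebra_UNIV by blast

lemma not_in_closed: "P \<in> C \<Longrightarrow> x \<notin> P \<Longrightarrow> P \<in> closed_points C"
  by (auto simp: closed_points_def)

lemma center_eq: "valuation_ring scale R \<Longrightarrow> P \<in> C \<Longrightarrow> dominates R P \<Longrightarrow> normalization_map C R = P"
  unfolding normalization_map_def using center_unique by (intro the1_equality) auto

lemma center_eq': "valuation R \<Longrightarrow> P \<in> closed_points C \<Longrightarrow> P \<subseteq> R \<Longrightarrow> normalization_map C R = P"
  using dominates_if_subset[OF closed_point_ring valuation_point_ring] closed_point_in_C
  by (intro center_eq) (auto simp: valuation_def)

lemma center:
  assumes "valuation R"
  shows "normalization_map C R \<in> closed_points C" "dominates R (normalization_map C R)"
    "normalization_map C R \<subseteq> R"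
proof -
  have "\<exists>!P. P \<in> C \<and> dominates R P" using assms center_unique by (simp add: valuation_def)
  then have *: "normalization_map C R \<in> C \<and> dominates R (normalization_map C R)"
    unfolding normalization_map_def by (rule theI')
  then show d: "dominates R (normalization_map C R)" by blast
  then show "normalization_map C R \<subseteq> R" by (simp add: dominates_def)
  then show "normalization_map C R \<in> closed_points C"
    using * assms by (auto simp: closed_points_def valuation_def)
qed

lemma constant_if_regular:
  assumes "\<And>P. P \<in> closed_points C \<Longrightarrow> x \<in> P"
  shows "x \<in> constants"
  using constant_if_no_pole center assms by blast

lemma finite_valuations_over:
  assumes "P \<in> closed_points C"
  shows "finite {R. valuation R \<and> P \<subseteq> R}"
proof -
  note P = closed_point_ring[OF assms]
  obtain z where z: "z \<in> nonunits P" "z \<noteq> 0" using point_ring_nonunit_exists[OF P] .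
  have "{R. valuation R \<and> P \<subseteq> R} \<subseteq> {R. valuation R \<and> z \<in> nonunits R}"
    using dominates_if_subset[OF P valuation_point_ring] z by (auto simp: dominates_def)
  then show ?thesis
    using finite_zeros[OF nonunits_nonconstant[OF point_ring_subalgebra[OF P] z]] finite_subset by blast
qed

text \<open>On an affine chart a pole of \<open>a/d\<close> is a zero of \<open>d\<close>, and a zero of \<open>d\<close> is dominated by one of
  the finitely many valuation rings in which \<open>d\<close> is a nonunit.\<close>

lemma finite_poles: "finite {P \<in> C. x \<notin> P}"
proof -
  obtain \<A> where cov: "affine_cover scale C \<A>" by (rule affine_cover_exists)
  have "finite {P \<in> local_rings A. x \<notin> P}" if A: "A \<in> \<A>" for A
  proof -
    note am = affine_coverD(2)[OF cov A]
    obtain a d where ad: "a \<in> A" "d \<in> A" "d \<noteq> 0" "x = a / d" using affine_modelD(2)[OF am] by blast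
    have "P \<in> normalization_map C ` {R. valuation R \<and> d \<in> nonunits R} \<and> d \<notin> constants"
      if P: "P \<in> local_rings A" "x \<notin> P" for P
    proof -
      have cl: "P \<in> closed_points C" using P affine_coverD(3)[OF cov A] not_in_closed by blast
      note pr = closed_point_ring[OF cl]
      note sub = point_ring_subalgebra[OF pr]
      have dP: "d \<in> P" "a \<in> P" using local_rings_cases(1)[OF am P(1)] ad by auto
      have "inverse d \<notin> P" using subalgebra_mult[OF sub dP(2), of "inverse d"] P(2) ad(4) by (auto simp: divide_inverse)
      then have d: "d \<in> nonunits P" using dP by (simp add: nonunits_iff)
      obtain R where R: "valuation R" "dominates R P" using dominating_valuation_exists[OF pr] .
      then have "normalization_map C R = P" "d \<in> nonunits R"
        using center_eq' cl d by (auto simp: dominates_def)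
      then show ?thesis using R(1) nonunits_nonconstant[OF sub d ad(3)] by blast
    qed
    then have "{P \<in> local_rings A. x \<notin> P} \<subseteq> (if d \<in> constants then {} else normalization_map C ` {R. valuation R \<and> d \<in> nonunits R})"
      by auto
    moreover have "finite (if d \<in> constants then {} else normalization_map C ` {R. valuation R \<and> d \<in> nonunits R})"
      using finite_zeros by auto
    ultimately show ?thesis by (rule finite_subset)
  qed
  moreover have "{P \<in> C. x \<notin> P} = (\<Union>A\<in>\<A>. {P \<in> local_rings A. x \<notin> P})"
    using cov unfolding affine_cover_def by blast
  ultimately show ?thesis using affine_coverD(1)[OF cov] by simp
qed

lemma pole_exists:
  assumes "x \<notin> constants"
  obtains P where "P \<in> closed_points C" "x \<notin> P"
  using assms constant_if_regular by blast

text \<open>Two closed points of an affine chart are separated by a function on the chart: if every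
  function that vanishes at \<open>Q\<close> vanishes at \<open>P\<close>, subtract from a function that vanishes at \<open>P\<close> its
  value at \<open>Q\<close>.\<close>

lemma chart_separates:
  assumes am: "affine_model scale A" and P: "P \<in> local_rings A" "point_ring P"
    and Q: "Q \<in> local_rings A" "point_ring Q" and ne: "P \<noteq> Q"
  obtains b where "b \<in> A" "b \<in> nonunits Q" "b \<notin> nonunits P"
proof (rule ccontr)
  assume "\<not> thesis"
  then have le: "A \<inter> nonunits Q \<subseteq> A \<inter> nonunits P" using that by blast
  have "A \<inter> nonunits P \<subseteq> A \<inter> nonunits Q"
  proof (intro subsetI IntI)
    fix y assume y: "y \<in> A \<inter> nonunits P"
    then show "y \<in> A" by blast
    then have "y \<in> Q" using local_rings_cases(1)[OF am Q(1)] by blast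
    then obtain c where c: "y - emb c \<in> nonunits Q" using point_ring_residue[OF Q(2)] by blast
    moreover have "y - emb c \<in> A"
      using y by (intro subalgebra_diff subalgebra_emb affine_modelD(1)[OF am]) auto
    ultimately have "y - emb c \<in> nonunits P" using le by blast
    then have "y - (y - emb c) \<in> nonunits P" using y point_ring_diff[OF P(2)] by blast
    then have "c = 0" using nonunits_emb[OF point_ring_subalgebra[OF P(2)]] by auto
    then show "y \<in> nonunits Q" using c by simp
  qed
  then have "A \<inter> nonunits P = A \<inter> nonunits Q" using le by blast
  then show False using local_rings_cases(3)[OF am] P Q ne by metis
qed

section \<open>Coherent sheaves of rank one\<close>

definition is_submodule :: "'a set \<Rightarrow> 'a set \<Rightarrow> bool" where
  "is_submodule R N \<longleftrightarrow> 0 \<in> N \<and> (\<forall>x\<in>N. \<forall>y\<in>N. x + y \<in> N) \<and> (\<forall>a\<in>R. \<forall>x\<in>N. a * x \<in> N)"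

lemma submodule_0: "is_submodule R N \<Longrightarrow> 0 \<in> N"
  and submodule_add: "is_submodule R N \<Longrightarrow> x \<in> N \<Longrightarrow> y \<in> N \<Longrightarrow> x + y \<in> N"
  and submodule_mult: "is_submodule R N \<Longrightarrow> a \<in> R \<Longrightarrow> x \<in> N \<Longrightarrow> a * x \<in> N"
  by (auto simp: is_submodule_def)

lemma submodule_sum: "is_submodule R N \<Longrightarrow> (\<And>i. i \<in> S \<Longrightarrow> f i \<in> N) \<Longrightarrow> sum f S \<in> N"
  by (induction S rule: infinite_finite_induct) (auto intro: submodule_add submodule_0)

lemma submodule_uminus: "subalgebra scale R \<Longrightarrow> is_submodule R N \<Longrightarrow> x \<in> N \<Longrightarrow> - x \<in> N"
  using submodule_mult[of R N "-1" x] subalgebra_uminus[of R 1] subalgebra_1[of R] by auto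

lemma submodule_diff: "subalgebra scale R \<Longrightarrow> is_submodule R N \<Longrightarrow> x \<in> N \<Longrightarrow> y \<in> N \<Longrightarrow> x - y \<in> N"
  using submodule_add[of R N x "- y"] submodule_uminus by auto

lemma generated_module_least:
  assumes "is_submodule R N" "M \<subseteq> N"
  shows "generated_module R M \<subseteq> N"
  unfolding generated_module_def using assms
  by (auto intro!: submodule_sum submodule_mult)

lemma generated_module_finite:
  assumes "subalgebra scale R" "finite G"
  shows "generated_module R G = {(\<Sum>m\<in>G. c m * m) | c. \<forall>m\<in>G. c m \<in> R}"
proof (intro equalityI subsetI)
  fix x assume "x \<in> generated_module R G"
  then obtain T c where T: "T \<subseteq> G" "\<forall>m\<in>T. c m \<in> R" "x = (\<Sum>m\<in>T. c m * m)"
    unfolding generated_module_def by blast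
  then have "x = (\<Sum>m\<in>G. (if m \<in> T then c m else 0) * m)"
    using assms(2) by (simp add: if_distrib[of "\<lambda>u. u * _"] sum.If_cases Int_absorb1 cong: if_cong)
  moreover have "\<forall>m\<in>G. (if m \<in> T then c m else 0) \<in> R" using T subalgebra_0[OF assms(1)] by auto
  ultimately show "x \<in> {(\<Sum>m\<in>G. c m * m) | c. \<forall>m\<in>G. c m \<in> R}"
    by (intro CollectI exI[of _ "\<lambda>m. if m \<in> T then c m else 0"] conjI)
next
  fix x assume "x \<in> {(\<Sum>m\<in>G. c m * m) | c. \<forall>m\<in>G. c m \<in> R}"
  then show "x \<in> generated_module R G" unfolding generated_module_def using assms(2) by blast
qed

context
  fixes R assumes R: "subalgebra scale R"
begin

lemma generated_module_contains: "M \<subseteq> generated_module R M"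
proof
  fix x assume "x \<in> M"
  then show "x \<in> generated_module R M" unfolding generated_module_def
    using subalgebra_1[OF R] by (intro CollectI exI[of _ "{x}"] exI[of _ "\<lambda>_. 1"]) auto
qed

lemma generated_module_submodule: "is_submodule R (generated_module R M)"
  unfolding is_submodule_def
proof (intro conjI ballI)
  show "0 \<in> generated_module R M" unfolding generated_module_def
    by (intro CollectI exI[of _ "{}"]) auto
  fix x assume "x \<in> generated_module R M"
  then obtain T c where T: "finite T" "T \<subseteq> M" "\<forall>m\<in>T. c m \<in> R" "x = (\<Sum>m\<in>T. c m * m)"
    unfolding generated_module_def by blast
  show "a * x \<in> generated_module R M" if "a \<in> R" for a
    unfolding generated_module_def using T that
    by (intro CollectI exI[of _ T] exI[of _ "\<lambda>m. a * c m"]) (auto simp: sum_distrib_left mult_ac intro: subalgebra_mult[OF R])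
  fix y assume "y \<in> generated_module R M"
  then obtain T' c' where T': "finite T'" "T' \<subseteq> M" "\<forall>m\<in>T'. c' m \<in> R" "y = (\<Sum>m\<in>T'. c' m * m)"
    unfolding generated_module_def by blast
  define d where "d m = (if m \<in> T then c m else 0) + (if m \<in> T' then c' m else 0)" for m
  have "x = (\<Sum>m\<in>T \<union> T'. (if m \<in> T then c m else 0) * m)"
    using T T' by (simp add: if_distrib[of "\<lambda>u. u * _"] sum.If_cases Int_absorb1 cong: if_cong)
  moreover have "y = (\<Sum>m\<in>T \<union> T'. (if m \<in> T' then c' m else 0) * m)"
    using T T' by (simp add: if_distrib[of "\<lambda>u. u * _"] sum.If_cases Int_absorb1 cong: if_cong)
  ultimately have "x + y = (\<Sum>m\<in>T \<union> T'. d m * m)" by (simp add: d_def distrib_right sum.distrib)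
  moreover have "\<forall>m\<in>T \<union> T'. d m \<in> R"
    using T T' subalgebra_0[OF R] by (auto simp: d_def intro!: subalgebra_add[OF R])
  ultimately show "x + y \<in> generated_module R M" unfolding generated_module_def
    using T T' by (intro CollectI exI[of _ "T \<union> T'"] exI[of _ d]) auto
qed

lemma generated_module_mono: "M \<subseteq> generated_module R N \<Longrightarrow> generated_module R M \<subseteq> generated_module R N"
  using generated_module_least[OF generated_module_submodule] .

end

text \<open>Sheaves of rank one, with \<open>K\<close> in place of the vectors that vanish from \<open>1\<close> on.\<close>

definition coherent1 :: "('a set \<Rightarrow> 'a set) \<Rightarrow> bool" where
  "coherent1 L \<longleftrightarrow> L UNIV = UNIV \<and> (\<exists>\<A>. affine_cover scale C \<A> \<and>
     (\<forall>A\<in>\<A>. \<exists>G. finite G \<and> (\<forall>P\<in>local_rings A. L P = generated_module P G)))"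

definition vec1 :: "'a \<Rightarrow> nat \<Rightarrow> 'a" where "vec1 x = (\<lambda>i. if i = 0 then x else 0)"

lemma vec1_simps [simp]: "vec1 x 0 = x" "vec1 x \<in> vectors (Suc 0)"
  by (auto simp: vec1_def vectors_def)

lemma vectors_one: "v \<in> vectors 1 \<longleftrightarrow> v = vec1 (v 0)"
  unfolding vectors_def vec1_def by (auto simp: fun_eq_iff)

lemma vectors_one_range: "vectors 1 = range vec1"
proof (intro equalityI subsetI)
  fix v :: "nat \<Rightarrow> 'a" assume "v \<in> vectors 1"
  then have "v = vec1 (v 0)" by (simp only: vectors_one)
  then show "v \<in> range vec1" by (rule range_eqI)
qed auto

lemma vec1_line_sheaf: "vec1 x \<in> line_sheaf L P \<longleftrightarrow> x \<in> L P"
  unfolding line_sheaf_def by simp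

lemma vec1_inj: "inj vec1"
  by (metis injI vec1_simps(1))

lemma line_sheaf_vec1: "line_sheaf L P = vec1 ` L P"
proof (intro equalityI subsetI)
  fix v assume "v \<in> line_sheaf L P"
  then have "v = vec1 (v 0)" "v 0 \<in> L P" using vectors_one by (auto simp: line_sheaf_def)
  then show "v \<in> vec1 ` L P" by blast
qed (auto simp: vec1_line_sheaf)

lemma vec1_generated:
  assumes "subalgebra scale P" "finite G"
  shows "{(\<lambda>i. \<Sum>g\<in>vec1 ` G. c g * g i) | c. \<forall>g\<in>vec1 ` G. c g \<in> P} = vec1 ` generated_module P G"
proof -
  have eq: "(\<lambda>i. \<Sum>g\<in>vec1 ` G. c g * g i) = vec1 (\<Sum>m\<in>G. c (vec1 m) * m)" for c
    by (subst sum.reindex) (auto simp: inj_on_subset[OF vec1_inj] vec1_def)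
  have "vec1 (\<Sum>m\<in>G. d m * m) \<in> {(\<lambda>i. \<Sum>g\<in>vec1 ` G. c g * g i) | c. \<forall>g\<in>vec1 ` G. c g \<in> P}"
    if "\<forall>m\<in>G. d m \<in> P" for d
    using that unfolding eq by (intro CollectI exI[of _ "\<lambda>v. d (v 0)"]) auto
  then show ?thesis
    unfolding generated_module_finite[OF assms] using eq by auto
qed

lemma coherent1_iff: "coherent_sheaf scale C 1 (line_sheaf L) \<longleftrightarrow> coherent1 L"
proof -
  have U: "line_sheaf L UNIV = vectors 1 \<longleftrightarrow> L UNIV = UNIV"
    unfolding line_sheaf_vec1 vectors_one_range using inj_image_eq_iff[OF vec1_inj] by metis
  have "(\<exists>G. finite G \<and> G \<subseteq> vectors 1 \<and>
           (\<forall>P\<in>local_rings A. line_sheaf L P = {(\<lambda>i. \<Sum>g\<in>G. c g * g i) | c. \<forall>g\<in>G. c g \<in> P}))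
      \<longleftrightarrow> (\<exists>G. finite G \<and> (\<forall>P\<in>local_rings A. L P = generated_module P G))"
    if A: "local_rings A \<subseteq> C" for A
  proof -
    have sub: "subalgebra scale P" if "P \<in> local_rings A" for P using A that C_subalgebra by blast
    have "(\<exists>G. finite G \<and> G \<subseteq> vectors 1 \<and>
           (\<forall>P\<in>local_rings A. line_sheaf L P = {(\<lambda>i. \<Sum>g\<in>G. c g * g i) | c. \<forall>g\<in>G. c g \<in> P}))
      \<longleftrightarrow> (\<exists>G. finite G \<and>
           (\<forall>P\<in>local_rings A. line_sheaf L P = {(\<lambda>i. \<Sum>g\<in>vec1 ` G. c g * g i) | c. \<forall>g\<in>vec1 ` G. c g \<in> P}))"
      (is "?l \<longleftrightarrow> ?r")
    proof
      assume ?l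
      then obtain G where G: "finite G" "G \<subseteq> vectors 1"
        "\<forall>P\<in>local_rings A. line_sheaf L P = {(\<lambda>i. \<Sum>g\<in>G. c g * g i) | c. \<forall>g\<in>G. c g \<in> P}" by blast
      have "vec1 ` (\<lambda>v. v 0) ` G = G"
      proof -
        have "vec1 (v 0) = v" if "v \<in> G" for v using G(2) that vectors_one[of v] by (metis subsetD)
        then show ?thesis unfolding image_image by (simp cong: image_cong)
      qed
      then show ?r using G by (intro exI[of _ "(\<lambda>v. v 0) ` G"]) simp
    next
      assume ?r
      then obtain G where "finite G" "\<forall>P\<in>local_rings A. line_sheaf L P = {(\<lambda>i. \<Sum>g\<in>vec1 ` G. c g * g i) | c. \<forall>g\<in>vec1 ` G. c g \<in> P}"
        by blast
      then show ?l by (intro exI[of _ "vec1 ` G"]) auto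
    qed
    also have "\<dots> \<longleftrightarrow> (\<exists>G. finite G \<and> (\<forall>P\<in>local_rings A. L P = generated_module P G))"
    proof (intro ex_cong1 conj_cong ball_cong refl, goal_cases)
      case (1 G P)
      show ?case
        unfolding line_sheaf_vec1 vec1_generated[OF sub[OF 1(2)] 1(1)] by (rule inj_image_eq_iff[OF vec1_inj])
    qed
    finally show ?thesis .
  qed
  note chart = this
  show ?thesis unfolding coherent_sheaf_def coherent1_def U
  proof (intro conj_cong ex_cong1 ball_cong refl, goal_cases)
    case (1 \<A> A)
    then show ?case using chart[of A] affine_coverD(3)[of \<A> A] by simp
  qed
qed

end

context complete_curve
begin

subsection \<open>Changing one stalk\<close>

lemma coherent1_charts:
  assumes "coherent1 L"
  obtains \<A> where "affine_cover scale C \<A>"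
    "\<And>A. A \<in> \<A> \<Longrightarrow> \<exists>G. finite G \<and> (\<forall>P\<in>local_rings A. L P = generated_module P G)"
  using assms unfolding coherent1_def by blast

lemma coherent1_submodule:
  assumes "coherent1 L" "P \<in> C"
  shows "is_submodule P (L P)"
proof -
  obtain \<A> where A: "affine_cover scale C \<A>"
    "\<And>A. A \<in> \<A> \<Longrightarrow> \<exists>G. finite G \<and> (\<forall>P\<in>local_rings A. L P = generated_module P G)"
    using coherent1_charts[OF assms(1)] by blast
  then obtain A G where "\<forall>P\<in>local_rings A. L P = generated_module P G" "P \<in> local_rings A"
    using affine_coverD(4)[OF A(1) assms(2)] by blast
  then show ?thesis using generated_module_submodule[OF C_subalgebra[OF assms(2)]] by simp
qed

lemma nonunits_power_iff:
  "subalgebra scale P \<Longrightarrow> x \<in> P \<Longrightarrow> x \<notin> nonunits P \<Longrightarrow> x ^ n \<notin> nonunits P"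
  using one_not_nonunit nonunits_prime[of P x "x ^ _"] subalgebra_power
  by (induction n) auto

lemma nonunits_UNIV: "nonunits UNIV = {0}"
  by (auto simp: nonunits_def)

text \<open>The poles of \<open>u\<close> on a chart, apart from \<open>P\<^sub>0\<close>, are cleared by a function that does not
  vanish at \<open>P\<^sub>0\<close>.\<close>

lemma chart_clears_poles:
  assumes cov: "affine_cover scale C \<A>" "A \<in> \<A>" and P0: "P0 \<in> local_rings A" "P0 \<in> closed_points C"
  obtains b where "b \<in> A" "b \<notin> nonunits P0" "\<And>Q. Q \<in> local_rings A - {P0} \<Longrightarrow> b * u \<in> Q"
proof -
  note am = affine_coverD(2)[OF cov]
  note pr0 = closed_point_ring[OF P0(2)]
  note sub0 = point_ring_subalgebra[OF pr0]
  note Asub = affine_modelD(1)[OF am]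
  define S where "S = {Q \<in> local_rings A - {P0}. u \<notin> Q}"
  have finS: "finite S"
    unfolding S_def using affine_coverD(3)[OF cov] by (intro finite_subset[OF _ finite_poles[of u]]) auto
  have "\<exists>b. b \<in> A \<and> b \<notin> nonunits P0 \<and> b * u \<in> Q" if Q: "Q \<in> S" for Q
  proof -
    have Qcl: "Q \<in> closed_points C" using Q affine_coverD(3)[OF cov] not_in_closed[of Q u] by (auto simp: S_def)
    note prQ = closed_point_ring[OF Qcl]
    obtain b where b: "b \<in> A" "b \<in> nonunits Q" "b \<notin> nonunits P0"
      using chart_separates[OF am P0(1) pr0 _ prQ] Q by (auto simp: S_def)
    obtain N where "b ^ N * u \<in> Q" using nonunit_power_absorbs[OF prQ b(2), of u] by blast
    then show ?thesis
      using b nonunits_power_iff[OF sub0, of b N] local_rings_cases(1)[OF am P0(1)] subalgebra_power[OF Asub b(1)]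
      by (intro exI[of _ "b ^ N"]) auto
  qed
  then obtain h where h: "\<And>Q. Q \<in> S \<Longrightarrow> h Q \<in> A" "\<And>Q. Q \<in> S \<Longrightarrow> h Q \<notin> nonunits P0"
    "\<And>Q. Q \<in> S \<Longrightarrow> h Q * u \<in> Q" by metis
  show ?thesis
  proof (rule that[of "prod h S"])
    show "prod h S \<in> A" using h(1) subalgebra_prod[OF Asub, of S h] by blast
    have "prod h T \<notin> nonunits P0" if "T \<subseteq> S" for T
      using finite_subset[OF that finS] that
    proof (induction T rule: finite_induct)
      case empty then show ?case using one_not_nonunit[OF sub0] by simp
    next
      case (insert Q T)
      have "h Q \<in> P0" "prod h T \<in> P0"
        using insert h(1) local_rings_cases(1)[OF am P0(1)] subalgebra_prod[OF Asub, of T h] by blast+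
      then show ?case using insert h(2)[of Q] nonunits_prime[OF sub0, of "h Q" "prod h T"] by auto
    qed
    then show "prod h S \<notin> nonunits P0" by blast
    fix Q assume Q: "Q \<in> local_rings A - {P0}"
    have subQ: "subalgebra scale Q" using Q affine_coverD(3)[OF cov] C_subalgebra by blast
    have AQ: "A \<subseteq> Q" using local_rings_cases(1)[OF am] Q by blast
    show "prod h S * u \<in> Q"
    proof (cases "Q \<in> S")
      case True
      have "prod h S * u = prod h (S - {Q}) * (h Q * u)"
        using prod.remove[OF finS True, of h] by (simp add: mult_ac)
      moreover have "prod h (S - {Q}) \<in> Q" using h(1) AQ subalgebra_prod[OF Asub, of "S - {Q}" h] by blast
      ultimately show ?thesis using subalgebra_mult[OF subQ] h(3)[OF True] by metis
    next
      case False
      then have "u \<in> Q" using Q by (auto simp: S_def)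
      then show ?thesis using \<open>prod h S \<in> A\<close> AQ subalgebra_mult[OF subQ] by blast
    qed
  qed
qed

text \<open>A function that vanishes to high order at \<open>P\<^sub>0\<close> has finitely many other zeros on the chart; for
  each of these, add a function that does not vanish there.\<close>

lemma chart_functions_vanishing:
  assumes cov: "affine_cover scale C \<A>" "A \<in> \<A>" and P0: "P0 \<in> local_rings A" "P0 \<in> closed_points C"
    and fin: "finite G"
  obtains B where "finite B" "B \<subseteq> A" "\<And>b y. b \<in> B \<Longrightarrow> y \<in> G \<Longrightarrow> b * y \<in> P0"
    "\<And>Q. Q \<in> local_rings A - {P0} \<Longrightarrow> \<exists>b\<in>B. b \<noteq> 0 \<and> inverse b \<in> Q"
proof -
  note am = affine_coverD(2)[OF cov]
  note pr0 = closed_point_ring[OF P0(2)]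
  note sub0 = point_ring_subalgebra[OF pr0]
  note Asub = affine_modelD(1)[OF am]
  have ex: "\<exists>b. b \<in> A \<and> b \<noteq> 0 \<and> inverse b \<in> Q \<and> (\<forall>y\<in>G. b * y \<in> P0)" if Q: "Q \<in> local_rings A - {P0}" for Q
  proof -
    have subQ: "subalgebra scale Q" using Q affine_coverD(3)[OF cov] C_subalgebra by blast
    have AQ: "A \<subseteq> Q" using local_rings_cases(1)[OF am] Q by blast
    have "\<exists>b. b \<in> A \<and> b \<in> nonunits P0 \<and> b \<notin> nonunits Q"
    proof (cases "Q = UNIV")
      case True
      have "\<not> A \<inter> nonunits P0 \<subseteq> {0}"
      proof
        assume "A \<inter> nonunits P0 \<subseteq> {0}"
        then have "A \<inter> nonunits P0 = {0}"
          using subalgebra_0[OF Asub] zero_in_nonunits[OF subalgebra_0[OF sub0]] by blast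
        then have "P0 = localization A {0}" using local_rings_cases(3)[OF am P0(1)] by simp
        moreover have "x \<in> localization A {0}" for x
          using affine_modelD(2)[OF am, of x] unfolding localization_def by blast
        ultimately show False using point_ring_proper[OF pr0] by blast
      qed
      then show ?thesis using True nonunits_UNIV by auto
    next
      case False
      then have prQ: "point_ring Q" using Q affine_coverD(3)[OF cov] in_C_cases closed_point_ring by blast
      show ?thesis using chart_separates[OF am _ prQ P0(1) pr0] Q by (metis DiffD1 DiffD2 singletonI)
    qed
    then obtain b where b: "b \<in> A" "b \<in> nonunits P0" "b \<notin> nonunits Q" by blast
    have "\<forall>y. \<exists>N. \<forall>n\<ge>N. b ^ n * y \<in> P0" using nonunit_power_absorbs[OF pr0 b(2)] by metis
    then obtain N where N: "\<And>y n. n \<ge> N y \<Longrightarrow> b ^ n * y \<in> P0" by metis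
    define n where "n = sum N G"
    have "b ^ n * y \<in> P0" if "y \<in> G" for y
      using N member_le_sum[OF that, of N] fin by (simp add: n_def)
    moreover have "b ^ n \<notin> nonunits Q" using nonunits_power_iff[OF subQ] b AQ by blast
    moreover have bnA: "b ^ n \<in> A" using b subalgebra_power[OF Asub] by blast
    ultimately show ?thesis using AQ
      by (intro exI[of _ "b ^ n"]) (auto simp: nonunits_iff)
  qed
  have U: "UNIV \<in> local_rings A - {P0}" using UNIV_in_local_rings[OF am] point_ring_proper[OF pr0] by auto
  obtain b where b: "\<And>Q. Q \<in> local_rings A - {P0} \<Longrightarrow> b Q \<in> A \<and> b Q \<noteq> 0 \<and> inverse (b Q) \<in> Q \<and> (\<forall>y\<in>G. b Q * y \<in> P0)"
    using ex by metis
  define S where "S = insert UNIV {Q \<in> local_rings A - {P0}. inverse (b UNIV) \<notin> Q}"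
  have finS: "finite S" unfolding S_def using affine_coverD(3)[OF cov]
    by (auto intro: finite_subset[OF _ finite_poles[of "inverse (b UNIV)"]])
  have S: "S \<subseteq> local_rings A - {P0}" using U by (auto simp: S_def)
  show ?thesis
  proof (rule that[of "b ` S"])
    show "finite (b ` S)" using finS by blast
    show "b ` S \<subseteq> A" using b S by blast
    show "c * y \<in> P0" if "c \<in> b ` S" "y \<in> G" for c y using that b S by blast
    fix Q assume Q: "Q \<in> local_rings A - {P0}"
    show "\<exists>c\<in>b ` S. c \<noteq> 0 \<and> inverse c \<in> Q"
    proof (cases "inverse (b UNIV) \<in> Q")
      case True then show ?thesis using b[OF U] by (auto simp: S_def)
    next
      case False then show ?thesis using b[OF Q] Q by (auto simp: S_def)
    qed
  qed
qed

text \<open>On a chart that contains \<open>P\<^sub>0\<close>, the modified sheaf is generated by generators of the new stalk,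
  multiplied by functions that do not vanish at \<open>P\<^sub>0\<close> in order to be sections of \<open>L\<close> elsewhere,
  together with the generators of \<open>L\<close>, multiplied by functions that vanish to high order at \<open>P\<^sub>0\<close> and
  have no other common zero.\<close>

lemma coherent1_modify:
  assumes L: "coherent1 L" and P0: "P0 \<in> closed_points C" and H: "finite H"
    and m0: "m0 \<in> generated_module P0 H" "m0 \<noteq> 0"
  shows "coherent1 (L(P0 := generated_module P0 H))"
proof -
  let ?M = "generated_module P0 H"
  let ?L = "L(P0 := ?M)"
  note pr0 = closed_point_ring[OF P0]
  note sub0 = point_ring_subalgebra[OF pr0]
  note M = generated_module_submodule[OF sub0, of H]
  obtain \<A> where cov: "affine_cover scale C \<A>"
    and G: "\<And>A. A \<in> \<A> \<Longrightarrow> \<exists>G. finite G \<and> (\<forall>P\<in>local_rings A. L P = generated_module P G)"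
    using coherent1_charts[OF L] by blast
  have "\<exists>G. finite G \<and> (\<forall>P\<in>local_rings A. ?L P = generated_module P G)" if A: "A \<in> \<A>" for A
  proof (cases "P0 \<in> local_rings A")
    case False
    then show ?thesis using G[OF A] by auto
  next
    case P0A: True
    note am = affine_coverD(2)[OF cov A]
    obtain G where G: "finite G" "\<And>P. P \<in> local_rings A \<Longrightarrow> L P = generated_module P G" using G[OF A] by blast
    have "\<not> G \<subseteq> {0}"
    proof
      assume "G \<subseteq> {0}"
      moreover have "is_submodule UNIV {0}" by (auto simp: is_submodule_def)
      ultimately have "generated_module UNIV G \<subseteq> {0}" by (intro generated_module_least)
      then have "L UNIV \<subseteq> {0}" using G(2)[OF UNIV_in_local_rings[OF am]] by simp
      then show False using L unfolding coherent1_def using one_neq_zero by blast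
    qed
    then obtain g0 where g0: "g0 \<in> G" "g0 \<noteq> 0" by blast
    have "\<exists>b. b \<in> A \<and> b \<notin> nonunits P0 \<and> (\<forall>Q\<in>local_rings A - {P0}. b * (y / g0) \<in> Q)" for y
      using chart_clears_poles[OF cov A P0A P0, of "y / g0"] by metis
    then obtain b where b: "\<And>y. b y \<in> A" "\<And>y. b y \<notin> nonunits P0"
      "\<And>y Q. Q \<in> local_rings A - {P0} \<Longrightarrow> b y * (y / g0) \<in> Q" by metis
    obtain B where B: "finite B" "B \<subseteq> A" "\<And>c y. c \<in> B \<Longrightarrow> y \<in> (\<lambda>y. y / m0) ` G \<Longrightarrow> c * y \<in> P0"
      "\<And>Q. Q \<in> local_rings A - {P0} \<Longrightarrow> \<exists>c\<in>B. c \<noteq> 0 \<and> inverse c \<in> Q"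
      using chart_functions_vanishing[OF cov A P0A P0, of "(\<lambda>y. y / m0) ` G"] G(1) by (metis finite_imageI)
    define G' where "G' = (\<lambda>h. b h * h) ` H \<union> (\<lambda>(c,y). c * y) ` (B \<times> G)"
    have "finite G'" unfolding G'_def using H B G by auto
    moreover have "?L Q = generated_module Q G'" if Q: "Q \<in> local_rings A" for Q
    proof (cases "Q = P0")
      case True
      have "G' \<subseteq> ?M"
      proof -
        have "b h * h \<in> ?M" if "h \<in> H" for h
          using submodule_mult[OF M, of "b h" h] b(1) local_rings_cases(1)[OF am P0A]
            generated_module_contains[OF sub0, of H] that by blast
        moreover have "c * y \<in> ?M" if "c \<in> B" "y \<in> G" for c y
        proof -
          have "c * (y / m0) \<in> P0" using B(3) that by blast
          then have "c * (y / m0) * m0 \<in> ?M" using submodule_mult[OF M] m0 by blast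
          then show ?thesis using m0(2) by simp
        qed
        ultimately show ?thesis by (auto simp: G'_def)
      qed
      moreover have "H \<subseteq> generated_module P0 G'"
      proof
        fix h assume "h \<in> H"
        then have "b h * h \<in> generated_module P0 G'"
          using generated_module_contains[OF sub0, of G'] by (auto simp: G'_def)
        moreover have bP: "b h \<in> P0" using b(1) local_rings_cases(1)[OF am P0A] by blast
        then have "inverse (b h) \<in> P0" "b h \<noteq> 0"
          using b(2)[of h] unit_inverse[of "b h" P0] zero_in_nonunits[OF subalgebra_0[OF sub0]] by auto
        ultimately have "inverse (b h) * (b h * h) \<in> generated_module P0 G'"
          using submodule_mult[OF generated_module_submodule[OF sub0]] by blast
        then show "h \<in> generated_module P0 G'" using \<open>b h \<noteq> 0\<close> by (simp add: field_simps)
      qed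
      ultimately show ?thesis
        using True generated_module_mono[OF sub0, of G' H] generated_module_mono[OF sub0, of H G'] by auto
    next
      case False
      have subQ: "subalgebra scale Q" using Q affine_coverD(3)[OF cov A] C_subalgebra by blast
      have AQ: "A \<subseteq> Q" using local_rings_cases(1)[OF am Q] .
      note GQ = generated_module_contains[OF subQ, of G] and NQ = generated_module_submodule[OF subQ]
      have "G' \<subseteq> generated_module Q G"
      proof -
        have "b h * h \<in> generated_module Q G" for h
        proof -
          have "b h * (h / g0) * g0 \<in> generated_module Q G"
            using b(3)[of Q h] Q False g0 GQ submodule_mult[OF NQ] by blast
          then show ?thesis using g0 by simp
        qed
        moreover have "c * y \<in> generated_module Q G" if "c \<in> B" "y \<in> G" for c y
          using that B(2) AQ GQ submodule_mult[OF NQ] by blast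
        ultimately show ?thesis by (auto simp: G'_def)
      qed
      moreover have "G \<subseteq> generated_module Q G'"
      proof
        fix y assume y: "y \<in> G"
        obtain c where c: "c \<in> B" "c \<noteq> 0" "inverse c \<in> Q" using B(4) Q False by blast
        have "c * y \<in> generated_module Q G'"
          using generated_module_contains[OF subQ, of G'] c y by (auto simp: G'_def)
        then have "inverse c * (c * y) \<in> generated_module Q G'" using c submodule_mult[OF NQ] by blast
        then show "y \<in> generated_module Q G'" using c by (simp add: field_simps)
      qed
      ultimately show ?thesis
        using False G(2)[OF Q] generated_module_mono[OF subQ, of G' G] generated_module_mono[OF subQ, of G G'] by auto
    qed
    ultimately show ?thesis by blast
  qed
  moreover have "?L UNIV = UNIV" using L point_ring_proper[OF pr0] by (auto simp: coherent1_def)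
  ultimately show ?thesis unfolding coherent1_def using cov by blast
qed

lemma coherent1_structure_sheaf: "coherent1 (\<lambda>P. P)"
proof -
  obtain \<A> where cov: "affine_cover scale C \<A>" by (rule affine_cover_exists)
  have "P = generated_module P {1}" if "P \<in> C" for P
    using generated_module_finite[OF C_subalgebra[OF that], of "{1}"] by (auto intro: exI[of _ "\<lambda>_. _"])
  then show ?thesis unfolding coherent1_def using cov affine_coverD(3)[OF cov] by blast
qed

section \<open>Adeles and the first cohomology\<close>

text \<open>Again the rank-one case, with \<open>lift1\<close> translating to vectors.\<close>

definition adeles1 :: "('a set \<Rightarrow> 'a) set" where
  "adeles1 = {a. (\<forall>P. P \<notin> closed_points C \<longrightarrow> a P = 0) \<and> finite {P \<in> closed_points C. a P \<notin> P}}"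

definition cob1 :: "('a set \<Rightarrow> 'a set) \<Rightarrow> ('a set \<Rightarrow> 'a) set" where
  "cob1 L = {a \<in> adeles1. \<exists>x. \<forall>P\<in>closed_points C. a P - x \<in> L P}"

definition lift1 :: "('a set \<Rightarrow> 'a) \<Rightarrow> 'a set \<Rightarrow> nat \<Rightarrow> 'a" where
  "lift1 a = (\<lambda>P. vec1 (a P))"

lemma zero_in_closed: "P \<in> closed_points C \<Longrightarrow> 0 \<in> P"
  using closed_point_ring point_ring_subalgebra subalgebra_0 by blast

lemma lift1_adeles: "lift1 a \<in> adeles C 1 \<longleftrightarrow> a \<in> adeles1"
proof -
  have "{P \<in> closed_points C. \<exists>i. lift1 a P i \<notin> P} = {P \<in> closed_points C. a P \<notin> P}"
    using zero_in_closed by (auto simp: lift1_def vec1_def split: if_splits)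
  moreover have "lift1 a P = (\<lambda>i. 0) \<longleftrightarrow> a P = 0" for P
    by (auto simp: lift1_def vec1_def fun_eq_iff)
  ultimately show ?thesis by (simp add: adeles_def adeles1_def lift1_def)
qed

lemma adeles_lift1: "a \<in> adeles C 1 \<Longrightarrow> a = lift1 (\<lambda>P. a P 0)"
proof
  fix P assume "a \<in> adeles C 1"
  then have "a P \<in> vectors 1" by (simp add: adeles_def)
  then show "a P = lift1 (\<lambda>P. a P 0) P" unfolding lift1_def by (simp only: vectors_one)
qed

lemma lift1_coboundaries: "lift1 a \<in> coboundaries C 1 (line_sheaf L) \<longleftrightarrow> a \<in> cob1 L"
proof -
  have eq: "(\<lambda>i. lift1 a P i - vec1 x i) = vec1 (a P - x)" for P x
    by (auto simp: lift1_def vec1_def)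
  have "(\<exists>x\<in>vectors 1. \<forall>P\<in>closed_points C. (\<lambda>i. lift1 a P i - x i) \<in> line_sheaf L P) \<longleftrightarrow>
      (\<exists>x. \<forall>P\<in>closed_points C. (\<lambda>i. lift1 a P i - vec1 x i) \<in> line_sheaf L P)"
    unfolding vectors_one_range by blast
  then show ?thesis
    unfolding coboundaries_def cob1_def mem_Collect_eq lift1_adeles eq vec1_line_sheaf by simp
qed

lemma adeles1_add: "a \<in> adeles1 \<Longrightarrow> b \<in> adeles1 \<Longrightarrow> (\<lambda>P. a P + b P) \<in> adeles1"
proof -
  assume "a \<in> adeles1" "b \<in> adeles1"
  moreover have "{P \<in> closed_points C. a P + b P \<notin> P} \<subseteq> {P \<in> closed_points C. a P \<notin> P} \<union> {P \<in> closed_points C. b P \<notin> P}"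
    using closed_point_ring point_ring_subalgebra subalgebra_add by blast
  ultimately show ?thesis unfolding adeles1_def by (auto intro: finite_subset)
qed

lemma adeles1_mult: "a \<in> adeles1 \<Longrightarrow> (\<lambda>P. h * a P) \<in> adeles1"
proof -
  assume "a \<in> adeles1"
  moreover have "{P \<in> closed_points C. h * a P \<notin> P} \<subseteq> {P \<in> closed_points C. a P \<notin> P} \<union> {P \<in> C. h \<notin> P}"
    using closed_point_ring point_ring_subalgebra subalgebra_mult closed_point_in_C by blast
  ultimately show ?thesis unfolding adeles1_def using finite_poles[of h] by (auto intro: finite_subset)
qed

lemma adeles1_uminus: "a \<in> adeles1 \<Longrightarrow> (\<lambda>P. - a P) \<in> adeles1"
  using adeles1_mult[of a "-1"] by simp

lemma adeles1_diff: "a \<in> adeles1 \<Longrightarrow> b \<in> adeles1 \<Longrightarrow> (\<lambda>P. a P - b P) \<in> adeles1"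
  using adeles1_add[OF _ adeles1_uminus[of b], of a] by simp

lemma adeles1_restrict:
  assumes "S \<subseteq> closed_points C"
  shows "(\<lambda>P. if P \<in> S then y else 0) \<in> adeles1"
proof -
  have "{P \<in> closed_points C. (if P \<in> S then y else 0) \<notin> P} \<subseteq> {P \<in> C. y \<notin> P}"
    using closed_point_in_C zero_in_closed by (auto split: if_splits)
  then have "finite {P \<in> closed_points C. (if P \<in> S then y else 0) \<notin> P}"
    using finite_poles by (rule finite_subset)
  moreover have "\<forall>P. P \<notin> closed_points C \<longrightarrow> (if P \<in> S then y else 0) = 0" using assms by auto
  ultimately show ?thesis unfolding adeles1_def by blast
qed

lemma adeles1_zero: "(\<lambda>P. 0) \<in> adeles1"
  using adeles1_restrict[of "{}"] by simp


definition skyscraper :: "'a set \<Rightarrow> 'a \<Rightarrow> 'a set \<Rightarrow> 'a" where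
  "skyscraper P y = (\<lambda>Q. if Q = P then y else 0)"

lemma adeles1_skyscraper: "P \<in> closed_points C \<Longrightarrow> skyscraper P y \<in> adeles1"
  using adeles1_restrict[of "{P}" y] by (simp add: skyscraper_def)

lemma cob1_adele: "a \<in> cob1 L \<Longrightarrow> a \<in> adeles1"
  by (simp add: cob1_def)

context
  fixes L assumes L: "\<And>P. P \<in> closed_points C \<Longrightarrow> is_submodule P (L P)"
begin

lemma cob1_add: "a \<in> cob1 L \<Longrightarrow> b \<in> cob1 L \<Longrightarrow> (\<lambda>P. a P + b P) \<in> cob1 L"
proof -
  assume ab: "a \<in> cob1 L" "b \<in> cob1 L"
  then obtain x y where "\<forall>P\<in>closed_points C. a P - x \<in> L P" "\<forall>P\<in>closed_points C. b P - y \<in> L P"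
    unfolding cob1_def by blast
  then have "\<forall>P\<in>closed_points C. (a P - x) + (b P - y) \<in> L P" using submodule_add[OF L] by blast
  then have "\<forall>P\<in>closed_points C. a P + b P - (x + y) \<in> L P" by (simp add: algebra_simps)
  then show ?thesis unfolding cob1_def using ab cob1_adele adeles1_add by blast
qed

lemma cob1_scale: "a \<in> cob1 L \<Longrightarrow> (\<lambda>P. emb c * a P) \<in> cob1 L"
proof -
  assume a: "a \<in> cob1 L"
  then obtain x where "\<forall>P\<in>closed_points C. a P - x \<in> L P" unfolding cob1_def by blast
  then have "\<forall>P\<in>closed_points C. emb c * (a P - x) \<in> L P"
    using submodule_mult[OF L] subalgebra_emb point_ring_subalgebra closed_point_ring by blast
  then have "\<forall>P\<in>closed_points C. emb c * a P - emb c * x \<in> L P" by (simp add: algebra_simps)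
  then show ?thesis unfolding cob1_def using a cob1_adele adeles1_mult by blast
qed

lemma cob1_zero: "(\<lambda>P. 0) \<in> cob1 L"
  unfolding cob1_def using submodule_0[OF L] adeles1_zero by (auto intro: exI[of _ 0])

lemma cob1_sum: "(\<And>i. i \<in> S \<Longrightarrow> a i \<in> cob1 L) \<Longrightarrow> (\<lambda>P. \<Sum>i\<in>S. a i P) \<in> cob1 L"
  by (induction S rule: infinite_finite_induct) (auto intro: cob1_add cob1_zero)

text \<open>A vector outside a subspace is detected by a linear form that vanishes on the subspace.\<close>

lemma functional_exists:
  assumes a0: "a0 \<notin> cob1 L"
  obtains \<phi> :: "('a set \<Rightarrow> 'a) \<Rightarrow> 'k" where "\<And>a b. \<phi> (\<lambda>P. a P + b P) = \<phi> a + \<phi> b"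
    "\<And>c a. \<phi> (\<lambda>P. emb c * a P) = c * \<phi> a" "\<And>a. a \<in> cob1 L \<Longrightarrow> \<phi> a = 0" "\<phi> a0 = 1"
proof -
  define sc :: "'k \<Rightarrow> ('a set \<Rightarrow> 'a) \<Rightarrow> 'a set \<Rightarrow> 'a" where "sc c a = (\<lambda>P. emb c * a P)" for c a
  interpret V: vector_space_pair sc "(*) :: 'k \<Rightarrow> 'k \<Rightarrow> 'k"
    by unfold_locales (auto simp: sc_def fun_eq_iff algebra_simps emb_add emb_mult)
  have S: "V.vs1.subspace (cob1 L)"
  proof (rule V.vs1.subspaceI)
    show "0 \<in> cob1 L" using cob1_zero by (simp add: zero_fun_def)
    show "a + b \<in> cob1 L" if "a \<in> cob1 L" "b \<in> cob1 L" for a b using cob1_add[OF that] by (simp add: plus_fun_def)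
    show "sc c a \<in> cob1 L" if "a \<in> cob1 L" for c a using cob1_scale[OF that] by (simp add: sc_def)
  qed
  obtain B where B: "B \<subseteq> cob1 L" "V.vs1.independent B" "cob1 L \<subseteq> V.vs1.span B"
    using V.vs1.maximal_independent_subset .
  have span: "V.vs1.span B \<subseteq> cob1 L" using V.vs1.span_minimal[OF B(1) S] .
  then have "V.vs1.independent (insert a0 B)" using a0 B(2) by (intro V.vs1.independent_insertI) auto
  then obtain \<phi> where \<phi>: "Vector_Spaces.linear sc (*) \<phi>" "\<forall>x\<in>insert a0 B. \<phi> x = (if x = a0 then 1 else 0)"
    using V.linear_independent_extend[of "insert a0 B" "\<lambda>x. if x = a0 then 1 else 0"] by blast
  interpret \<phi>: Vector_Spaces.linear sc "(*)" \<phi> by (rule \<phi>(1))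
  show ?thesis
  proof (rule that[of \<phi>])
    show "\<phi> (\<lambda>P. a P + b P) = \<phi> a + \<phi> b" for a b using \<phi>.add[of a b] by (simp add: plus_fun_def)
    show "\<phi> (\<lambda>P. emb c * a P) = c * \<phi> a" for c a using \<phi>.scale[of c a] by (simp add: sc_def)
    show "\<phi> a0 = 1" using \<phi>(2) by simp
    fix a assume "a \<in> cob1 L"
    then have "a \<in> V.vs1.span B" using B(3) by blast
    moreover have "\<phi> x = 0" if "x \<in> B" for x using \<phi>(2) that B(1) a0 by auto
    ultimately show "\<phi> a = 0" using V.linear_eq_0_on_span[OF \<phi>(1)] by blast
  qed
qed

end

end

locale curve_with_genus = complete_curve scale C
  for scale :: "'k::alg_closed_field \<Rightarrow> 'a::field \<Rightarrow> 'a" and C +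
  fixes g :: nat
  assumes genus: "has_arithmetic_genus scale C g"
begin

lemma structure_submodule: "P \<in> closed_points C \<Longrightarrow> is_submodule P P"
  using coherent1_submodule[OF coherent1_structure_sheaf] closed_point_in_C by blast

lemma adeles_dependent_mod_coboundaries:
  assumes w: "\<And>j. j \<le> g \<Longrightarrow> w j \<in> adeles1"
  obtains c where "\<exists>j\<le>g. c j \<noteq> 0" "(\<lambda>P. \<Sum>j\<le>g. emb (c j) * w j P) \<in> cob1 (\<lambda>P. P)"
proof -
  obtain b :: "nat \<Rightarrow> 'a set \<Rightarrow> nat \<Rightarrow> 'a" where b: "\<forall>j<g. b j \<in> adeles C 1"
    and ex1: "\<forall>a\<in>adeles C 1. \<exists>!c :: nat \<Rightarrow> 'k. (\<forall>j\<ge>g. c j = 0) \<and>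
           (\<lambda>P i. a P i - (\<Sum>j<g. scale (c j) (b j P i))) \<in> coboundaries C 1 (line_sheaf (\<lambda>P. P))"
    using genus unfolding has_arithmetic_genus_def has_h1_def by blast
  have ex: "\<exists>c :: nat \<Rightarrow> 'k. (\<lambda>P i. a P i - (\<Sum>j<g. scale (c j) (b j P i))) \<in> coboundaries C 1 (line_sheaf (\<lambda>P. P))"
    if "a \<in> adeles C 1" for a using ex1 that by blast
  have "\<exists>d. (\<lambda>P. w j P - (\<Sum>l<g. emb (d l) * b l P 0)) \<in> cob1 (\<lambda>P. P)" if j: "j \<le> g" for j
  proof -
    have "lift1 (w j) \<in> adeles C 1" using w[OF j] lift1_adeles by blast
    then obtain d where d: "(\<lambda>P i. lift1 (w j) P i - (\<Sum>l<g. scale (d l) (b l P i))) \<in> coboundaries C 1 (line_sheaf (\<lambda>P. P))"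
      using ex by blast
    then have "(\<lambda>P i. lift1 (w j) P i - (\<Sum>l<g. scale (d l) (b l P i))) \<in> adeles C 1"
      by (simp add: coboundaries_def)
    then have eq: "(\<lambda>P i. lift1 (w j) P i - (\<Sum>l<g. scale (d l) (b l P i)))
        = lift1 (\<lambda>P. lift1 (w j) P 0 - (\<Sum>l<g. scale (d l) (b l P 0)))"
      by (rule adeles_lift1)
    have "(\<lambda>P. lift1 (w j) P 0 - (\<Sum>l<g. scale (d l) (b l P 0))) \<in> cob1 (\<lambda>P. P)"
      using d unfolding eq lift1_coboundaries .
    then have "(\<lambda>P. w j P - (\<Sum>l<g. emb (d l) * b l P 0)) \<in> cob1 (\<lambda>P. P)"
      by (simp add: scale_eq lift1_def)
    then show ?thesis by blast
  qed
  then have "\<forall>j. \<exists>d. j \<le> g \<longrightarrow> (\<lambda>P. w j P - (\<Sum>l<g. emb (d l) * b l P 0)) \<in> cob1 (\<lambda>P. P)" by blast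
  from choice[OF this]
  obtain d where d: "\<forall>j. j \<le> g \<longrightarrow> (\<lambda>P. w j P - (\<Sum>l<g. emb (d j l) * b l P 0)) \<in> cob1 (\<lambda>P. P)" ..
  obtain c where c: "\<exists>j\<in>{..g}. c j \<noteq> 0" "\<forall>l\<in>{..<g}. (\<Sum>j\<in>{..g}. c j * d j l) = 0"
    using homogeneous_system_solution[of "UNIV :: 'k set" "{..<g}" "{..g}" "\<lambda>l j. d j l"] by auto
  have "(\<lambda>P. \<Sum>j\<le>g. emb (c j) * (w j P - (\<Sum>l<g. emb (d j l) * b l P 0))) \<in> cob1 (\<lambda>P. P)"
    using d by (intro cob1_sum cob1_scale structure_submodule) auto
  moreover have "(\<Sum>j\<le>g. emb (c j) * (w j P - (\<Sum>l<g. emb (d j l) * b l P 0))) = (\<Sum>j\<le>g. emb (c j) * w j P)" for P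
  proof -
    have "(\<Sum>j\<le>g. emb (c j) * (\<Sum>l<g. emb (d j l) * b l P 0)) = (\<Sum>j\<le>g. \<Sum>l<g. emb (c j * d j l) * b l P 0)"
      by (simp add: sum_distrib_left emb_mult mult_ac)
    also have "\<dots> = (\<Sum>l<g. emb (\<Sum>j\<le>g. c j * d j l) * b l P 0)"
      by (subst sum.swap) (simp add: emb_sum sum_distrib_right)
    also have "\<dots> = 0" using c(2) by simp
    finally show ?thesis by (simp add: right_diff_distrib sum_subtractf)
  qed
  ultimately show ?thesis using that[of c] c(1) by auto
qed

text \<open>A function without poles along the valuation rings lies in every local ring of the curve.  So
  an adele whose components are regular on all branches is a coboundary only if each component
  lies in the local ring of its point; as \<open>g + 1\<close> adeles have a combination that is a coboundary,
  this bounds the distance between the local rings and their integral closures.\<close>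

lemma branch_regular_constant:
  assumes "\<And>R. valuation R \<Longrightarrow> x \<in> R"
  shows "\<exists>c. x = emb c" "P \<in> closed_points C \<Longrightarrow> x \<in> P"
  using constant_if_no_pole[OF assms] subalgebra_emb[OF point_ring_subalgebra[OF closed_point_ring]]
  by (auto simp: constants_iff)

text \<open>There is a nonzero polynomial \<open>p\<close> of degree at most \<open>g\<close> such that \<open>p(z) y\<close> is in \<open>P\<close>, and \<open>p(z)\<close>
  is a power of \<open>z\<close> times a unit of \<open>P\<close>.\<close>

lemma conductor:
  assumes P: "P \<in> closed_points C" and z: "z \<in> nonunits P"
    and y: "\<And>R. valuation R \<Longrightarrow> P \<subseteq> R \<Longrightarrow> y \<in> R"
  shows "z ^ g * y \<in> P"
proof -
  note pr = closed_point_ring[OF P]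
  note sub = point_ring_subalgebra[OF pr]
  have zP: "z \<in> P" using z nonunits_subset by blast
  obtain c where c: "\<exists>j\<le>g. c j \<noteq> 0" "(\<lambda>Q. \<Sum>j\<le>g. emb (c j) * skyscraper P (z ^ j * y) Q) \<in> cob1 (\<lambda>P. P)"
    by (rule adeles_dependent_mod_coboundaries[of "\<lambda>j. skyscraper P (z ^ j * y)"]) (rule adeles1_skyscraper[OF P])
  define v where "v = (\<Sum>j\<le>g. emb (c j) * (z ^ j * y))"
  have "(\<lambda>Q. \<Sum>j\<le>g. emb (c j) * skyscraper P (z ^ j * y) Q) = skyscraper P v"
    by (auto simp: skyscraper_def v_def fun_eq_iff)
  then obtain x where x: "\<And>Q. Q \<in> closed_points C \<Longrightarrow> skyscraper P v Q - x \<in> Q"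
    using c(2) unfolding cob1_def by auto
  have xR: "x \<in> R" if R: "valuation R" for R
  proof -
    note Rsub = valuation_subalgebra[OF R]
    have "skyscraper P v (normalization_map C R) - x \<in> R" using x center[OF R] by blast
    moreover have "skyscraper P v (normalization_map C R) \<in> R"
    proof (cases "normalization_map C R = P")
      case True
      then have "P \<subseteq> R" using center[OF R] by blast
      then have "v \<in> R" unfolding v_def using y[OF R] zP
        by (intro subalgebra_sum[OF Rsub] subalgebra_mult[OF Rsub] subalgebra_emb[OF Rsub] subalgebra_power[OF Rsub]) auto
      then show ?thesis using True by (simp add: skyscraper_def)
    qed (simp add: skyscraper_def subalgebra_0[OF Rsub])
    ultimately show ?thesis using subalgebra_diff[OF Rsub, of "skyscraper P v (normalization_map C R)"] by fastforce
  qed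
  have "v - x \<in> P" using x[OF P] by (simp add: skyscraper_def)
  then have vP: "v \<in> P" using subalgebra_add[OF sub _ branch_regular_constant(2)[OF xR P], of "v - x"] by simp
  define i where "i = (LEAST i. c i \<noteq> 0)"
  obtain i' where i': "i' \<le> g" "c i' \<noteq> 0" using c(1) by blast
  have i: "c i \<noteq> 0" "i \<le> g" unfolding i_def using i' LeastI[of "\<lambda>j. c j \<noteq> 0" i'] Least_le[of "\<lambda>j. c j \<noteq> 0" i'] by auto
  have iz: "c j = 0" if "j < i" for j using not_less_Least that unfolding i_def by blast
  define m where "m = (\<Sum>j\<in>{i..g} - {i}. emb (c j) * z ^ (j - i))"
  have mP: "m \<in> nonunits P" unfolding m_def
    by (rule point_ring_sum[OF pr], rule nonunits_mult[OF sub subalgebra_emb[OF sub]], rule nonunits_power[OF sub z]) auto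
  have "v = (\<Sum>j\<in>{i..g}. emb (c j) * (z ^ j * y))"
    unfolding v_def using iz by (intro sum.mono_neutral_right) auto
  also have "\<dots> = (\<Sum>j\<in>{i..g}. emb (c j) * z ^ (j - i)) * (z ^ i * y)"
    unfolding sum_distrib_right
    by (intro sum.cong refl) (auto simp: mult_ac simp flip: power_add)
  also have "(\<Sum>j\<in>{i..g}. emb (c j) * z ^ (j - i)) = m + emb (c i)"
    using i(2) by (simp add: m_def sum.remove[of "{i..g}" i])
  finally have v: "v = (m + emb (c i)) * (z ^ i * y)" .
  have "z ^ i * y = inverse (m + emb (c i)) * v" using v point_ring_unit_add(2)[OF pr mP i(1)] by simp
  then have "z ^ i * y \<in> P" using vP point_ring_unit_add(3)[OF pr mP i(1)] subalgebra_mult[OF sub] by simp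
  then have "z ^ (g - i) * (z ^ i * y) \<in> P"
    using subalgebra_mult[OF sub subalgebra_power[OF sub zP]] by blast
  then show ?thesis using i(2) by (simp flip: mult.assoc power_add)
qed

text \<open>If every element regular on all branches is in \<open>P\<close>, then there is only one branch, because an
  element that separates two branches would be a nonunit of \<open>P\<close> and a unit on one of them.  The only
  branch is then \<open>P\<close> itself.\<close>

lemma nonvaluation_point:
  assumes P: "P \<in> closed_points C" and nv: "\<not> valuation P"
  obtains y where "y \<notin> P" "\<And>R. valuation R \<Longrightarrow> P \<subseteq> R \<Longrightarrow> y \<in> R"
proof (rule ccontr)
  assume "\<not> thesis"
  then have nex: "\<not> (\<exists>y. y \<notin> P \<and> (\<forall>R. valuation R \<longrightarrow> P \<subseteq> R \<longrightarrow> y \<in> R))" using that by blast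
  have cl: "y \<in> P" if "\<And>R. valuation R \<Longrightarrow> P \<subseteq> R \<Longrightarrow> y \<in> R" for y using nex that by blast
  note pr = closed_point_ring[OF P]
  obtain R where R: "valuation R" "dominates R P" using dominating_valuation_exists[OF pr] .
  have PR: "P \<subseteq> R" using R(2) by (simp add: dominates_def)
  then obtain u where u: "u \<in> R" "u \<notin> P" using R(1) nv by (metis subsetI subset_antisym)
  then obtain S where S: "valuation S" "P \<subseteq> S" "S \<noteq> R" using cl by blast
  let ?\<L> = "{L. valuation L \<and> P \<subseteq> L} - {R}"
  have L: "finite ?\<L>" "\<And>L. L \<in> ?\<L> \<Longrightarrow> valuation L" "\<And>L. L \<in> ?\<L> \<Longrightarrow> L \<inter> UNIV \<noteq> R \<inter> UNIV"
    using finite_valuations_over[OF P] by auto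
  obtain w where w: "w - 1 \<in> nonunits R" "\<And>L. L \<in> ?\<L> \<Longrightarrow> w \<in> nonunits L"
  proof (rule separating_element[OF subextension_UNIV L(1,2) R(1) L(3)])
    fix w assume "w - 1 \<in> nonunits R" "\<And>L. L \<in> ?\<L> \<Longrightarrow> w \<in> nonunits L"
    then show thesis by (rule that)
  qed
  note subR = valuation_subalgebra[OF R(1)]
  have wR: "w \<in> R" using subalgebra_add[OF subR, of "w - 1" 1] w(1) nonunits_subset[of R] subalgebra_1[OF subR] by auto
  have "w \<in> L" if "valuation L" "P \<subseteq> L" for L
    using w(2)[of L] wR that nonunits_subset[of L] by (cases "L = R") auto
  then have "w \<in> P" by (rule cl)
  moreover have "w \<in> nonunits S" using w(2) S by blast
  ultimately have "w \<in> nonunits P" using S(2) by (auto simp: nonunits_iff)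
  then have "w \<in> nonunits R" using R(2) by (auto simp: dominates_def)
  then have "w - (w - 1) \<in> nonunits R" using w(1) point_ring_diff[OF valuation_point_ring[OF R(1)]] by blast
  then show False using one_not_nonunit[OF subR] by simp
qed

text \<open>At \<open>g + 1\<close> points that are not valuation rings, take elements that are regular on all branches
  without being in the local ring.  No combination of the corresponding adeles is a coboundary.\<close>

lemma finite_nonvaluation_points: "finite {P \<in> closed_points C. \<not> valuation P}"
proof (rule ccontr)
  assume "infinite {P \<in> closed_points C. \<not> valuation P}"
  then obtain S where S: "finite S" "card S = Suc g" "S \<subseteq> {P \<in> closed_points C. \<not> valuation P}"
    using infinite_arbitrarily_large by blast
  then obtain h where h: "bij_betw h {..g} S"
    using ex_bij_betw_nat_finite[of S] by (auto simp: lessThan_Suc_atMost atLeast0LessThan)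
  have "\<forall>P. \<exists>y. P \<in> S \<longrightarrow> y \<notin> P \<and> (\<forall>R. valuation R \<longrightarrow> P \<subseteq> R \<longrightarrow> y \<in> R)"
  proof
    fix P
    have "\<exists>y. y \<notin> P \<and> (\<forall>R. valuation R \<longrightarrow> P \<subseteq> R \<longrightarrow> y \<in> R)" if "P \<in> S"
      using nonvaluation_point[of P] S(3) that by blast
    then show "\<exists>y. P \<in> S \<longrightarrow> y \<notin> P \<and> (\<forall>R. valuation R \<longrightarrow> P \<subseteq> R \<longrightarrow> y \<in> R)" by blast
  qed
  then obtain y where y: "\<And>P. P \<in> S \<Longrightarrow> y P \<notin> P" "\<And>P R. P \<in> S \<Longrightarrow> valuation R \<Longrightarrow> P \<subseteq> R \<Longrightarrow> y P \<in> R"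
    by metis
  have hS: "h j \<in> S" if "j \<le> g" for j using h that by (auto simp: bij_betw_def)
  have hC: "h j \<in> closed_points C" if "j \<le> g" for j using hS[OF that] S(3) by blast
  obtain c where c: "\<exists>j\<le>g. c j \<noteq> 0" "(\<lambda>P. \<Sum>j\<le>g. emb (c j) * skyscraper (h j) (y (h j)) P) \<in> cob1 (\<lambda>P. P)"
    by (rule adeles_dependent_mod_coboundaries[of "\<lambda>j. skyscraper (h j) (y (h j))"]) (rule adeles1_skyscraper[OF hC])
  define a where "a P = (\<Sum>j\<le>g. emb (c j) * skyscraper (h j) (y (h j)) P)" for P
  have ah: "a (h j) = emb (c j) * y (h j)" if j: "j \<le> g" for j
  proof -
    have "skyscraper (h i) (y (h i)) (h j) = (if i = j then y (h j) else 0)" if "i \<le> g" for i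
      using h that j by (auto simp: skyscraper_def bij_betw_def dest: inj_onD)
    then have "a (h j) = (\<Sum>i\<le>g. emb (c i) * (if i = j then y (h j) else 0))" unfolding a_def by (intro sum.cong) auto
    also have "\<dots> = (\<Sum>i\<le>g. if i = j then emb (c i) * y (h j) else 0)" by (intro sum.cong) auto
    finally show ?thesis using j by simp
  qed
  have a0: "a P = 0" if "P \<notin> S" for P
    unfolding a_def using hS that by (intro sum.neutral) (auto simp: skyscraper_def)
  obtain x where x: "\<And>P. P \<in> closed_points C \<Longrightarrow> a P - x \<in> P" using c(2) unfolding cob1_def a_def by auto
  have xR: "x \<in> R" if R: "valuation R" for R
  proof -
    note Rsub = valuation_subalgebra[OF R]
    let ?P = "normalization_map C R"
    have "a ?P - x \<in> R" using x center[OF R] by blast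
    moreover have "a ?P \<in> R"
    proof (cases "?P \<in> S")
      case True
      then obtain j where j: "j \<le> g" "?P = h j" using h by (auto simp: bij_betw_def)
      show ?thesis unfolding j(2) ah[OF j(1)] using y(2)[of "h j" R] hS[OF j(1)] R center(3)[OF R] j(2)
        by (intro subalgebra_mult[OF Rsub] subalgebra_emb[OF Rsub]) auto
    qed (simp add: a0 subalgebra_0[OF Rsub])
    ultimately show ?thesis using subalgebra_diff[OF Rsub, of "a ?P"] by fastforce
  qed
  obtain j where j: "j \<le> g" "c j \<noteq> 0" using c(1) by blast
  note sub = point_ring_subalgebra[OF closed_point_ring[OF hC[OF j(1)]]]
  have "a (h j) - x \<in> h j" "x \<in> h j" using x[OF hC[OF j(1)]] branch_regular_constant(2)[OF xR hC[OF j(1)]] by auto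
  then have "emb (c j) * y (h j) \<in> h j" using subalgebra_add[OF sub, of "a (h j) - x" x] ah[OF j(1)] by simp
  then have "emb (inverse (c j)) * (emb (c j) * y (h j)) \<in> h j" using subalgebra_mult[OF sub subalgebra_emb[OF sub]] by blast
  moreover have "emb (inverse (c j)) * (emb (c j) * y (h j)) = y (h j)"
    using j(2) by (simp add: emb_inverse flip: mult.assoc)
  ultimately have "y (h j) \<in> h j" by metis
  then show False using y(1)[OF hS[OF j(1)]] by blast
qed

text \<open>Approximation at points of the curve, obtained from approximation along the branches by means
  of the conductor.\<close>

lemma point_approximation:
  assumes fin: "finite B" "B \<subseteq> closed_points C" and P: "P \<in> B" "c \<in> P"
    and z: "z \<noteq> 0" "\<And>Q. Q \<in> B \<Longrightarrow> z \<in> nonunits Q"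
  obtains a where "(a - c) / z \<in> P" "\<And>Q. Q \<in> B - {P} \<Longrightarrow> a / z \<in> Q"
proof (cases "c = 0")
  case True
  then show ?thesis using that[of 0] fin P zero_in_closed by auto
next
  case c0: False
  define \<L> where "\<L> = (\<Union>Q\<in>B. {R. valuation R \<and> Q \<subseteq> R})"
  define \<I> where "\<I> = {R. valuation R \<and> P \<subseteq> R}"
  have finL: "finite \<L>" unfolding \<L>_def using fin finite_valuations_over by blast
  have val: "valuation L" if "L \<in> \<L>" for L using that by (auto simp: \<L>_def)
  have IL: "\<I> \<subseteq> \<L>" using P(1) by (auto simp: \<I>_def \<L>_def)
  have finI: "finite \<I>" using IL finL finite_subset by blast
  define z' where "z' = z ^ Suc g / c"
  have "\<exists>e. (e - 1) / z' \<in> R \<and> (\<forall>L\<in>\<L> - {R}. e / z' \<in> L)" if R: "R \<in> \<I>" for R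
  proof -
    have "inj_on (\<lambda>L. L \<inter> UNIV) \<L>" "R \<in> \<L>" using R IL by auto
    then show ?thesis
      using valuation_approximation[OF subextension_UNIV finL val, of R z'] by metis
  qed
  then obtain e where e: "\<And>R. R \<in> \<I> \<Longrightarrow> (e R - 1) / z' \<in> R"
    "\<And>R L. R \<in> \<I> \<Longrightarrow> L \<in> \<L> - {R} \<Longrightarrow> e R / z' \<in> L" by metis
  define a where "a = c * sum e \<I>"
  have az: "a / z ^ Suc g = sum e \<I> / z'" "(a - c) / z ^ Suc g = (sum e \<I> - 1) / z'"
    using c0 by (simp_all add: a_def z'_def field_simps)
  have rest: "(\<Sum>L\<in>T. e L) / z' \<in> R" if "T \<subseteq> \<I>" "R \<in> \<L>" "R \<notin> T" for T R
  proof -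
    have "(\<Sum>L\<in>T. e L / z') \<in> R"
      using that e(2) by (intro subalgebra_sum[OF valuation_subalgebra[OF val]]) auto
    then show ?thesis by (simp add: sum_divide_distrib)
  qed
  have at_P: "(a - c) / z ^ Suc g \<in> R" if R: "valuation R" "P \<subseteq> R" for R
  proof -
    have RI: "R \<in> \<I>" using R by (simp add: \<I>_def)
    have "(sum e \<I> - 1) / z' = (e R - 1) / z' + (\<Sum>L\<in>\<I> - {R}. e L) / z'"
      using sum.remove[OF finI RI, of e] by (simp add: add_divide_distrib diff_divide_distrib)
    also have "\<dots> \<in> R"
      using e(1)[OF RI] rest[of "\<I> - {R}" R] RI IL by (intro subalgebra_add[OF valuation_subalgebra[OF R(1)]]) auto
    finally show ?thesis by (simp only: az(2))
  qed
  have at_Q: "a / z ^ Suc g \<in> R" if R: "valuation R" "Q \<subseteq> R" and Q: "Q \<in> B - {P}" for R Q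
  proof -
    have "R \<in> \<L>" using R Q by (auto simp: \<L>_def)
    moreover have "R \<notin> \<I>"
      using R Q P fin center_eq'[of R P] center_eq'[of R Q] by (auto simp: \<I>_def)
    ultimately show ?thesis unfolding az(1) by (intro rest) auto
  qed
  have zz: "z ^ g * (u / z ^ Suc g) = u / z" for u using z(1) by simp
  show ?thesis
  proof (rule that[of a])
    show "(a - c) / z \<in> P" using conductor[of P z "(a - c) / z ^ Suc g"] at_P fin P z(2) zz by auto
    fix Q assume Q: "Q \<in> B - {P}"
    then show "a / z \<in> Q" using conductor[of Q z "a / z ^ Suc g"] at_Q[OF _ _ Q] fin z(2)[of Q] zz by auto
  qed
qed

end

section \<open>Normalization\<close>

context complete_curve
begin

text \<open>If \<open>x\<close> is not integral over \<open>P\<close>, then \<open>x\<close> is not in \<open>P[1/x]\<close>, and some valuation ring contains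
  \<open>P[1/x]\<close> with \<open>1/x\<close> as a nonunit.\<close>

lemma integral_closure_valuations:
  assumes P: "P \<in> closed_points C"
  shows "integral_closure P = \<Inter>{R. valuation R \<and> P \<subseteq> R}"
proof (intro equalityI subsetI InterI)
  note sub = C_subalgebra[OF closed_point_in_C[OF P]]
  fix x R assume x: "x \<in> integral_closure P" and "R \<in> {R. valuation R \<and> P \<subseteq> R}"
  then have R: "valuation R" "P \<subseteq> R" by auto
  note subR = valuation_subalgebra[OF R(1)]
  show "x \<in> R"
  proof (rule ccontr)
    assume nx: "x \<notin> R"
    then have x0: "x \<noteq> 0" using subalgebra_0[OF subR] by auto
    have m: "inverse x \<in> nonunits R" using nx valuation_cases[OF R(1), of x] by (auto simp: nonunits_iff)
    obtain p where p: "lead_coeff p = 1" "\<forall>i. coeff p i \<in> P" "poly p x = 0"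
      using x unfolding integral_closure_def by blast
    define n where "n = degree p"
    have "0 = inverse x ^ n * poly p x" using p(3) by simp
    also have "\<dots> = (\<Sum>i\<le>n. coeff p i * inverse x ^ (n - i))"
      unfolding poly_altdef n_def sum_distrib_left
      using x0 by (intro sum.cong refl) (auto simp: power_diff power_inverse field_simps)
    also have "\<dots> = 1 + (\<Sum>i<n. coeff p i * inverse x ^ (n - i))"
      using p(1) by (simp add: n_def lessThan_Suc_atMost[symmetric])
    finally have "1 = - (\<Sum>i<n. coeff p i * inverse x ^ (n - i))"
      by (simp add: eq_neg_iff_add_eq_0)
    moreover have "(\<Sum>i<n. coeff p i * inverse x ^ (n - i)) \<in> nonunits R"
      using p(2) R(2)
      by (intro point_ring_sum[OF valuation_point_ring[OF R(1)]] nonunits_mult[OF subR] nonunits_power[OF subR m]) auto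
    ultimately show False
      using point_ring_uminus[OF valuation_point_ring[OF R(1)]] one_not_nonunit[OF subR] by metis
  qed
next
  note sub = C_subalgebra[OF closed_point_in_C[OF P]]
  note cl = subalgebra_closed[OF sub]
  fix x assume x: "x \<in> \<Inter>{R. valuation R \<and> P \<subseteq> R}"
  show "x \<in> integral_closure P"
  proof (rule ccontr)
    assume nx: "x \<notin> integral_closure P"
    have "0 \<in> integral_closure P" unfolding integral_closure_def
      using cl by (intro CollectI exI[of _ "[:0, 1:]"]) (auto simp: coeff_pCons split: nat.split)
    then have x0: "x \<noteq> 0" using nx by auto
    let ?A = "{poly p (inverse x) | p. \<forall>i. coeff p i \<in> P}"
    have "x \<notin> ?A"
    proof
      assume "x \<in> ?A"
      then obtain p where p: "x = poly p (inverse x)" "\<forall>i. coeff p i \<in> P" by blast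
      define n where "n = degree p"
      define s where "s = (\<Sum>i\<le>n. monom (coeff p i) (n - i))"
      define q where "q = monom 1 (Suc n) - s"
      have ds: "degree s < Suc n" unfolding s_def less_Suc_eq_le
        by (intro degree_sum_le) (auto intro: order_trans[OF degree_monom_le])
      have "lead_coeff q = 1"
      proof -
        have "degree (monom 1 (Suc n) + (- s)) = Suc n"
          using ds by (subst degree_add_eq_left) (auto simp: degree_monom_eq)
        then have "degree q = Suc n" by (simp add: q_def)
        then show ?thesis using ds by (simp add: q_def coeff_eq_0)
      qed
      moreover have "\<forall>i. coeff q i \<in> P" unfolding q_def s_def
        using p(2) cl by (auto simp: coeff_sum intro!: cl(4) cl(5) subalgebra_sum[OF sub])
      moreover have "poly q x = 0"
      proof -
        have "x ^ Suc n = x ^ n * poly p (inverse x)" using p(1) by simp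
        also have "\<dots> = (\<Sum>i\<le>n. coeff p i * x ^ (n - i))"
          unfolding poly_altdef n_def sum_distrib_left
          using x0 by (intro sum.cong refl) (auto simp: power_diff power_inverse field_simps)
        finally show ?thesis by (simp add: q_def s_def poly_sum poly_monom)
      qed
      ultimately show False using nx unfolding integral_closure_def by blast
    qed
    then have "inverse (inverse x) \<notin> ?A" "inverse x \<noteq> 0" using x0 by auto
    with valuation_extension[OF subalgebra_adjoin[OF sub] adjoin_contains(2)[OF sub], of "inverse x"]
    obtain R where "valuation R" "?A \<subseteq> R" "inverse x \<in> nonunits R" by blast
    then show False using x adjoin_contains(1)[OF sub, of "inverse x"] x0 by (auto simp: nonunits_iff)
  qed
qed

lemma integral_closure_UNIV: "integral_closure UNIV = UNIV"
proof -
  have "x \<in> integral_closure UNIV" for x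
    unfolding integral_closure_def by (intro CollectI exI[of _ "[:- x, 1:]"]) auto
  then show ?thesis by blast
qed

text \<open>The integral closure of \<open>P\<close> is the intersection of finitely many valuation rings.  Every \<open>y\<close> is
  a quotient of two of its elements \<open>y w\<close> and \<open>w\<close> that generate the unit ideal.\<close>

lemma local_ring_of_integral_closure:
  assumes P: "P \<in> C" and Q: "Q \<in> local_rings (integral_closure P)"
  shows "Q = UNIV \<or> valuation Q"
proof (cases "P = UNIV")
  case True
  obtain q where q: "prime_ideal_of UNIV q" "Q = localization UNIV q"
    using Q unfolding True integral_closure_UNIV local_rings_def by blast
  then have "Q = UNIV" using subset_localization[OF subalgebra_UNIV q(1)] by auto
  then show ?thesis ..
next
  case False
  then have Pc: "P \<in> closed_points C" using P by (simp add: closed_points_def)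
  let ?\<L> = "{R. valuation R \<and> P \<subseteq> R}"
  let ?O = "\<Inter>?\<L>"
  obtain q where q: "prime_ideal_of ?O q" "Q = localization ?O q"
    using Q unfolding integral_closure_valuations[OF Pc] local_rings_def by blast
  have sub: "subalgebra scale ?O" by (intro subalgebra_Inter) (auto intro: valuation_subalgebra)
  have "y \<in> Q \<or> inverse y \<in> Q" for y
  proof -
    obtain c where c: "c \<noteq> 0" "\<And>L. L \<in> ?\<L> \<Longrightarrow> 1 + emb c * y \<noteq> 0 \<and> inverse (1 + emb c * y) \<in> L"
    proof (rule pole_free_inverse[of ?\<L> y])
      show "finite ?\<L>" by (rule finite_valuations_over[OF Pc])
      fix c assume "c \<noteq> 0" "\<And>L. L \<in> ?\<L> \<Longrightarrow> 1 + emb c * y \<noteq> 0 \<and> inverse (1 + emb c * y) \<in> L"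
      then show thesis by (rule that)
    qed auto
    define w where "w = inverse (1 + emb c * y)"
    obtain R where "valuation R" "dominates R P" using dominating_valuation_exists[OF closed_point_ring[OF Pc]] .
    then have "R \<in> ?\<L>" by (simp add: dominates_def)
    then have ne: "1 + emb c * y \<noteq> 0" using c(2) by blast
    have wO: "w \<in> ?O" using c(2) by (auto simp: w_def)
    have "emb (inverse c) * (1 - w) \<in> ?O"
      by (intro subalgebra_mult[OF sub] subalgebra_diff[OF sub] subalgebra_emb[OF sub] subalgebra_1[OF sub] wO)
    moreover have "emb (inverse c) * (1 - w) = y * w"
    proof -
      have "1 - w = emb c * (y * w)" using ne by (simp add: w_def field_simps)
      then show ?thesis using c(1) by (simp add: emb_inverse)
    qed
    ultimately have ywO: "y * w \<in> ?O" by metis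
    have one: "w + emb c * (y * w) = 1" using ne by (simp add: w_def field_simps)
    show ?thesis
    proof (cases "w \<in> q")
      case False
      then have "(y * w) / w \<in> Q" using localizationI[OF sub q(1) ywO wO] q(2) by blast
      then show ?thesis using False prime_ideal_ofD(2)[OF q(1)] by (cases "w = 0") auto
    next
      case True
      have "y * w \<notin> q"
      proof
        assume "y * w \<in> q"
        then have "w + emb c * (y * w) \<in> q"
          using True prime_ideal_ofD(3,4)[OF q(1)] subalgebra_emb[OF sub] by blast
        then show False using one prime_ideal_ofD(5)[OF q(1)] by simp
      qed
      then have "w / (y * w) \<in> Q" "w \<noteq> 0" using localizationI[OF sub q(1) wO ywO] q(2) prime_ideal_ofD(2)[OF q(1)] by auto
      then show ?thesis by (simp add: field_simps)
    qed
  qed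
  moreover have "subalgebra scale Q" unfolding q(2) by (rule subalgebra_localization[OF sub q(1)])
  ultimately show ?thesis by (auto simp: valuation_def valuation_ring_def)
qed

lemma normalization_cases: "Q \<in> normalization C \<Longrightarrow> Q = UNIV \<or> valuation Q"
  unfolding normalization_def using local_ring_of_integral_closure by blast

lemma UNIV_in_normalization: "UNIV \<in> normalization C"
proof -
  have "localization UNIV {0} = (UNIV :: 'a set)"
    using subset_localization[OF subalgebra_UNIV prime_ideal_zero[OF subalgebra_UNIV]]
    by (metis subset_UNIV subset_antisym)
  then have "(UNIV :: 'a set) \<in> local_rings (integral_closure UNIV)"
    unfolding integral_closure_UNIV local_rings_def using prime_ideal_zero[OF subalgebra_UNIV] by blast
  then show ?thesis unfolding normalization_def using UNIV_in_C by blast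
qed

end

section \<open>Duality\<close>

locale dualized_curve = curve_with_genus scale C g
  for scale :: "'k::alg_closed_field \<Rightarrow> 'a::field \<Rightarrow> 'a" and C g +
  fixes \<omega> :: "'a set \<Rightarrow> 'a set"
    and t :: "('a set \<Rightarrow> nat \<Rightarrow> 'a) \<Rightarrow> 'k"
    and s :: "nat \<Rightarrow> 'a"
  assumes genus_ge_2: "g \<ge> 2"
    and dualizing: "dualizing_sheaf scale C \<omega> t"
    and basis: "basis_of scale (global_sections C \<omega>) g s"
begin

lemma coherent_omega: "coherent1 \<omega>"
  using dualizing coherent1_iff unfolding dualizing_sheaf_def by blast

lemma omega_submodule: "P \<in> C \<Longrightarrow> is_submodule P (\<omega> P)"
  by (rule coherent1_submodule[OF coherent_omega])

lemma omega_submodule': "P \<in> closed_points C \<Longrightarrow> is_submodule P (\<omega> P)"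
  by (rule omega_submodule[OF closed_point_in_C])

definition trace :: "('a set \<Rightarrow> 'a) \<Rightarrow> 'k" where "trace a = t (lift1 a)"

lemma lift1_operations:
  "lift1 (\<lambda>P. a P + b P) = (\<lambda>P i. lift1 a P i + lift1 b P i)"
  "lift1 (\<lambda>P. emb c * a P) = (\<lambda>P i. scale c (lift1 a P i))"
  by (auto simp: lift1_def vec1_def scale_eq fun_eq_iff)

lemma trace_add: "a \<in> adeles1 \<Longrightarrow> b \<in> adeles1 \<Longrightarrow> trace (\<lambda>P. a P + b P) = trace a + trace b"
  and trace_emb: "a \<in> adeles1 \<Longrightarrow> trace (\<lambda>P. emb c * a P) = c * trace a"
  and trace_coboundary: "a \<in> cob1 \<omega> \<Longrightarrow> trace a = 0"
  using dualizing
  unfolding dualizing_sheaf_def h1_functional_def lift1_adeles[symmetric] lift1_coboundaries[symmetric]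
  by (auto simp: trace_def lift1_operations)


lemma trace_diff: "a \<in> adeles1 \<Longrightarrow> b \<in> adeles1 \<Longrightarrow> trace (\<lambda>P. a P - b P) = trace a - trace b"
  using trace_add[OF _ adeles1_uminus, of a b] trace_emb[of b "-1"] by (simp add: emb_minus)

text \<open>The universal property of \<open>\<omega>\<close> for sheaves of rank one.\<close>

lemma duality:
  fixes \<phi> :: "('a set \<Rightarrow> 'a) \<Rightarrow> 'k"
  assumes L: "coherent1 L"
    and add: "\<And>a b. a \<in> adeles1 \<Longrightarrow> b \<in> adeles1 \<Longrightarrow> \<phi> (\<lambda>P. a P + b P) = \<phi> a + \<phi> b"
    and mult: "\<And>c a. a \<in> adeles1 \<Longrightarrow> \<phi> (\<lambda>P. emb c * a P) = c * \<phi> a"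
    and cob: "\<And>a. a \<in> cob1 L \<Longrightarrow> \<phi> a = 0"
  shows "\<exists>!h. (\<forall>P\<in>C. \<forall>v\<in>L P. h * v \<in> \<omega> P) \<and> (\<forall>a\<in>adeles1. \<phi> a = trace (\<lambda>P. h * a P))"
proof -
  define \<Phi> where "\<Phi> A = \<phi> (\<lambda>P. A P 0)" for A :: "'a set \<Rightarrow> nat \<Rightarrow> 'a"
  have un: "A \<in> adeles C 1 \<Longrightarrow> (\<lambda>P. A P 0) \<in> adeles1" for A
    using adeles_lift1[of A] lift1_adeles[of "\<lambda>P. A P 0"] by metis
  have unc: "A \<in> coboundaries C 1 (line_sheaf L) \<Longrightarrow> (\<lambda>P. A P 0) \<in> cob1 L" for A
  proof -
    assume A: "A \<in> coboundaries C 1 (line_sheaf L)"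
    then have "A = lift1 (\<lambda>P. A P 0)" by (intro adeles_lift1) (simp add: coboundaries_def)
    then show ?thesis using A lift1_coboundaries[of "\<lambda>P. A P 0" L] by metis
  qed
  have "h1_functional scale C 1 (line_sheaf L) \<Phi>"
    unfolding h1_functional_def \<Phi>_def using add mult cob un unc by (simp add: scale_eq)
  then have "\<exists>!h. h \<in> vectors 1 \<and> (\<forall>P\<in>C. \<forall>v\<in>line_sheaf L P. (\<Sum>j<1. h j * v j) \<in> \<omega> P) \<and>
           (\<forall>a\<in>adeles C 1. \<Phi> a = t (\<lambda>P i. if i = 0 then \<Sum>j<1. h j * a P j else 0))"
    using dualizing L unfolding dualizing_sheaf_def coherent1_iff[symmetric] by blast
  moreover define D where "D h \<longleftrightarrow> (\<forall>P\<in>C. \<forall>v\<in>line_sheaf L P. (\<Sum>j<1. h j * v j) \<in> \<omega> P) \<and>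
           (\<forall>a\<in>adeles C 1. \<Phi> a = t (\<lambda>P i. if i = 0 then \<Sum>j<1. h j * a P j else 0))" for h
  ultimately have ex1: "\<exists>!h. h \<in> vectors 1 \<and> D h" by (simp only:)
  have eq: "D (vec1 h) \<longleftrightarrow>
      (\<forall>P\<in>C. \<forall>v\<in>L P. h * v \<in> \<omega> P) \<and> (\<forall>a\<in>adeles1. \<phi> a = trace (\<lambda>P. h * a P))" for h
  proof -
    have l: "\<Phi> (lift1 a) = \<phi> a" for a by (simp add: \<Phi>_def lift1_def)
    have r: "t (\<lambda>P i. if i = 0 then \<Sum>j<1. vec1 h j * lift1 a P j else 0) = trace (\<lambda>P. h * a P)" for a
    proof -
      have "(\<Sum>j<1. vec1 h j * lift1 a P j) = h * a P" for P by (simp add: lift1_def)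
      then show ?thesis by (simp only: trace_def lift1_def vec1_def)
    qed
    have "(\<forall>a\<in>adeles C 1. Q a) \<longleftrightarrow> (\<forall>a\<in>adeles1. Q (lift1 a))" for Q
      using adeles_lift1 lift1_adeles un by metis
    then have "(\<forall>a\<in>adeles C 1. \<Phi> a = t (\<lambda>P i. if i = 0 then \<Sum>j<1. vec1 h j * a P j else 0))
        \<longleftrightarrow> (\<forall>a\<in>adeles1. \<phi> a = trace (\<lambda>P. h * a P))"
      by (simp only: l r)
    then show ?thesis unfolding D_def by (simp add: line_sheaf_vec1)
  qed
  obtain h where h: "D (vec1 h)" using ex1 unfolding vectors_one_range by blast
  show ?thesis unfolding eq[symmetric]
  proof (rule ex1I[of _ h])
    fix h' assume "D (vec1 h')"
    then have "vec1 h' = vec1 h" using h ex1 unfolding vectors_one_range by blast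
    then show "h' = h" using vec1_inj by (simp add: inj_eq)
  qed (rule h)
qed

definition residue :: "'a set \<Rightarrow> 'a \<Rightarrow> 'k" where "residue P y = trace (skyscraper P y)"

context
  fixes P assumes P: "P \<in> closed_points C"
begin

lemma residue_add: "residue P (x + y) = residue P x + residue P y"
proof -
  have "skyscraper P (x + y) = (\<lambda>Q. skyscraper P x Q + skyscraper P y Q)" by (auto simp: skyscraper_def)
  then show ?thesis unfolding residue_def using trace_add[OF adeles1_skyscraper[OF P] adeles1_skyscraper[OF P]] by simp
qed

lemma residue_emb: "residue P (emb c * x) = c * residue P x"
proof -
  have "skyscraper P (emb c * x) = (\<lambda>Q. emb c * skyscraper P x Q)" by (auto simp: skyscraper_def)
  then show ?thesis unfolding residue_def using trace_emb[OF adeles1_skyscraper[OF P]] by simp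
qed

lemma residue_diff: "residue P (x - y) = residue P x - residue P y"
  using residue_add[of "x - y" y] by simp

lemma residue_regular: "y \<in> \<omega> P \<Longrightarrow> residue P y = 0"
  unfolding residue_def
proof (rule trace_coboundary)
  assume "y \<in> \<omega> P"
  then show "skyscraper P y \<in> cob1 \<omega>"
    unfolding cob1_def using adeles1_skyscraper[OF P] submodule_0[OF omega_submodule']
    by (auto simp: skyscraper_def intro!: exI[of _ 0])
qed

text \<open>Enlarge the stalk of \<open>\<omega>\<close> at \<open>P\<close> by \<open>y\<close>.  By the hypothesis the trace vanishes on the
  coboundaries of the larger sheaf, hence it is given by a map from that sheaf to \<open>\<omega>\<close>; by uniqueness
  for \<open>\<omega>\<close> itself this map is the identity.\<close>

lemma local_duality:
  assumes res: "\<And>c. c \<in> P \<Longrightarrow> residue P (c * y) = 0"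
  shows "y \<in> \<omega> P"
proof -
  note sub = C_subalgebra[OF closed_point_in_C[OF P]]
  obtain \<A> where A: "affine_cover scale C \<A>"
    "\<And>A. A \<in> \<A> \<Longrightarrow> \<exists>G. finite G \<and> (\<forall>P\<in>local_rings A. \<omega> P = generated_module P G)"
    using coherent1_charts[OF coherent_omega] by blast
  obtain A where "A \<in> \<A>" "P \<in> local_rings A"
    using affine_coverD(4)[OF A(1) closed_point_in_C[OF P]] by blast
  then obtain G where G: "finite G" "\<omega> P = generated_module P G" using A(2)[of A] by blast
  define H where "H = insert y G"
  define M where "M = generated_module P H"
  have H: "finite H" using G by (simp add: H_def)
  note Mmod = generated_module_submodule[OF sub, of H, folded M_def]
  note HM = generated_module_contains[OF sub, of H, folded M_def]
  have GM: "\<omega> P \<subseteq> M"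
    using HM G(2) generated_module_least[OF Mmod, of G] by (auto simp: H_def)
  have decomp: "\<exists>c\<in>P. \<exists>w\<in>\<omega> P. m = c * y + w" if "m \<in> M" for m
  proof -
    let ?N = "{c * y + w | c w. c \<in> P \<and> w \<in> \<omega> P}"
    have "is_submodule P ?N" unfolding is_submodule_def
    proof (intro conjI ballI)
      show "0 \<in> ?N" using subalgebra_0[OF sub] submodule_0[OF omega_submodule'[OF P]]
        by (intro CollectI exI[of _ 0]) auto
      fix u assume "u \<in> ?N"
      then obtain c w where u: "u = c * y + w" "c \<in> P" "w \<in> \<omega> P" by blast
      show "a * u \<in> ?N" if "a \<in> P" for a
        using u that subalgebra_mult[OF sub that u(2)] submodule_mult[OF omega_submodule'[OF P] that u(3)]
        by (intro CollectI exI[of _ "a * c"] exI[of _ "a * w"]) (auto simp: algebra_simps)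
      fix v assume "v \<in> ?N"
      then obtain c' w' where v: "v = c' * y + w'" "c' \<in> P" "w' \<in> \<omega> P" by blast
      show "u + v \<in> ?N"
        using u v subalgebra_add[OF sub u(2) v(2)] submodule_add[OF omega_submodule'[OF P] u(3) v(3)]
        by (intro CollectI exI[of _ "c + c'"] exI[of _ "w + w'"]) (auto simp: algebra_simps)
    qed
    moreover have "H \<subseteq> ?N"
    proof
      fix h assume "h \<in> H"
      then consider "h = y" | "h \<in> \<omega> P" using generated_module_contains[OF sub, of G] G(2) by (auto simp: H_def)
      then show "h \<in> ?N"
      proof cases
        case 1 then show ?thesis using subalgebra_1[OF sub] submodule_0[OF omega_submodule'[OF P]]
            by (intro CollectI exI[of _ 1] exI[of _ 0]) auto
      next
        case 2 then show ?thesis using subalgebra_0[OF sub]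
            by (intro CollectI exI[of _ 0] exI[of _ h]) auto
      qed
    qed
    ultimately show ?thesis using generated_module_least[of P ?N H] that unfolding M_def by blast
  qed
  have yM: "y \<in> M" using HM by (auto simp: H_def)
  show ?thesis
  proof (cases "y = 0")
    case True then show ?thesis using submodule_0[OF omega_submodule'[OF P]] by simp
  next
    case False
    let ?L = "\<omega>(P := M)"
    have coh: "coherent1 ?L" using coherent1_modify[OF coherent_omega P H] yM False unfolding M_def by blast
    have "trace a = 0" if a: "a \<in> cob1 ?L" for a
    proof -
      obtain x where x: "\<And>Q. Q \<in> closed_points C \<Longrightarrow> a Q - x \<in> ?L Q" and aa: "a \<in> adeles1"
        using a unfolding cob1_def by blast
      have "a P - x \<in> M" using x[OF P] by simp
      then obtain c w where cw: "c \<in> P" "w \<in> \<omega> P" "a P - x = c * y + w" using decomp by blast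
      define b where "b = (\<lambda>Q. a Q - skyscraper P (c * y) Q)"
      have ba: "b \<in> adeles1" unfolding b_def using adeles1_diff[OF aa adeles1_skyscraper[OF P]] .
      have "b Q - x \<in> \<omega> Q" if Q: "Q \<in> closed_points C" for Q
      proof (cases "Q = P")
        case True
        then have "b Q - x = w" using cw(3) by (simp add: b_def skyscraper_def algebra_simps)
        then show ?thesis using cw True by simp
      next
        case False
        then show ?thesis using x[OF Q] by (simp add: b_def skyscraper_def)
      qed
      then have "b \<in> cob1 \<omega>" using ba unfolding cob1_def by blast
      then have "trace b = 0" by (rule trace_coboundary)
      then show ?thesis
        using trace_diff[OF aa adeles1_skyscraper[OF P], of "c * y"] res[OF cw(1)]
        by (simp add: b_def residue_def)
    qed
    then obtain h where h: "\<forall>Q\<in>C. \<forall>v\<in>?L Q. h * v \<in> \<omega> Q" "\<forall>a\<in>adeles1. trace a = trace (\<lambda>P. h * a P)"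
      using duality[OF coh, of trace] trace_add trace_emb by blast
    have "\<exists>!h. (\<forall>Q\<in>C. \<forall>v\<in>\<omega> Q. h * v \<in> \<omega> Q) \<and> (\<forall>a\<in>adeles1. trace a = trace (\<lambda>P. h * a P))"
      using duality[OF coherent_omega, of trace] trace_add trace_emb trace_coboundary by blast
    moreover have "\<forall>Q\<in>C. \<forall>v\<in>\<omega> Q. h * v \<in> \<omega> Q"
    proof (intro ballI)
      fix Q v assume "Q \<in> C" "v \<in> \<omega> Q"
      moreover then have "v \<in> ?L Q" using GM by auto
      ultimately show "h * v \<in> \<omega> Q" using h(1) by blast
    qed
    moreover have "\<forall>Q\<in>C. \<forall>v\<in>\<omega> Q. 1 * v \<in> \<omega> Q" "\<forall>a\<in>adeles1. trace a = trace (\<lambda>P. 1 * a P)" by auto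
    ultimately have "h = 1" using h(2) by blast
    then show ?thesis using h(1) yM closed_point_in_C[OF P] by fastforce
  qed
qed

end

text \<open>The residue theorem: the adele differs from the constant adele \<open>y\<close> by sections of \<open>\<omega>\<close>.\<close>

lemma trace_restriction:
  assumes S: "S \<subseteq> closed_points C" and y: "\<And>P. P \<in> closed_points C - S \<Longrightarrow> y \<in> \<omega> P"
  shows "trace (\<lambda>P. if P \<in> S then y else 0) = 0"
proof (rule trace_coboundary)
  have "(if P \<in> S then y else 0) - y \<in> \<omega> P" if P: "P \<in> closed_points C" for P
    using y[of P] P submodule_0[OF omega_submodule'[OF P]]
      submodule_uminus[OF C_subalgebra[OF closed_point_in_C[OF P]] omega_submodule'[OF P], of y] by auto
  then show "(\<lambda>P. if P \<in> S then y else 0) \<in> cob1 \<omega>"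
    unfolding cob1_def using adeles1_restrict[OF S] by blast
qed

subsection \<open>Global sections\<close>

abbreviation V :: "'a set" where "V \<equiv> global_sections C \<omega>"

lemma section_iff: "h \<in> V \<longleftrightarrow> (\<forall>P\<in>C. h \<in> \<omega> P)"
  by (simp add: global_sections_def)

lemma sectionI: "(\<And>P. P \<in> closed_points C \<Longrightarrow> h \<in> \<omega> P) \<Longrightarrow> h \<in> V"
  using in_C_cases coherent_omega unfolding section_iff coherent1_def by blast

lemma V_span: "V = span (s ` {..<g})"
  and s_inj: "inj_on s {..<g}"
  and s_independent: "independent (s ` {..<g})"
  using basis by (auto simp: basis_of_def)

lemma s_nonzero: "i < g \<Longrightarrow> s i \<noteq> 0"
  using s_independent dependent_zero[of "s ` {..<g}"] by (metis imageI lessThan_iff)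

lemma s_in_V: "i < g \<Longrightarrow> s i \<in> V"
  unfolding V_span by (auto intro: span_base)

lemma V_subspace: "subspace V"
  unfolding V_span by (rule subspace_span)

lemma V_coordinates:
  assumes "h \<in> V"
  obtains a where "h = (\<Sum>l<g. emb (a l) * s l)"
proof -
  have "span (s ` {..<g}) = range (\<lambda>u. \<Sum>v\<in>s ` {..<g}. scale (u v) v)" by (rule span_finite) simp
  then obtain u where "h = (\<Sum>v\<in>s ` {..<g}. scale (u v) v)" using assms unfolding V_span by auto
  then have "h = (\<Sum>l<g. emb (u (s l)) * s l)" using s_inj by (simp add: sum.reindex scale_eq)
  then show ?thesis by (rule that)
qed

lemma V_combination: "(\<Sum>l<g. emb (a l) * s l) \<in> V"
  using s_in_V by (intro subspace_sum[OF V_subspace]) (auto simp: scale_eq[symmetric] intro: subspace_scale[OF V_subspace])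

lemma V_combination_nonzero:
  assumes "j < g" "a j \<noteq> 0"
  shows "(\<Sum>l<g. emb (a l) * s l) \<noteq> 0"
proof
  assume z: "(\<Sum>l<g. emb (a l) * s l) = 0"
  define u where "u v = a (the_inv_into {..<g} s v)" for v
  have us: "u (s l) = a l" if "l < g" for l using s_inj that by (simp add: u_def the_inv_into_f_f)
  have "(\<Sum>v\<in>s ` {..<g}. scale (u v) v) = (\<Sum>l<g. scale (u (s l)) (s l))" using s_inj by (simp add: sum.reindex)
  also have "\<dots> = 0" using z us by (simp add: scale_eq)
  finally have "u (s j) = 0" using s_independent independentD[of "s ` {..<g}" "s ` {..<g}" u "s j"] assms by auto
  then show False using us assms by simp
qed

lemma V_dependent:
  assumes w: "\<And>i. i \<le> g \<Longrightarrow> w i \<in> V"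
  obtains c where "\<exists>i\<le>g. c i \<noteq> 0" "(\<Sum>i\<le>g. emb (c i) * w i) = 0"
proof -
  have "\<exists>a. i \<le> g \<longrightarrow> w i = (\<Sum>l<g. emb (a l) * s l)" for i using V_coordinates[OF w] by metis
  then obtain a where a: "\<And>i. i \<le> g \<Longrightarrow> w i = (\<Sum>l<g. emb (a i l) * s l)" by metis
  obtain c where c: "\<forall>i\<in>{..g}. c i \<in> constants" "\<exists>i\<in>{..g}. c i \<noteq> 0" "(\<Sum>i\<le>g. c i * w i) = 0"
    using dependent_if_spanned[OF constants_subextension, of "{..<g}" "{..g}" "\<lambda>l i. emb (a i l)" w s] a by auto
  then obtain d where d: "\<And>i. i \<le> g \<Longrightarrow> c i = emb (d i)" unfolding Ball_def constants_iff by (metis atMost_iff)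
  show ?thesis using that[of d] c(2,3) d by (metis (no_types, lifting) atMost_iff emb_0 sum.cong)
qed

text \<open>Powers of an element that maps the finite-dimensional space \<open>V\<close> into itself are dependent.\<close>

lemma V_not_stable:
  assumes "y \<notin> constants" "\<And>v. v \<in> V \<Longrightarrow> y * v \<in> V"
  shows False
proof -
  have "y ^ i * s 0 \<in> V" for i
    using s_in_V[of 0] genus_ge_2 assms(2) by (induction i) (auto simp: mult.assoc)
  then obtain c where c: "\<exists>i\<le>g. c i \<noteq> 0" "(\<Sum>i\<le>g. emb (c i) * (y ^ i * s 0)) = 0"
    using V_dependent[of "\<lambda>i. y ^ i * s 0"] by blast
  define q where "q = (\<Sum>i\<le>g. monom (c i) i)"
  have "coeff q i = c i" if "i \<le> g" for i using that by (simp add: q_def coeff_sum)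
  then have "q \<noteq> 0" using c(1) by auto
  moreover have "peval q y * s 0 = (\<Sum>i\<le>g. emb (c i) * (y ^ i * s 0))"
    by (simp add: q_def peval_sum peval_monom sum_distrib_right mult.assoc)
  then have "peval q y * s 0 = 0" using c(2) by simp
  ultimately show False using peval_nonconstant[OF assms(1)] s_nonzero[of 0] genus_ge_2 by auto
qed

text \<open>The dualizing sheaf is generated by its global sections.  Otherwise replace its stalk at \<open>P\<close> by
  the submodule that the sections generate.  The smaller sheaf has a linear form on its first
  cohomology that does not come from the trace; it is given by a nonconstant \<open>y\<close> that maps the
  smaller sheaf into \<open>\<omega>\<close>, and so maps \<open>V\<close> into \<open>V\<close>.\<close>

lemma globally_generated:
  assumes P: "P \<in> closed_points C"
  shows "\<omega> P = generated_module P (s ` {..<g})"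
proof (rule ccontr)
  note PC = closed_point_in_C[OF P]
  note sub = C_subalgebra[OF PC]
  define M where "M = generated_module P (s ` {..<g})"
  assume "\<omega> P \<noteq> generated_module P (s ` {..<g})"
  moreover have Mw: "M \<subseteq> \<omega> P" unfolding M_def
    using s_in_V section_iff PC by (intro generated_module_least[OF omega_submodule[OF PC]]) auto
  ultimately obtain \<eta> where eta: "\<eta> \<in> \<omega> P" "\<eta> \<notin> M" by (auto simp: M_def)
  let ?L = "\<omega>(P := M)"
  have s0: "s 0 \<in> M" unfolding M_def using generated_module_contains[OF sub, of "s ` {..<g}"] genus_ge_2 by auto
  have coh: "coherent1 ?L" using coherent1_modify[OF coherent_omega P] s0 s_nonzero[of 0] genus_ge_2 unfolding M_def by auto
  have VM: "V \<subseteq> M"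
  proof
    fix v assume "v \<in> V"
    then obtain a where "v = (\<Sum>l<g. emb (a l) * s l)" by (rule V_coordinates)
    moreover have "(\<Sum>l<g. emb (a l) * s l) \<in> M"
      unfolding M_def using generated_module_contains[OF sub, of "s ` {..<g}"]
      by (intro submodule_sum[OF generated_module_submodule[OF sub]] submodule_mult[OF generated_module_submodule[OF sub]] subalgebra_emb[OF sub]) auto
    ultimately show "v \<in> M" by simp
  qed
  have "skyscraper P \<eta> \<notin> cob1 ?L"
  proof
    assume "skyscraper P \<eta> \<in> cob1 ?L"
    then obtain x where x: "\<And>Q. Q \<in> closed_points C \<Longrightarrow> skyscraper P \<eta> Q - x \<in> ?L Q" unfolding cob1_def by blast
    have e: "\<eta> - x \<in> M" using x[OF P] by (simp add: skyscraper_def)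
    have "x \<in> \<omega> Q" if Q: "Q \<in> closed_points C" for Q
    proof (cases "Q = P")
      case True
      then show ?thesis using submodule_diff[OF sub omega_submodule[OF PC], of \<eta> "\<eta> - x"] e Mw eta by auto
    next
      case False
      then have "- x \<in> \<omega> Q" using x[OF Q] by (simp add: skyscraper_def)
      then show ?thesis
        using submodule_uminus[OF C_subalgebra[OF closed_point_in_C[OF Q]] omega_submodule'[OF Q], of "- x"] by simp
    qed
    then have "x \<in> M" using VM sectionI by blast
    then have "\<eta> - x + x \<in> M" using e submodule_add[OF generated_module_submodule[OF sub]] unfolding M_def by blast
    then show False using eta by simp
  qed
  then obtain \<phi> where phi: "\<And>a b. \<phi> (\<lambda>P. a P + b P) = \<phi> a + \<phi> b"
    "\<And>c a. \<phi> (\<lambda>P. emb c * a P) = c * \<phi> a" "\<And>a. a \<in> cob1 ?L \<Longrightarrow> \<phi> a = 0" "\<phi> (skyscraper P \<eta>) = 1"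
    using functional_exists[of ?L "skyscraper P \<eta>"] coherent1_submodule[OF coh] closed_point_in_C by blast
  obtain y where y: "\<forall>Q\<in>C. \<forall>v\<in>?L Q. y * v \<in> \<omega> Q" "\<forall>a\<in>adeles1. \<phi> a = trace (\<lambda>P. y * a P)"
    using duality[OF coh, of \<phi>] phi by blast
  have "y \<notin> constants"
  proof
    assume "y \<in> constants"
    then obtain c where "y = emb c" by (auto simp: constants_iff)
    then have "\<phi> (skyscraper P \<eta>) = c * residue P \<eta>"
      using y(2) adeles1_skyscraper[OF P] trace_emb by (simp add: residue_def)
    then show False using residue_regular[OF P eta(1)] phi(4) by simp
  qed
  moreover have "y * v \<in> V" if v: "v \<in> V" for v
  proof -
    have "v \<in> ?L Q" if "Q \<in> C" for Q using v VM section_iff that by auto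
    then show ?thesis using y(1) section_iff by blast
  qed
  ultimately show False by (rule V_not_stable)
qed

subsection \<open>The canonical model\<close>

lemma dominant_section:
  assumes R: "valuation R"
  obtains j where "j < g" "\<And>i. i < g \<Longrightarrow> s i / s j \<in> R"
proof -
  note sub = valuation_subalgebra[OF R]
  have "\<exists>j\<in>I. \<forall>i\<in>I. s i / s j \<in> R" if "finite I" "I \<noteq> {}" "I \<subseteq> {..<g}" for I
    using that
  proof (induction I rule: finite_ne_induct)
    case (singleton i)
    then show ?case using subalgebra_1[OF sub] s_nonzero[of i] by auto
  next
    case (insert k I)
    then obtain j where j: "j \<in> I" "\<And>i. i \<in> I \<Longrightarrow> s i / s j \<in> R" by auto
    have nz: "s j \<noteq> 0" "s k \<noteq> 0" using insert j s_nonzero by auto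

    show ?case
    proof (cases "s k / s j \<in> R")
      case True then show ?thesis using j by auto
    next
      case False
      then have jk: "s j / s k \<in> R" using valuation_cases[OF R, of "s k / s j"] by simp
      have "s i / s k \<in> R" if "i \<in> I" for i
        using subalgebra_mult[OF sub j(2)[OF that] jk] nz by simp
      then show ?thesis using nz subalgebra_1[OF sub] by auto
    qed
  qed
  from this[of "{..<g}"] genus_ge_2 show ?thesis using that by (auto simp: lessThan_empty_iff)
qed

text \<open>By global generation, a section with minimal valuation at \<open>Q\<close> generates the stalk there.  So the
  chart chosen in the definition of the canonical map exists.\<close>

lemma pullback_generator:
  assumes Q: "Q \<in> normalization C"
  shows "\<exists>j<g. pullback_mod_torsion C \<omega> Q = generated_module Q {s j}"
proof (cases "Q = UNIV")
  case True
  have "dominates UNIV (UNIV :: 'a set)" by (simp add: dominates_def)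
  then have "normalization_map C UNIV = UNIV"
    by (intro center_eq) (auto simp: valuation_ring_def subalgebra_UNIV UNIV_in_C)
  then have "pullback_mod_torsion C \<omega> Q = generated_module UNIV UNIV"
    using coherent_omega True by (simp add: pullback_mod_torsion_def coherent1_def)
  also have "\<dots> = UNIV" using generated_module_contains[OF subalgebra_UNIV] by blast
  also have "\<dots> = generated_module UNIV {s 0}"
  proof -
    have "x / s 0 * s 0 \<in> generated_module UNIV {s 0}" for x
      by (rule submodule_mult[OF generated_module_submodule[OF subalgebra_UNIV]])
        (use generated_module_contains[OF subalgebra_UNIV, of "{s 0}"] in auto)
    then show ?thesis using s_nonzero[of 0] genus_ge_2 by auto
  qed
  finally show ?thesis using genus_ge_2 True by (intro exI[of _ 0]) auto
next
  case False
  then have R: "valuation Q" using normalization_cases Q by blast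
  note sub = valuation_subalgebra[OF R]
  let ?P = "normalization_map C Q"
  obtain j where j: "j < g" "\<And>i. i < g \<Longrightarrow> s i / s j \<in> Q" using dominant_section[OF R] by blast
  have "\<omega> ?P \<subseteq> generated_module Q {s j}"
  proof -
    have "s i \<in> generated_module Q {s j}" if "i < g" for i
    proof -
      have "s i / s j * s j \<in> generated_module Q {s j}"
        using generated_module_contains[OF sub, of "{s j}"] j(2)[OF that]
        by (intro submodule_mult[OF generated_module_submodule[OF sub]]) auto
      then show ?thesis using s_nonzero[OF j(1)] by simp
    qed
    moreover have "is_submodule ?P (generated_module Q {s j})"
      using generated_module_submodule[OF sub, of "{s j}"] center(3)[OF R] by (auto simp: is_submodule_def)
    ultimately show ?thesis unfolding globally_generated[OF center(1)[OF R]]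
      by (intro generated_module_least) auto
  qed
  moreover have "s j \<in> \<omega> ?P" using s_in_V[OF j(1)] section_iff closed_point_in_C center(1)[OF R] by blast
  then have "{s j} \<subseteq> generated_module Q (\<omega> ?P)" using generated_module_contains[OF sub, of "\<omega> ?P"] by blast
  ultimately show ?thesis unfolding pullback_mod_torsion_def
    using generated_module_mono[OF sub, of "{s j}" "\<omega> ?P"] generated_module_mono[OF sub, of "\<omega> ?P" "{s j}"] j(1) by blast
qed

text \<open>The function field of the canonical model, which is generated by the quotients of sections
  (\<open>model_field\<close>, \<open>model_field_minimal\<close>).\<close>

definition model_field :: "'a set" where "model_field = \<Union>(canonical_model scale C \<omega> g s)"

lemma canonical_map_chart:
  assumes "Q \<in> normalization C"
  obtains j where "j < g"
    "canonical_map scale C \<omega> g s Q = (let A = subalgebra scale hull ((\<lambda>i. s i / s j) ` {..<g})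
       in localization A (A \<inter> nonunits Q))"
  using someI_ex[OF pullback_generator[OF assms]] unfolding canonical_map_def Let_def by metis

lemma model_field_minimal:
  assumes E: "subextension scale E" and s: "\<And>i j. i < g \<Longrightarrow> j < g \<Longrightarrow> s i / s j \<in> E"
  shows "model_field \<subseteq> E"
proof -
  have "canonical_map scale C \<omega> g s Q \<subseteq> E" if Q: "Q \<in> normalization C" for Q
  proof -
    obtain j where j: "j < g" "canonical_map scale C \<omega> g s Q = (let A = subalgebra scale hull ((\<lambda>i. s i / s j) ` {..<g})
       in localization A (A \<inter> nonunits Q))" by (rule canonical_map_chart[OF Q])
    have "subalgebra scale hull ((\<lambda>i. s i / s j) ` {..<g}) \<subseteq> E"
      using s j(1) subextension_subalgebra[OF E] by (intro hull_minimal) auto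
    then show ?thesis unfolding j(2) Let_def localization_def using subextension_divide[OF E] by blast
  qed
  then show ?thesis unfolding model_field_def canonical_model_def by blast
qed

lemma model_field:
  shows "subextension scale model_field" "i < g \<Longrightarrow> j < g \<Longrightarrow> s i / s j \<in> model_field"
proof -
  obtain k where k: "k < g" "canonical_map scale C \<omega> g s UNIV = (let A = subalgebra scale hull ((\<lambda>i. s i / s k) ` {..<g})
       in localization A (A \<inter> nonunits UNIV))" by (rule canonical_map_chart[OF UNIV_in_normalization])
  let ?A = "subalgebra scale hull ((\<lambda>i. s i / s k) ` {..<g})"
  let ?E = "{a / b | a b. a \<in> ?A \<and> b \<in> ?A \<and> b \<noteq> 0}"
  have A: "subalgebra scale ?A" by (rule subalgebra_hull)
  have E: "subextension scale ?E" by (rule subextensionI[OF A])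
  have eq: "canonical_map scale C \<omega> g s UNIV = ?E"
    unfolding k(2) Let_def localization_def nonunits_UNIV using subalgebra_0[OF A] by auto
  have sk: "s i / s k \<in> ?E" if "i < g" for i
  proof -
    have "s i / s k \<in> ?A" using that by (intro hull_inc) auto
    moreover have "s i / s k = (s i / s k) / 1" by simp
    ultimately show ?thesis using subalgebra_1[OF A]
      by (intro CollectI exI[of _ "s i / s k"] exI[of _ 1]) auto
  qed
  have ratio: "s i / s j \<in> ?E" if "i < g" "j < g" for i j
  proof -
    have "s i / s j = (s i / s k) / (s j / s k)" using s_nonzero k(1) by simp
    then show ?thesis using subextension_divide[OF E sk[OF that(1)] sk[OF that(2)]] by (simp only:)
  qed
  have "model_field = ?E"
  proof (rule antisym)
    show "model_field \<subseteq> ?E" by (rule model_field_minimal[OF E ratio])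
    show "?E \<subseteq> model_field"
      unfolding model_field_def canonical_model_def eq[symmetric] using UNIV_in_normalization by blast
  qed
  then show "subextension scale model_field" "i < g \<Longrightarrow> j < g \<Longrightarrow> s i / s j \<in> model_field"
    using E ratio by auto
qed

lemma canonical_map_birational_iff:
  "has_map_degree (normalization C) (canonical_model scale C \<omega> g s) 1 \<longleftrightarrow> model_field = UNIV"
proof -
  have U: "\<Union>(normalization C) = UNIV" using UNIV_in_normalization by blast
  show ?thesis unfolding has_map_degree_def U model_field_def[symmetric]
  proof
    assume "has_ext_degree model_field UNIV 1"
    then obtain b :: "nat \<Rightarrow> 'a" where "\<forall>x. \<exists>c. (\<forall>i<1. c i \<in> model_field) \<and> x = (\<Sum>i<1. c i * b i)"
      unfolding has_ext_degree_def by (metis UNIV_I)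
    then have b: "\<exists>c\<in>model_field. x = c * b 0" for x by auto
    obtain c where c: "c \<in> model_field" "1 = c * b 0" using b by blast
    have "b 0 = inverse c" using c(2) by (metis inverse_unique)
    then have "b 0 \<in> model_field" using c(1) subextension_inverse[OF model_field(1)] by simp
    then have "x \<in> model_field" for x
      using b[of x] subalgebra_mult[OF subextension_subalgebra[OF model_field(1)]] by auto
    then show "model_field = UNIV" by blast
  next
    assume F: "model_field = UNIV"
    have "\<exists>!c :: nat \<Rightarrow> 'a. (\<forall>i\<ge>1. c i = 0) \<and> x = (\<Sum>i<1. c i * 1)" for x
      by (rule ex1I[of _ "\<lambda>i. if i = 0 then x else 0"]) (auto simp: fun_eq_iff)
    then show "has_ext_degree model_field UNIV 1"
      unfolding has_ext_degree_def F by (intro conjI exI[of _ "\<lambda>_. 1"]) auto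
  qed
qed

end

section \<open>Maps to the projective line\<close>

context curve_function_field
begin

lemma projective_line_function_field: "\<Union>(projective_line scale f) = subextension scale hull {f}"
proof (rule antisym)
  have *: "\<Union>(local_rings (subalgebra scale hull {x})) \<subseteq> subextension scale hull {x}" for x
  proof -
    let ?E = "subextension scale hull {x}"
    have E: "subextension scale ?E" by (rule subextension_hull)
    have "subalgebra scale hull {x} \<subseteq> ?E"
      by (intro hull_minimal) (auto intro: hull_inc subextension_subalgebra[OF E])
    then show ?thesis unfolding local_rings_def localization_def using subextension_divide[OF E] by blast
  qed
  show "\<Union>(projective_line scale f) \<subseteq> subextension scale hull {f}"
    using *[of f] *[of "inverse f"] unfolding projective_line_def subextension_hull_inverse by blast
  have A: "subalgebra scale (subalgebra scale hull {f})" by (rule subalgebra_hull)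
  have "localization (subalgebra scale hull {f}) {0} \<in> local_rings (subalgebra scale hull {f})"
    unfolding local_rings_def using prime_ideal_zero[OF A] by blast
  moreover have "subextension scale hull {f} \<subseteq> localization (subalgebra scale hull {f}) {0}"
    unfolding subextension_hull_singleton subalgebra_hull_singleton localization_def by blast
  ultimately show "subextension scale hull {f} \<subseteq> \<Union>(projective_line scale f)"
    unfolding projective_line_def by blast
qed

lemma localization_at_nonunits:
  assumes A: "subalgebra scale A" "A \<subseteq> Q" and Q: "subalgebra scale Q" and add: "\<And>x y. x \<in> nonunits Q \<Longrightarrow> y \<in> nonunits Q \<Longrightarrow> x + y \<in> nonunits Q"
  shows "prime_ideal_of A (A \<inter> nonunits Q)" "dominates Q (localization A (A \<inter> nonunits Q))"
proof -
  let ?p = "A \<inter> nonunits Q"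
  show p: "prime_ideal_of A ?p"
    unfolding prime_ideal_of_def
  proof (intro conjI ballI impI)
    show "0 \<in> ?p" using subalgebra_0[OF A(1)] zero_in_nonunits[OF subalgebra_0[OF Q]] by blast
    show "1 \<notin> ?p" using one_not_nonunit[OF Q] by blast
    show "x + y \<in> ?p" if "x \<in> ?p" "y \<in> ?p" for x y using that add subalgebra_add[OF A(1)] by blast
    show "a * x \<in> ?p" if "a \<in> A" "x \<in> ?p" for a x
      using that subalgebra_mult[OF A(1)] nonunits_mult[OF Q] A(2) by blast
    show "a \<in> ?p \<or> b \<in> ?p" if "a \<in> A" "b \<in> A" "a * b \<in> ?p" for a b
      using that nonunits_prime[OF Q, of a b] A(2) by blast
  qed blast
  have "a / b \<in> Q" if "a \<in> A" "b \<in> A" "b \<notin> ?p" for a b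
    using that A(2) unit_inverse[of b Q] subalgebra_mult[OF Q, of a "inverse b"] by (auto simp: divide_inverse)
  moreover have "a / b \<in> nonunits Q" if "a \<in> ?p" "b \<in> A" "b \<notin> ?p" for a b
    using that A(2) unit_inverse[of b Q] nonunits_mult[OF Q, of "inverse b" a] by (auto simp: divide_inverse mult.commute)
  ultimately show "dominates Q (localization A ?p)"
    unfolding dominates_def nonunits_localization[OF A(1) p] unfolding localization_def by blast
qed

lemma adic_expansion:
  assumes J: "subspace J"
    and gen: "\<And>y. y \<in> J \<Longrightarrow> \<exists>c. \<exists>z\<in>J. y = (\<Sum>l<r. emb (c l) * u l) + b * z"
    and y: "y \<in> J"
  shows "\<exists>a. \<exists>z\<in>J. y = (\<Sum>i<n. (\<Sum>l<r. emb (a i l) * u l) * b ^ i) + b ^ n * z"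
proof (induction n)
  case 0 then show ?case using y by auto
next
  case (Suc n)
  then obtain a z where az: "z \<in> J" "y = (\<Sum>i<n. (\<Sum>l<r. emb (a i l) * u l) * b ^ i) + b ^ n * z" by blast
  obtain c z' where c: "z' \<in> J" "z = (\<Sum>l<r. emb (c l) * u l) + b * z'" using gen[OF az(1)] by blast
  define a' where "a' = a(n := c)"
  have "(\<Sum>i<n. (\<Sum>l<r. emb (a' i l) * u l) * b ^ i) = (\<Sum>i<n. (\<Sum>l<r. emb (a i l) * u l) * b ^ i)"
    by (intro sum.cong) (auto simp: a'_def)
  then have "y = (\<Sum>i<Suc n. (\<Sum>l<r. emb (a' i l) * u l) * b ^ i) + b ^ Suc n * z'"
    unfolding az(2) c(2) by (simp add: a'_def algebra_simps)
  then show ?case using c(1) by blast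
qed

lemma degree_two_not_one: "\<not> has_ext_degree (UNIV :: 'a set) UNIV 2"
proof
  assume "has_ext_degree (UNIV :: 'a set) UNIV 2"
  then obtain b :: "nat \<Rightarrow> 'a" where "\<forall>x. \<exists>!c. (\<forall>i\<ge>2. c i = 0) \<and> x = (\<Sum>i<2. c i * b i)"
    unfolding has_ext_degree_def by auto
  then have "\<exists>!c :: nat \<Rightarrow> 'a. (\<forall>i\<ge>2. c i = 0) \<and> 0 = (\<Sum>i<2. c i * b i)" by (rule spec)
  moreover define D where "D c \<longleftrightarrow> (\<forall>i\<ge>2. c i = 0) \<and> 0 = (\<Sum>i<2. c i * b i)" for c
  ultimately have ex1: "\<exists>!c. D c" by (simp only:)
  define c :: "nat \<Rightarrow> 'a" where "c i = (if i = 0 then (if b 0 = 0 then 1 else b 1) else if i = 1 then (if b 0 = 0 then 0 else - b 0) else 0)" for i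
  have "D c" by (auto simp: D_def c_def numeral_2_eq_2)
  moreover have "D (\<lambda>_. 0)" by (simp add: D_def)
  ultimately have "c = (\<lambda>_. 0)" using ex1 by blast
  then have "c 0 = 0" "c 1 = 0" by auto
  then show False by (auto simp: c_def split: if_splits)
qed

lemma peval_degree_nonconstant:
  assumes "x \<notin> constants" "degree p > 0"
  shows "peval p x \<notin> constants"
proof
  assume "peval p x \<in> constants"
  then obtain c where "peval p x = emb c" by (auto simp: constants_iff)
  then have "peval (p - [:c:]) x = 0" by (simp add: peval_diff)
  then have "p - [:c:] = 0" using peval_nonconstant[OF assms(1)] by blast
  then show False using assms(2) by auto
qed

end

context complete_curve
begin

lemma Union_C: "\<Union>C = UNIV"
  using UNIV_in_C by blast

lemma C_nonunits_add: "P \<in> C \<Longrightarrow> x \<in> nonunits P \<Longrightarrow> y \<in> nonunits P \<Longrightarrow> x + y \<in> nonunits P"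
  using in_C_cases[of P] point_ring_add[OF closed_point_ring[of P]] by (auto simp: nonunits_UNIV)

lemma dominant_map_projective_line:
  "dominant_map C (projective_line scale f) \<longleftrightarrow> (\<forall>Q\<in>C. f \<in> Q \<or> inverse f \<in> Q)"
proof
  assume dm: "dominant_map C (projective_line scale f)"
  show "\<forall>Q\<in>C. f \<in> Q \<or> inverse f \<in> Q"
  proof
    fix Q assume "Q \<in> C"
    then obtain P where P: "P \<in> projective_line scale f" "P \<subseteq> Q"
      using dm unfolding dominant_map_def dominates_def by blast
    have "x \<in> P" if "P \<in> local_rings (subalgebra scale hull {x})" for x
    proof -
      obtain p where "prime_ideal_of (subalgebra scale hull {x}) p" "P = localization (subalgebra scale hull {x}) p"
        using \<open>P \<in> local_rings _\<close> unfolding local_rings_def by blast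
      then have "subalgebra scale hull {x} \<subseteq> P" using subset_localization[OF subalgebra_hull] by blast
      moreover have "x \<in> subalgebra scale hull {x}" by (rule hull_inc) simp
      ultimately show ?thesis by blast
    qed
    then show "f \<in> Q \<or> inverse f \<in> Q" using P unfolding projective_line_def by blast
  qed
next
  assume A: "\<forall>Q\<in>C. f \<in> Q \<or> inverse f \<in> Q"
  have "\<exists>P\<in>local_rings (subalgebra scale hull {x}). dominates Q P" if "Q \<in> C" "x \<in> Q" for Q x
  proof -
    have sub: "subalgebra scale hull {x} \<subseteq> Q"
      using that C_subalgebra by (intro hull_minimal) auto
    note l = localization_at_nonunits[OF subalgebra_hull sub C_subalgebra[OF that(1)] C_nonunits_add[OF that(1)]]
    show ?thesis unfolding local_rings_def using l by blast
  qed
  then show "dominant_map C (projective_line scale f)"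
    unfolding dominant_map_def projective_line_def using A by (metis UnCI)
qed

lemma hyperelliptic_iff:
  "hyperelliptic scale C \<longleftrightarrow> (\<exists>f. f \<notin> constants \<and> (\<forall>Q\<in>C. f \<in> Q \<or> inverse f \<in> Q) \<and>
     has_ext_degree (subextension scale hull {f}) UNIV 2)"
  unfolding hyperelliptic_def range_scale_one dominant_map_projective_line has_map_degree_def
    projective_line_function_field Union_C ..

text \<open>A semilocal ring.  If the poles of \<open>x\<close> are smooth, its dimension modulo \<open>1/x\<close> is \<open>[K : k(x)]\<close>.\<close>

definition polar_ring :: "'a \<Rightarrow> 'a set" where "polar_ring x = \<Inter>{P \<in> C. x \<notin> P}"

lemma polar_ring_iff: "y \<in> polar_ring x \<longleftrightarrow> (\<forall>P\<in>C. x \<notin> P \<longrightarrow> y \<in> P)"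
  by (auto simp: polar_ring_def)

lemma polar_ring_subalgebra: "subalgebra scale (polar_ring x)"
  unfolding polar_ring_def using C_subalgebra by (intro subalgebra_Inter) auto

lemma inverse_nonunit:
  assumes "P \<in> C" "x \<notin> P" "inverse x \<in> P"
  shows "inverse x \<in> nonunits P"
  using assms by (auto simp: nonunits_iff)

text \<open>At a pole of \<open>w\<close> that is not a pole of \<open>x\<close>, multiply by a power of \<open>x - c\<close>, where \<open>c\<close> is the value
  of \<open>x\<close> there.\<close>

lemma clear_finite_poles:
  obtains q where "q \<noteq> 0" "\<And>P. P \<in> C \<Longrightarrow> x \<in> P \<Longrightarrow> peval q x * w \<in> P"
proof -
  define S where "S = {P \<in> C. x \<in> P \<and> w \<notin> P}"
  have finS: "finite S" unfolding S_def by (rule finite_subset[OF _ finite_poles[of w]]) auto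
  have "\<exists>q. q \<noteq> 0 \<and> peval q x * w \<in> P" if P: "P \<in> S" for P
  proof -
    have Pc: "P \<in> closed_points C" using P not_in_closed by (auto simp: S_def)
    note pr = closed_point_ring[OF Pc]
    obtain c where c: "x - emb c \<in> nonunits P" using P point_ring_residue[OF pr] by (auto simp: S_def)
    obtain N where "(x - emb c) ^ N * w \<in> P" using nonunit_power_absorbs[OF pr c, of w] by blast
    then show ?thesis by (intro exI[of _ "[:- c, 1:] ^ N"]) (simp add: peval_power emb_minus)
  qed
  then obtain q where q: "\<And>P. P \<in> S \<Longrightarrow> q P \<noteq> 0" "\<And>P. P \<in> S \<Longrightarrow> peval (q P) x * w \<in> P" by metis
  show ?thesis
  proof (rule that[of "prod q S"])
    show "prod q S \<noteq> 0" using q(1) finS by simp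
    fix P assume P: "P \<in> C" "x \<in> P"
    note sub = C_subalgebra[OF P(1)]
    show "peval (prod q S) x * w \<in> P"
    proof (cases "P \<in> S")
      case True
      have "peval (prod q S) x * w = peval (prod q (S - {P})) x * (peval (q P) x * w)"
        using prod.remove[OF finS True, of q] by (simp add: peval_mult mult_ac)
      then show ?thesis using subalgebra_mult[OF sub subalgebra_peval[OF sub P(2)] q(2)[OF True]] by metis
    next
      case False
      then have "w \<in> P" using P by (auto simp: S_def)
      then show ?thesis using subalgebra_mult[OF sub subalgebra_peval[OF sub P(2)]] by blast
    qed
  qed
qed

text \<open>The lower bound for residue dimensions, in the form: if \<open>r\<close> elements span the functions regular
  at the poles of \<open>x\<close> modulo \<open>1/x\<close>, then \<open>[K : k(x)] \<le> r\<close>.  Given \<open>r + 1\<close> elements \<open>w\<^sub>j\<close> without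
  poles elsewhere, there are more products \<open>x\<^sup>i w\<^sub>j\<close> than conditions for a combination of them to vanish
  at the poles of \<open>x\<close>; and such a combination is zero.\<close>

lemma dep_bound_from_residues:
  assumes x: "x \<notin> constants" and val: "\<And>P. P \<in> C \<Longrightarrow> x \<notin> P \<Longrightarrow> valuation P"
    and gen: "\<And>y. y \<in> polar_ring x \<Longrightarrow> \<exists>c. \<exists>z\<in>polar_ring x. y = (\<Sum>l<r. emb (c l) * u l) + inverse x * z"
  shows "dep_bound x r"
  unfolding dep_bound_def
proof
  fix w :: "nat \<Rightarrow> 'a"
  let ?J = "polar_ring x"
  define b where "b = inverse x"
  note Jsub = polar_ring_subalgebra[of x]
  have x0: "x \<noteq> 0" using nonconstant_nonzero[OF x] .
  have xb: "x * b = 1" using x0 by (simp add: b_def)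
  have bm: "b \<in> nonunits P" if "P \<in> C" "x \<notin> P" for P
    unfolding b_def using that valuation_cases[OF val[OF that], of x] by (intro inverse_nonunit) auto
  have "\<forall>j. \<exists>q. q \<noteq> 0 \<and> (\<forall>P\<in>C. x \<in> P \<longrightarrow> peval q x * w j \<in> P)"
    using clear_finite_poles[of x] by metis
  then obtain q where q: "\<And>j. q j \<noteq> 0" "\<And>j P. P \<in> C \<Longrightarrow> x \<in> P \<Longrightarrow> peval (q j) x * w j \<in> P" by metis
  define Q where "Q = prod q {..r}"
  have Q0: "Q \<noteq> 0" using q(1) by (simp add: Q_def)
  define W where "W j = peval Q x * w j" for j
  have Wreg: "W j \<in> P" if "P \<in> C" "x \<in> P" "j \<le> r" for j P
  proof -
    note sub = C_subalgebra[OF that(1)]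
    have "W j = peval (prod q ({..r} - {j})) x * (peval (q j) x * w j)"
      using that(3) unfolding W_def Q_def by (simp add: prod.remove[of "{..r}" j] peval_mult mult_ac)
    then show ?thesis using subalgebra_mult[OF sub subalgebra_peval[OF sub that(2)] q(2)[OF that(1,2)]] by metis
  qed
  define B where "B = {P \<in> C. x \<notin> P}"
  have finB: "finite B" unfolding B_def by (rule finite_poles)
  have "\<exists>N. \<forall>n\<ge>N. b ^ n * W j \<in> P" if "P \<in> B" for P j
  proof -
    have P: "P \<in> C" "x \<notin> P" using that by (auto simp: B_def)
    show ?thesis using nonunit_power_absorbs[OF valuation_point_ring[OF val[OF P]] bm[OF P], of "W j"] by metis
  qed
  then obtain N where N: "\<And>P j n. P \<in> B \<Longrightarrow> n \<ge> N P j \<Longrightarrow> b ^ n * W j \<in> P" by metis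
  define E where "E = (\<Sum>(P,j)\<in>B \<times> {..r}. N P j)"
  have NE: "N P j \<le> E" if "P \<in> B" "j \<le> r" for P j
    unfolding E_def using member_le_sum[of "(P,j)" "B \<times> {..r}" "\<lambda>(P,j). N P j"] that finB by auto
  define n where "n = r * E"
  define m where "m = n + E"
  have "\<exists>a. \<exists>z\<in>?J. b ^ m * (x ^ i * W j) = (\<Sum>i'<Suc m. (\<Sum>l<r. emb (a i' l) * u l) * b ^ i') + b ^ Suc m * z"
    if ij: "i \<le> n" "j \<le> r" for i j
  proof (rule adic_expansion[OF subalgebra_subspace[OF Jsub]])
    show "\<exists>c. \<exists>z\<in>?J. y = (\<Sum>l<r. emb (c l) * u l) + b * z" if "y \<in> ?J" for y
      using gen[OF that] by (simp add: b_def)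
    have "b ^ m * (x ^ i * W j) = b ^ (m - i) * W j"
    proof -
      have "m = (m - i) + i" using ij(1) by (simp add: m_def)
      then have "b ^ m = b ^ (m - i) * b ^ i" by (metis power_add)
      moreover have "b ^ i * x ^ i = 1" using xb by (metis mult.commute power_mult_distrib power_one)
      moreover have "b ^ (m - i) * b ^ i * (x ^ i * W j) = b ^ (m - i) * (b ^ i * x ^ i) * W j"
        by (simp only: mult.assoc)
      ultimately show ?thesis by simp
    qed
    moreover have "b ^ (m - i) * W j \<in> P" if "P \<in> C" "x \<notin> P" for P
    proof -
      have "N P j \<le> m - i" using NE[of P j] that ij by (auto simp: B_def m_def)
      then show ?thesis using N[of P j "m - i"] that by (auto simp: B_def)
    qed
    ultimately show "b ^ m * (x ^ i * W j) \<in> ?J" by (simp only: polar_ring_iff) blast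
  qed
  note expand = this
  have "\<forall>v. \<exists>az. fst v \<le> n \<longrightarrow> snd v \<le> r \<longrightarrow> snd az \<in> ?J \<and> b ^ m * (x ^ fst v * W (snd v)) =
      (\<Sum>i'<Suc m. (\<Sum>l<r. emb (fst az i' l) * u l) * b ^ i') + b ^ Suc m * snd az"
  proof (intro allI)
    fix v :: "nat \<times> nat"
    show "\<exists>az. fst v \<le> n \<longrightarrow> snd v \<le> r \<longrightarrow> snd az \<in> ?J \<and> b ^ m * (x ^ fst v * W (snd v)) =
      (\<Sum>i'<Suc m. (\<Sum>l<r. emb (fst az i' l) * u l) * b ^ i') + b ^ Suc m * snd az"
    proof (cases "fst v \<le> n \<and> snd v \<le> r")
      case True
      then obtain a z where "z \<in> ?J" "b ^ m * (x ^ fst v * W (snd v)) =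
        (\<Sum>i'<Suc m. (\<Sum>l<r. emb (a i' l) * u l) * b ^ i') + b ^ Suc m * z"
        using expand by blast
      then show ?thesis by (intro exI[of _ "(a, z)"]) (simp only: fst_conv snd_conv simp_thms)
    qed auto
  qed
  from choice[OF this] obtain f where f: "\<forall>v. fst v \<le> n \<longrightarrow> snd v \<le> r \<longrightarrow> snd (f v) \<in> ?J \<and>
      b ^ m * (x ^ fst v * W (snd v)) =
      (\<Sum>i'<Suc m. (\<Sum>l<r. emb (fst (f v) i' l) * u l) * b ^ i') + b ^ Suc m * snd (f v)" ..
  define a where "a i j = fst (f (i, j))" for i j
  define z where "z i j = snd (f (i, j))" for i j
  have az: "z i j \<in> ?J" "b ^ m * (x ^ i * W j) =
         (\<Sum>i'<Suc m. (\<Sum>l<r. emb (a i j i' l) * u l) * b ^ i') + b ^ Suc m * z i j"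
    if "i \<le> n" "j \<le> r" for i j
    using f[rule_format, of "(i,j)"] that by (simp_all add: a_def z_def del: sum.lessThan_Suc)
  have card: "card ({..<Suc m} \<times> {..<r}) < card ({..n} \<times> {..r})"
    by (simp add: m_def n_def algebra_simps)
  obtain e where e: "\<exists>v\<in>{..n} \<times> {..r}. e v \<noteq> (0 :: 'k)"
     "\<forall>v\<in>{..<Suc m} \<times> {..<r}. (\<Sum>v'\<in>{..n} \<times> {..r}. e v' * (case (v, v') of ((i',l), (i,j)) \<Rightarrow> a i j i' l)) = 0"
    using homogeneous_system_solution[of "UNIV :: 'k set" "{..<Suc m} \<times> {..<r}" "{..n} \<times> {..r}"
      "\<lambda>v v'. case (v, v') of ((i',l), (i,j)) \<Rightarrow> a i j i' l"] card by auto
  have e0: "(\<Sum>(i,j)\<in>{..n} \<times> {..r}. e (i,j) * a i j i' l) = 0" if "i' < Suc m" "l < r" for i' l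
    using e(2)[rule_format, of "(i',l)"] that by (simp add: case_prod_beta)
  define Y where "Y = (\<Sum>(i,j)\<in>{..n} \<times> {..r}. emb (e (i,j)) * (x ^ i * W j))"
  define Z where "Z = (\<Sum>(i,j)\<in>{..n} \<times> {..r}. emb (e (i,j)) * z i j)"
  have ZJ: "Z \<in> ?J" unfolding Z_def
    by (intro subalgebra_sum[OF Jsub]) (auto intro!: subalgebra_mult[OF Jsub] subalgebra_emb[OF Jsub] az(1))
  have "b ^ m * Y = (\<Sum>(i,j)\<in>{..n} \<times> {..r}. emb (e (i,j)) * (b ^ m * (x ^ i * W j)))"
    unfolding Y_def sum_distrib_left by (intro sum.cong) (auto simp: mult_ac)
  also have "\<dots> = (\<Sum>(i,j)\<in>{..n} \<times> {..r}. \<Sum>(i',l)\<in>{..<Suc m} \<times> {..<r}. emb (e (i,j) * a i j i' l) * (u l * b ^ i'))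
      + b ^ Suc m * Z"
  proof -
    have "emb (e (i,j)) * (b ^ m * (x ^ i * W j)) =
        (\<Sum>(i',l)\<in>{..<Suc m} \<times> {..<r}. emb (e (i,j) * a i j i' l) * (u l * b ^ i'))
        + b ^ Suc m * (emb (e (i,j)) * z i j)" if ij: "i \<le> n" "j \<le> r" for i j
      unfolding az(2)[OF ij]
      by (simp add: distrib_left sum_distrib_left sum_distrib_right sum.cartesian_product[symmetric] emb_mult mult_ac
          del: sum.lessThan_Suc)
    then show ?thesis
      unfolding Z_def sum_distrib_left sum.distrib[symmetric] case_prod_beta
      by (intro sum.cong refl) auto
  qed
  also have "(\<Sum>(i,j)\<in>{..n} \<times> {..r}. \<Sum>(i',l)\<in>{..<Suc m} \<times> {..<r}. emb (e (i,j) * a i j i' l) * (u l * b ^ i'))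
      = (\<Sum>(i',l)\<in>{..<Suc m} \<times> {..<r}. emb (\<Sum>(i,j)\<in>{..n} \<times> {..r}. e (i,j) * a i j i' l) * (u l * b ^ i'))"
    unfolding case_prod_beta by (subst sum.swap) (simp add: emb_sum sum_distrib_right)
  also have "\<dots> = 0" using e0 by (intro sum.neutral) auto
  finally have "b ^ m * Y = b ^ m * (b * Z)" by (simp add: mult_ac)
  then have Y: "Y = b * Z" using x0 by (simp add: b_def)
  have Yreg: "Y \<in> P" if P: "P \<in> closed_points C" for P
  proof -
    note sub = point_ring_subalgebra[OF closed_point_ring[OF P]]
    note PC = closed_point_in_C[OF P]
    show ?thesis
    proof (cases "x \<in> P")
      case True
      then show ?thesis unfolding Y_def
        by (intro subalgebra_sum[OF sub])
          (auto intro!: subalgebra_mult[OF sub] subalgebra_emb[OF sub] subalgebra_power[OF sub] Wreg PC)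
    next
      case False
      then have "Z \<in> P" "b \<in> P" using ZJ bm[OF PC] PC nonunits_subset by (auto simp: polar_ring_iff)
      then show ?thesis unfolding Y using subalgebra_mult[OF sub] by blast
    qed
  qed
  then have "Y \<in> constants" by (rule constant_if_regular)
  then obtain c where c: "Y = emb c" by (auto simp: constants_iff)
  obtain P where P: "P \<in> closed_points C" "x \<notin> P" using pole_exists[OF x] .
  note sub = point_ring_subalgebra[OF closed_point_ring[OF P(1)]]
  have "Z * b \<in> nonunits P"
    using ZJ P closed_point_in_C[OF P(1)] by (intro nonunits_mult[OF sub] bm) (auto simp: polar_ring_iff)
  then have Y0: "Y = 0" using c Y nonunits_emb[OF sub, of c] by (simp add: mult.commute)
  define p where "p j = (\<Sum>i\<le>n. monom (e (i,j)) i) * Q" for j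
  have "(\<Sum>j\<le>r. peval (p j) x * w j) = (\<Sum>j\<le>r. \<Sum>i\<le>n. emb (e (i,j)) * (x ^ i * W j))"
    by (simp add: p_def peval_mult peval_sum peval_monom sum_distrib_left W_def mult_ac)
  also have "\<dots> = Y" unfolding Y_def sum.cartesian_product[symmetric] by (rule sum.swap)
  finally have "(\<Sum>j\<le>r. peval (p j) x * w j) = 0" using Y0 by simp
  moreover have "\<exists>j\<le>r. p j \<noteq> 0"
  proof -
    obtain i j where ij: "i \<le> n" "j \<le> r" "e (i,j) \<noteq> 0" using e(1) by auto
    have "coeff (\<Sum>i\<le>n. monom (e (i,j)) i) i = e (i,j)" using ij(1) by (simp add: coeff_sum)
    then have "(\<Sum>i\<le>n. monom (e (i,j)) i) \<noteq> 0" using ij(3) by auto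
    then show ?thesis using Q0 ij(2) by (auto simp: p_def)
  qed
  ultimately show "\<exists>p. (\<exists>j\<le>r. p j \<noteq> 0) \<and> (\<Sum>j\<le>r. peval (p j) x * w j) = 0" by blast
qed

text \<open>The other bound: elements independent modulo \<open>1/x\<close> are independent over \<open>k(x)\<close>.\<close>

lemma independent_from_residues:
  assumes x: "x \<notin> constants" and val: "\<And>P. P \<in> C \<Longrightarrow> x \<notin> P \<Longrightarrow> valuation P"
    and u: "\<And>j. j \<in> T \<Longrightarrow> u j \<in> polar_ring x"
    and ind: "\<And>c y. y \<in> polar_ring x \<Longrightarrow> (\<Sum>j\<in>T. emb (c j) * u j) = inverse x * y \<Longrightarrow> \<forall>j\<in>T. c j = 0"
    and T: "finite T" and d: "\<And>j. j \<in> T \<Longrightarrow> d j \<in> subextension scale hull {x}" and rel: "(\<Sum>j\<in>T. d j * u j) = 0"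
  shows "\<forall>j\<in>T. d j = 0"
proof (rule ccontr)
  assume "\<not> (\<forall>j\<in>T. d j = 0)"
  then obtain j0 where j0: "j0 \<in> T" "d j0 \<noteq> 0" by blast
  define b where "b = inverse x"
  note Jsub = polar_ring_subalgebra[of x]
  have b0: "b \<noteq> 0" using nonconstant_nonzero[OF x] by (simp add: b_def)
  have "b \<in> P" if "P \<in> C" "x \<notin> P" for P unfolding b_def using valuation_cases[OF val[OF that], of x] that by blast
  then have "b \<in> polar_ring x" by (simp add: polar_ring_iff)
  then have bJ: "\<And>y. y \<in> polar_ring x \<Longrightarrow> b * y \<in> polar_ring x" using subalgebra_mult[OF Jsub] by blast
  obtain p where p: "\<exists>j\<in>T. p j \<noteq> 0" "(\<Sum>j\<in>T. peval (p j) b * u j) = 0"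
    using clear_denominators[of T d b u j0] T d rel j0 unfolding b_def subextension_hull_inverse by blast
  then obtain j1 where "j1 \<in> T" "p j1 \<noteq> 0" by blast
  then obtain c y where "\<exists>j\<in>T. c j \<noteq> 0" "y \<in> polar_ring x" "(\<Sum>j\<in>T. emb (c j) * u j) = b * y"
    using dependent_mod[OF b0 subalgebra_subspace[OF Jsub] bJ u p(2)] by blast
  then show False using ind[of y c] by (auto simp: b_def)
qed

text \<open>The two bounds together: \<open>1\<close> and \<open>u\<close> form a basis of \<open>K\<close> over \<open>k(x)\<close>.\<close>

lemma hyperelliptic_if_residue_degree_two:
  assumes x: "x \<notin> constants" and val: "\<And>P. P \<in> C \<Longrightarrow> x \<notin> P \<Longrightarrow> valuation P"
    and u: "u \<in> polar_ring x"
    and gen: "\<And>y. y \<in> polar_ring x \<Longrightarrow> \<exists>c d. \<exists>z\<in>polar_ring x. y = emb c + emb d * u + inverse x * z"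
    and ind: "\<And>c z. z \<in> polar_ring x \<Longrightarrow> u \<noteq> emb c + inverse x * z"
  shows "hyperelliptic scale C"
proof -
  let ?J = "polar_ring x" and ?F = "subextension scale hull {x}"
  define b where "b = inverse x"
  note Jsub = polar_ring_subalgebra[of x]
  have F: "subextension scale ?F" by (rule subextension_hull)
  note Fsub = subextension_subalgebra[OF F]
  have xF: "x \<in> ?F" by (rule hull_inc) simp
  define v where "v l = (if l = 0 then 1 else u)" for l :: nat
  have two: "(\<Sum>l<2. f l * v l) = f 0 + f 1 * u" for f by (simp add: numeral_2_eq_2 v_def)
  have bound: "dep_bound x 2"
  proof (rule dep_bound_from_residues[OF x val])
    fix y assume "y \<in> ?J"
    then obtain c d z where "z \<in> ?J" "y = emb c + emb d * u + inverse x * z" using gen by blast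
    then show "\<exists>c. \<exists>z\<in>?J. y = (\<Sum>l<2. emb (c l) * v l) + inverse x * z"
      unfolding two by (intro exI[of _ "\<lambda>l. if l = 0 then c else d"]) auto
  qed
  obtain P where P: "P \<in> closed_points C" "x \<notin> P" using pole_exists[OF x] .
  note sub = point_ring_subalgebra[OF closed_point_ring[OF P(1)]]
  have bm: "b \<in> nonunits P" unfolding b_def
    using P closed_point_in_C[OF P(1)] val valuation_cases by (intro inverse_nonunit) blast+
  have indep: "\<forall>j\<in>{..<2}. d j = 0" if d: "\<And>j. j \<in> {..<2} \<Longrightarrow> d j \<in> ?F" and rel: "(\<Sum>j<2. d j * v j) = 0" for d
  proof (rule independent_from_residues[OF x val _ _ _ d rel])
    show "v j \<in> ?J" for j using u subalgebra_1[OF Jsub] by (simp add: v_def)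
    fix c y assume y: "y \<in> ?J" and "(\<Sum>j<2. emb (c j) * v j) = inverse x * y"
    then have rel: "emb (c 0) + emb (c 1) * u = inverse x * y" by (simp only: two)
    have c1: "c 1 = 0"
    proof (rule ccontr)
      assume c1: "c 1 \<noteq> 0"
      have "u = emb (- (c 0) * inverse (c 1)) + inverse x * (emb (inverse (c 1)) * y)"
      proof -
        have "emb (c 1) * u = inverse x * y - emb (c 0)" using rel by (metis add_diff_cancel_left')
        then have "inverse (emb (c 1)) * (emb (c 1) * u) = inverse (emb (c 1)) * (inverse x * y - emb (c 0))" by simp
        moreover have "inverse (emb (c 1)) * (emb (c 1) * u) = u" using c1 by (simp flip: mult.assoc)
        ultimately have "u = inverse (emb (c 1)) * (inverse x * y - emb (c 0))" by (simp only:)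
        then show ?thesis by (simp add: emb_mult emb_minus emb_inverse algebra_simps)
      qed
      then show False using ind subalgebra_mult[OF Jsub subalgebra_emb[OF Jsub] y] by blast
    qed
    then have "emb (c 0) = y * b" using rel by (simp add: b_def mult.commute)
    also have "\<dots> \<in> nonunits P"
      using y P closed_point_in_C[OF P(1)] by (intro nonunits_mult[OF sub _ bm]) (simp add: polar_ring_iff)
    finally have "c 0 = 0" using nonunits_emb[OF sub] by blast
    then show "\<forall>j\<in>{..<2}. c j = 0" using c1 by (auto simp: numeral_2_eq_2 less_Suc_eq)
  qed auto
  have "\<exists>!c. (\<forall>i<2. c i \<in> ?F) \<and> (\<forall>i\<ge>2. c i = 0) \<and> y = (\<Sum>i<2. c i * v i)" for y
  proof (rule ex_ex1I)
    obtain p where p: "\<exists>j\<le>2. p j \<noteq> 0" "(\<Sum>j\<le>2. peval (p j) x * (if j = 2 then y else v j)) = 0"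
      using bound[unfolded dep_bound_def, rule_format, of "\<lambda>j. if j = 2 then y else v j"] by blast
    have s: "(\<Sum>j\<le>2. peval (p j) x * (if j = 2 then y else v j)) = (\<Sum>j<2. peval (p j) x * v j) + peval (p 2) x * y"
      by (simp add: numeral_2_eq_2)
    have p2: "peval (p 2) x \<noteq> 0"
    proof
      assume z: "peval (p 2) x = 0"
      then have "(\<Sum>j<2. peval (p j) x * v j) = 0" using s p(2) by (metis add.right_neutral mult_zero_left)
      from indep[OF subalgebra_peval[OF Fsub xF] this] have "\<forall>j\<in>{..<2}. peval (p j) x = 0" .
      then have "\<forall>j<2. p j = 0" "p 2 = 0" using z by (simp_all add: peval_eq_0_iff[OF x])
      then show False using p(1) le_neq_implies_less by blast
    qed
    define c where "c j = (if j < 2 then - peval (p j) x / peval (p 2) x else 0)" for j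
    have "(\<Sum>j<2. c j * v j) = - (\<Sum>j<2. peval (p j) x * v j) / peval (p 2) x"
      by (simp add: c_def sum_divide_distrib flip: sum_negf)
    also have "- (\<Sum>j<2. peval (p j) x * v j) = peval (p 2) x * y"
      using s p(2) by (metis add.commute add_eq_0_iff)
    also have "peval (p 2) x * y / peval (p 2) x = y" using p2 by simp
    finally have "y = (\<Sum>j<2. c j * v j)" by simp
    moreover have "\<forall>i<2. c i \<in> ?F"
      using subextension_divide[OF F] subalgebra_uminus[OF Fsub] subalgebra_peval[OF Fsub xF] by (simp add: c_def)
    moreover have "\<forall>i\<ge>2. c i = 0" by (simp add: c_def)
    ultimately show "\<exists>c. (\<forall>i<2. c i \<in> ?F) \<and> (\<forall>i\<ge>2. c i = 0) \<and> y = (\<Sum>i<2. c i * v i)" by blast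
  next
    fix c d
    assume c: "(\<forall>i<2. c i \<in> ?F) \<and> (\<forall>i\<ge>2. c i = 0) \<and> y = (\<Sum>i<2. c i * v i)"
      and d: "(\<forall>i<2. d i \<in> ?F) \<and> (\<forall>i\<ge>2. d i = 0) \<and> y = (\<Sum>i<2. d i * v i)"
    have "\<forall>j\<in>{..<2}. c j - d j = 0"
      using c d by (intro indep) (auto simp: left_diff_distrib sum_subtractf intro: subalgebra_diff[OF Fsub])
    then have "c i = d i" for i using c d by (cases "i < 2") auto
    then show "c = d" by blast
  qed
  then have "has_ext_degree ?F UNIV 2"
    unfolding has_ext_degree_def by (intro conjI exI[of _ v] ballI) simp_all
  moreover have "x \<in> Q \<or> inverse x \<in> Q" if "Q \<in> C" for Q
    using val[OF that] valuation_cases[of Q x] by blast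
  ultimately show ?thesis unfolding hyperelliptic_iff using x by blast
qed

end

context dualized_curve
begin

section \<open>The canonical map of a hyperelliptic curve\<close>

definition polar_trace :: "'a \<Rightarrow> 'a \<Rightarrow> 'k" where
  "polar_trace f y = trace (\<lambda>P. if P \<in> {P \<in> closed_points C. f \<notin> P} then y else 0)"

lemma polar_trace_add: "polar_trace f (x + y) = polar_trace f x + polar_trace f y"
proof -
  let ?B = "{P \<in> closed_points C. f \<notin> P}"
  have "(\<lambda>P. if P \<in> ?B then x + y else 0) = (\<lambda>P. (if P \<in> ?B then x else 0) + (if P \<in> ?B then y else 0))" by auto
  then show ?thesis unfolding polar_trace_def
    using trace_add[OF adeles1_restrict[of ?B x] adeles1_restrict[of ?B y]] by auto
qed

lemma polar_trace_emb: "polar_trace f (emb c * x) = c * polar_trace f x"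
proof -
  let ?B = "{P \<in> closed_points C. f \<notin> P}"
  have "(\<lambda>P. if P \<in> ?B then emb c * x else 0) = (\<lambda>P. emb c * (if P \<in> ?B then x else 0))" by auto
  then show ?thesis unfolding polar_trace_def
    using trace_emb[OF adeles1_restrict[of ?B x], of c] by auto
qed

lemma polar_trace_sum: "polar_trace f (sum h S) = (\<Sum>i\<in>S. polar_trace f (h i))"
  using polar_trace_emb[of f 0 0]
  by (induction S rule: infinite_finite_induct) (auto simp: polar_trace_add)

lemma polar_trace_eq_0:
  "(\<And>P. P \<in> closed_points C \<Longrightarrow> f \<in> P \<Longrightarrow> y \<in> \<omega> P) \<Longrightarrow> polar_trace f y = 0"
  unfolding polar_trace_def by (intro trace_restriction) auto

lemma polar_trace_regular:
  assumes "\<And>P. P \<in> closed_points C \<Longrightarrow> f \<notin> P \<Longrightarrow> y \<in> \<omega> P"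
  shows "polar_trace f y = 0"
  unfolding polar_trace_def
proof (rule trace_coboundary)
  let ?B = "{P \<in> closed_points C. f \<notin> P}"
  have "(if P \<in> ?B then y else 0) - 0 \<in> \<omega> P" if "P \<in> closed_points C" for P
    using assms that submodule_0[OF omega_submodule'] by auto
  then show "(\<lambda>P. if P \<in> ?B then y else 0) \<in> cob1 \<omega>"
    unfolding cob1_def using adeles1_restrict[of ?B y] by blast
qed

text \<open>A degree-two map leaves only two residue directions at the poles of \<open>f\<close>, and one of them is
  spanned by \<open>1\<close>.\<close>

lemma polar_ring_two_generators:
  assumes f: "f \<notin> constants" and fQ: "\<And>Q. Q \<in> C \<Longrightarrow> f \<in> Q \<or> inverse f \<in> Q"
    and deg: "has_ext_degree (subextension scale hull {f}) UNIV 2"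
  obtains u where "u \<in> polar_ring f"
    "\<And>y. y \<in> polar_ring f \<Longrightarrow> \<exists>c. \<exists>z\<in>polar_ring f. y = (\<Sum>l<(2::nat). emb (c l) * (if l = 0 then 1 else u)) + inverse f * z"
proof -
  let ?J = "polar_ring f"
  define b where "b = inverse f"
  note Jsub = polar_ring_subalgebra[of f]
  note cl = subalgebra_closed[OF Jsub]
  have b0: "b \<noteq> 0" using nonconstant_nonzero[OF f] by (simp add: b_def)
  have bJ: "b \<in> ?J" using fQ by (auto simp: b_def polar_ring_iff)
  have dep: "dep_bound b 2" unfolding b_def using deg by (intro dep_bound_degree) (simp add: subextension_hull_inverse)
  obtain P where P: "P \<in> closed_points C" "f \<notin> P" using pole_exists[OF f] .
  note sub = point_ring_subalgebra[OF closed_point_ring[OF P(1)]]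
  have bm: "b \<in> nonunits P" unfolding b_def
    using P closed_point_in_C[OF P(1)] fQ by (intro inverse_nonunit) auto
  have const: "c = 0" if "emb c = b * z" "z \<in> ?J" for c z
  proof -
    have "z * b \<in> nonunits P"
      using that(2) P closed_point_in_C[OF P(1)] by (intro nonunits_mult[OF sub _ bm]) (simp add: polar_ring_iff)
    then show ?thesis using that(1) nonunits_emb[OF sub] by (simp add: mult.commute)
  qed
  have two: "(\<Sum>l<(2::nat). emb (c l) * (if l = 0 then 1 else u)) = emb (c 0) + emb (c 1) * u" for c :: "nat \<Rightarrow> 'k" and u
    by (simp add: numeral_2_eq_2)
  have ex: "\<exists>u\<in>?J. \<forall>y\<in>?J. \<exists>c d. \<exists>z\<in>?J. y = emb c + emb d * u + b * z"
  proof (cases "\<forall>y\<in>?J. \<exists>c. \<exists>z\<in>?J. y = emb c + b * z")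
    case True
    then show ?thesis using cl(1) by (intro bexI[of _ 0]) auto
  next
    case False
    then obtain u where u: "u \<in> ?J" "\<And>c z. z \<in> ?J \<Longrightarrow> u \<noteq> emb c + b * z" by blast
    have "\<exists>c d. \<exists>z\<in>?J. y = emb c + emb d * u + b * z" if y: "y \<in> ?J" for y
    proof -
      define w where "w j = (if j = 0 then 1 else if j = 1 then u else y)" for j :: nat
      have "w j \<in> ?J" for j using u y cl by (simp add: w_def)
      then obtain c z where c: "\<exists>j\<le>2. c j \<noteq> 0" "z \<in> ?J" "(\<Sum>j\<le>2. emb (c j) * w j) = b * z"
        using dep_bound_mod[OF dep b0 subalgebra_subspace[OF Jsub] cl(6)[OF bJ], of w] by blast
      have rel: "emb (c 0) + emb (c 1) * u + emb (c 2) * y = b * z"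
        using c(3) by (simp add: w_def numeral_2_eq_2)
      have c2: "c 2 \<noteq> 0"
      proof
        assume c2: "c 2 = 0"
        have c1: "c 1 = 0"
        proof (rule ccontr)
          assume c1: "c 1 \<noteq> 0"
          have "emb (c 1) * u = b * z - emb (c 0)" using rel c2 by (simp add: algebra_simps)
          then have "emb (inverse (c 1)) * (emb (c 1) * u) = emb (inverse (c 1)) * (b * z - emb (c 0))" by simp
          moreover have "emb (inverse (c 1)) * (emb (c 1) * u) = u" using c1 by (simp add: emb_inverse flip: mult.assoc)
          ultimately have "u = emb (inverse (c 1)) * (b * z - emb (c 0))" by (simp only:)
          then have "u = emb (- (inverse (c 1) * c 0)) + b * (emb (inverse (c 1)) * z)"
            by (simp add: emb_minus emb_mult algebra_simps)
          then show False using u(2)[OF cl(6)[OF cl(7) c(2)]] by blast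
        qed
        then have "emb (c 0) = b * z" using rel c2 by simp
        then have "c 0 = 0" using const c(2) by blast
        then show False using c(1) c1 c2 by (auto simp: numeral_2_eq_2 le_Suc_eq)
      qed
      have "emb (c 2) * y = b * z - emb (c 0) - emb (c 1) * u" using rel by (simp add: algebra_simps)
      then have "emb (inverse (c 2)) * (emb (c 2) * y) = emb (inverse (c 2)) * (b * z - emb (c 0) - emb (c 1) * u)" by simp
      moreover have "emb (inverse (c 2)) * (emb (c 2) * y) = y" using c2 by (simp add: emb_inverse flip: mult.assoc)
      ultimately have "y = emb (inverse (c 2)) * (b * z - emb (c 0) - emb (c 1) * u)" by (simp only:)
      then have "y = emb (- (inverse (c 2) * c 0)) + emb (- (inverse (c 2) * c 1)) * u + b * (emb (inverse (c 2)) * z)"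
        by (simp add: emb_minus emb_mult algebra_simps)
      then show ?thesis using cl(6)[OF cl(7) c(2)] by blast
    qed
    then show ?thesis using u(1) by blast
  qed
  then obtain u where u: "u \<in> ?J" "\<forall>y\<in>?J. \<exists>c d. \<exists>z\<in>?J. y = emb c + emb d * u + b * z" by blast
  show ?thesis
  proof (rule that[OF u(1)])
    fix y assume "y \<in> ?J"
    then obtain c d z where "z \<in> ?J" "y = emb c + emb d * u + b * z" using u(2) by blast
    then show "\<exists>c. \<exists>z\<in>?J. y = (\<Sum>l<(2::nat). emb (c l) * (if l = 0 then 1 else u)) + inverse f * z"
      unfolding two b_def by (intro exI[of _ "\<lambda>l. if l = 0 then c else d"]) auto
  qed
qed

text \<open>Of the \<open>2 (g - 1)\<close> conditions on a section \<open>h\<close> for \<open>f\<^sup>g\<^sup>-\<^sup>1 h\<close> to be a section again, half hold by the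
  residue theorem, because they involve the powers of \<open>f\<close> alone.  So there is a nonzero \<open>h\<close>, and \<open>V\<close> is
  spanned by \<open>h, f h, \<dots>, f\<^sup>g\<^sup>-\<^sup>1 h\<close>.\<close>

lemma hyperelliptic_not_birational:
  assumes "hyperelliptic scale C"
  shows "model_field \<noteq> UNIV"
proof -
  obtain f where f: "f \<notin> constants" and fQ: "\<And>Q. Q \<in> C \<Longrightarrow> f \<in> Q \<or> inverse f \<in> Q"
    and deg: "has_ext_degree (subextension scale hull {f}) UNIV 2"
    using assms unfolding hyperelliptic_iff by blast
  let ?J = "polar_ring f" and ?E = "subextension scale hull {f}"
  let ?B = "{P \<in> closed_points C. f \<notin> P}"
  have E: "subextension scale ?E" by (rule subextension_hull)
  have fE: "f \<in> ?E" by (rule hull_inc) simp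
  define b where "b = inverse f"
  define n where "n = g - 1"
  have n: "n \<ge> 1" "g = Suc n" using genus_ge_2 by (auto simp: n_def)
  have f0: "f \<noteq> 0" using nonconstant_nonzero[OF f] .
  have fb: "f ^ i * b ^ i = 1" for i using f0 by (simp add: b_def flip: power_mult_distrib)
  note Jsub = polar_ring_subalgebra[of f]
  obtain u where u: "u \<in> ?J"
    and gen: "\<And>y. y \<in> ?J \<Longrightarrow> \<exists>c. \<exists>z\<in>?J. y = (\<Sum>l<(2::nat). emb (c l) * (if l = 0 then 1 else u)) + b * z"
    using polar_ring_two_generators[OF f fQ deg] unfolding b_def by blast
  have finB: "finite ?B" by (rule finite_subset[OF _ finite_poles[of f]]) (auto simp: closed_points_def)
  have bm: "b \<in> nonunits P" if "P \<in> ?B" for P unfolding b_def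
    using that closed_point_in_C fQ by (intro inverse_nonunit) auto
  \<comment> \<open>\<open>g - 1\<close> conditions on the \<open>g\<close> coefficients of \<open>h\<close>\<close>
  obtain e where e: "\<exists>l\<in>{..<g}. e l \<noteq> (0 :: 'k)"
      "\<forall>i\<in>{1..<g}. (\<Sum>l<g. e l * polar_trace f (f ^ i * (s l * u))) = 0"
    using homogeneous_system_solution[of "UNIV :: 'k set" "{1..<g}" "{..<g}" "\<lambda>i l. polar_trace f (f ^ i * (s l * u))"]
      n by auto
  define h where "h = (\<Sum>l<g. emb (e l) * s l)"
  have hV: "h \<in> V" unfolding h_def by (rule V_combination)
  have h0: "h \<noteq> 0" unfolding h_def using e(1) V_combination_nonzero by blast
  have hw: "h \<in> \<omega> P" if "P \<in> closed_points C" for P using hV section_iff closed_point_in_C[OF that] by blast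
  have T_u: "polar_trace f (f ^ i * h * u) = 0" if "1 \<le> i" "i \<le> n" for i
  proof -
    have "f ^ i * h * u = (\<Sum>l<g. emb (e l) * (f ^ i * (s l * u)))"
      by (simp add: h_def sum_distrib_left sum_distrib_right mult_ac)
    then have "polar_trace f (f ^ i * h * u) = (\<Sum>l<g. e l * polar_trace f (f ^ i * (s l * u)))"
      by (simp only: polar_trace_sum polar_trace_emb)
    then show ?thesis using e(2)[rule_format, of i] that n by simp
  qed
  have fh_regular: "f ^ i * h \<in> \<omega> P" if "P \<in> closed_points C" "f \<in> P" for i P
    using submodule_mult[OF omega_submodule'[OF that(1)] _ hw[OF that(1)], of "f ^ i"]
      subalgebra_power[OF C_subalgebra[OF closed_point_in_C[OF that(1)]] that(2)] by blast
  then have T_1: "polar_trace f (f ^ i * h) = 0" for i by (intro polar_trace_eq_0)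
  have T_J: "polar_trace f (f ^ n * h * a) = 0" if a: "a \<in> ?J" for a
  proof -
    obtain d z where dz: "z \<in> ?J" "a = (\<Sum>i<n. (\<Sum>l<(2::nat). emb (d i l) * (if l = 0 then 1 else u)) * b ^ i) + b ^ n * z"
      using adic_expansion[OF subalgebra_subspace[OF Jsub] gen a, where n = n] by blast
    have "f ^ n * h * a = (\<Sum>i<n. f ^ n * h * ((\<Sum>l<(2::nat). emb (d i l) * (if l = 0 then 1 else u)) * b ^ i)) + f ^ n * h * (b ^ n * z)"
      unfolding dz(2) by (simp only: distrib_left sum_distrib_left)
    also have "f ^ n * h * (b ^ n * z) = z * h" using fb[of n] by (metis mult.assoc mult.commute mult_1)
    also have "(\<Sum>i<n. f ^ n * h * ((\<Sum>l<(2::nat). emb (d i l) * (if l = 0 then 1 else u)) * b ^ i)) =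
        (\<Sum>i<n. emb (d i 0) * (f ^ (n - i) * h) + emb (d i 1) * (f ^ (n - i) * h * u))"
    proof (intro sum.cong refl)
      fix i assume "i \<in> {..<n}"
      then have "f ^ n = f ^ (n - i) * f ^ i" by (simp flip: power_add)
      then have "f ^ n * b ^ i = f ^ (n - i)" using fb[of i] by (simp add: mult.assoc)
      then have *: "f ^ n * h * (X * b ^ i) = f ^ (n - i) * h * X" for X by (metis mult.assoc mult.commute)
      show "f ^ n * h * ((\<Sum>l<(2::nat). emb (d i l) * (if l = 0 then 1 else u)) * b ^ i) =
          emb (d i 0) * (f ^ (n - i) * h) + emb (d i 1) * (f ^ (n - i) * h * u)"
        unfolding * by (simp add: numeral_2_eq_2 algebra_simps)
    qed
    finally have "polar_trace f (f ^ n * h * a) =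
        (\<Sum>i<n. d i 0 * polar_trace f (f ^ (n - i) * h) + d i 1 * polar_trace f (f ^ (n - i) * h * u)) + polar_trace f (z * h)"
      by (simp add: polar_trace_add polar_trace_sum polar_trace_emb)
    also have "(\<Sum>i<n. d i 0 * polar_trace f (f ^ (n - i) * h) + d i 1 * polar_trace f (f ^ (n - i) * h * u)) = 0"
      using T_1 T_u by (intro sum.neutral) auto
    also have "polar_trace f (z * h) = 0"
    proof (rule polar_trace_regular)
      fix P assume P: "P \<in> closed_points C" "f \<notin> P"
      then have "z \<in> P" using dz(1) closed_point_in_C by (auto simp: polar_ring_iff)
      then show "z * h \<in> \<omega> P" using submodule_mult[OF omega_submodule'[OF P(1)] _ hw[OF P(1)]] by blast
    qed
    finally show ?thesis by simp
  qed
  have top: "f ^ n * h \<in> \<omega> P" if P: "P \<in> ?B" for P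
  proof (rule local_duality)
    show Pc: "P \<in> closed_points C" using P by simp
    fix c assume c: "c \<in> P"
    have bn: "b ^ n \<noteq> 0" "\<And>Q. Q \<in> ?B \<Longrightarrow> b ^ n \<in> nonunits Q"
      using f0 n bm nonunits_power C_subalgebra closed_point_in_C by (auto simp: b_def)
    obtain a where a: "(a - c) / b ^ n \<in> P" "\<And>Q. Q \<in> ?B - {P} \<Longrightarrow> a / b ^ n \<in> Q"
      using point_approximation[OF finB _ P c bn] by blast
    have div: "y / b ^ n = f ^ n * y" for y by (simp add: b_def power_inverse divide_inverse)
    have cancel: "y / b ^ n * b ^ n = y" for y
      using bn(1) by (metis nonzero_eq_divide_eq)
    define \<beta> where "\<beta> Q = (if Q \<in> ?B then f ^ n * h * a else 0) - skyscraper P (c * (f ^ n * h)) Q" for Q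
    have bQ: "b ^ n \<in> Q" if "Q \<in> ?B" for Q using bn(2)[OF that] nonunits_subset by blast
    have aJ: "a \<in> ?J" unfolding polar_ring_iff
    proof (intro ballI impI)
      fix Q assume Q: "Q \<in> C" "f \<notin> Q"
      then have QB: "Q \<in> ?B" using not_in_closed by blast
      note sub = C_subalgebra[OF Q(1)]
      show "a \<in> Q"
      proof (cases "Q = P")
        case True
        have "(a - c) / b ^ n * b ^ n \<in> P" using a(1) bQ[OF P] C_subalgebra[OF closed_point_in_C[OF Pc]] by (intro subalgebra_mult)
        then have "a - c \<in> P" by (simp only: cancel)
        then have "a - c + c \<in> P" using c C_subalgebra[OF closed_point_in_C[OF Pc]] by (intro subalgebra_add)
        then show ?thesis using True by simp
      next
        case False
        then have "a / b ^ n * b ^ n \<in> Q" using a(2)[of Q] QB bQ[OF QB] sub by (intro subalgebra_mult) auto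
        then show ?thesis by (simp only: cancel)
      qed
    qed
    have bcob: "\<beta> \<in> cob1 \<omega>"
    proof -
      have "\<beta> \<in> adeles1" unfolding \<beta>_def
        by (intro adeles1_diff adeles1_restrict adeles1_skyscraper Pc) auto
      moreover have "\<beta> Q - 0 \<in> \<omega> Q" if Q: "Q \<in> closed_points C" for Q
      proof -
        consider "Q = P" | "Q \<noteq> P" "Q \<in> ?B" | "Q \<noteq> P" "Q \<notin> ?B" by blast
        then show ?thesis
        proof cases
          case 1
          then have "\<beta> Q = (f ^ n * (a - c)) * h" using P by (simp add: \<beta>_def skyscraper_def algebra_simps)
          then show ?thesis using a(1) 1 submodule_mult[OF omega_submodule'[OF Q] _ hw[OF Q]] by (simp add: div)
        next
          case 2
          then have "\<beta> Q = (f ^ n * a) * h" by (simp add: \<beta>_def skyscraper_def algebra_simps)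
          then show ?thesis using a(2)[of Q] 2 submodule_mult[OF omega_submodule'[OF Q] _ hw[OF Q]] by (simp add: div)
        next
          case 3
          then have "\<beta> Q = 0" using Q by (simp add: \<beta>_def skyscraper_def)
          then show ?thesis using submodule_0[OF omega_submodule'[OF Q]] by simp
        qed
      qed
      ultimately show ?thesis unfolding cob1_def by blast
    qed
    have "trace \<beta> = polar_trace f (f ^ n * h * a) - residue P (c * (f ^ n * h))"
      unfolding \<beta>_def polar_trace_def residue_def
      by (intro trace_diff adeles1_restrict adeles1_skyscraper Pc) auto
    then show "residue P (c * (f ^ n * h)) = 0" using trace_coboundary[OF bcob] T_J[OF aJ] by simp
  qed
  have fhV: "f ^ i * h \<in> V" if i: "i \<le> n" for i
  proof (rule sectionI)
    fix P assume P: "P \<in> closed_points C"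
    show "f ^ i * h \<in> \<omega> P"
    proof (cases "f \<in> P")
      case True then show ?thesis using fh_regular P by blast
    next
      case False
      then have PB: "P \<in> ?B" using P by simp
      have "f ^ n = f ^ i * f ^ (n - i)" using i by (simp flip: power_add)
      then have "b ^ (n - i) * (f ^ n * h) = f ^ i * h" using fb[of "n - i"] by (simp add: mult_ac)
      moreover have "b ^ (n - i) * (f ^ n * h) \<in> \<omega> P"
        using bm[OF PB] nonunits_subset C_subalgebra[OF closed_point_in_C[OF P]]
        by (intro submodule_mult[OF omega_submodule'[OF P]] top[OF PB] subalgebra_power) auto
      ultimately show ?thesis by (simp only:)
    qed
  qed
  have sh: "s i / h \<in> ?E" if i: "i < g" for i
  proof -
    obtain c where c: "\<exists>j\<le>g. c j \<noteq> 0" "(\<Sum>j\<le>g. emb (c j) * (if j = g then s i else f ^ j * h)) = 0"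
    proof (rule V_dependent[of "\<lambda>j. if j = g then s i else f ^ j * h"])
      show "(if j = g then s i else f ^ j * h) \<in> V" if "j \<le> g" for j
        using fhV[of j] s_in_V[OF i] that n by auto
      fix c assume "\<exists>j\<le>g. c j \<noteq> 0" "(\<Sum>j\<le>g. emb (c j) * (if j = g then s i else f ^ j * h)) = 0"
      then show thesis by (rule that)
    qed
    define q where "q = (\<Sum>j<g. monom (c j) j)"
    have "(\<Sum>j<g. emb (c j) * (if j = g then s i else f ^ j * h)) = peval q f * h"
      by (simp add: q_def peval_sum peval_monom sum_distrib_right mult.assoc)
    then have rel: "peval q f * h + emb (c g) * s i = 0"
      using c(2) by (simp add: lessThan_Suc_atMost[symmetric])
    have cg: "c g \<noteq> 0"
    proof
      assume cg: "c g = 0"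
      then have "peval q f = 0" using rel h0 by simp
      then have "q = 0" using peval_nonconstant[OF f] by blast
      moreover have "coeff q j = c j" if "j < g" for j using that by (simp add: q_def coeff_sum)
      ultimately have "c j = 0" if "j < g" for j using that by fastforce
      then show False using c(1) cg by (auto simp: le_less)
    qed
    have "emb (c g) * s i = - peval q f * h" using rel by (simp add: eq_neg_iff_add_eq_0 add.commute)
    then have "s i / h = - peval q f / emb (c g)" using h0 cg by (simp add: field_simps)
    also have "\<dots> \<in> ?E"
      using subextension_subalgebra[OF E] fE
      by (intro subextension_divide[OF E] subalgebra_uminus subalgebra_peval subalgebra_emb)
    finally show ?thesis .
  qed
  have "s i / s j \<in> ?E" if "i < g" "j < g" for i j
  proof -
    have "s i / s j = (s i / h) / (s j / h)" using h0 by simp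
    then show ?thesis using subextension_divide[OF E sh[OF that(1)] sh[OF that(2)]] by (simp only:)
  qed
  then have "model_field \<subseteq> ?E" by (rule model_field_minimal[OF E])
  moreover have "?E \<noteq> UNIV" using deg degree_two_not_one by auto
  ultimately show ?thesis by blast
qed

section \<open>Curves whose canonical map is not birational\<close>

text \<open>Duality for the structure sheaf: a linear form on its first cohomology is given by a section
  of \<open>\<omega>\<close>.\<close>

lemma coboundary_if_orthogonal:
  assumes a: "a \<in> adeles1" and orth: "\<And>h. h \<in> V \<Longrightarrow> trace (\<lambda>P. h * a P) = 0"
  shows "a \<in> cob1 (\<lambda>P. P)"
proof (rule ccontr)
  assume "a \<notin> cob1 (\<lambda>P. P)"
  then obtain \<phi> where phi: "\<And>a b. \<phi> (\<lambda>P. a P + b P) = \<phi> a + \<phi> b"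
    "\<And>c a. \<phi> (\<lambda>P. emb c * a P) = c * \<phi> a" "\<And>a. a \<in> cob1 (\<lambda>P. P) \<Longrightarrow> \<phi> a = 0" "\<phi> a = 1"
    using functional_exists[of "\<lambda>P. P" a] structure_submodule by blast
  obtain h where h: "\<forall>P\<in>C. \<forall>v\<in>P. h * v \<in> \<omega> P" "\<forall>a\<in>adeles1. \<phi> a = trace (\<lambda>P. h * a P)"
    using duality[OF coherent1_structure_sheaf, of \<phi>] phi by blast
  have "h \<in> V"
    using h(1) subalgebra_1[OF C_subalgebra] unfolding section_iff by (metis mult.right_neutral)
  then show False using orth h(2) a phi(4) by auto
qed

text \<open>Take \<open>y\<close> to be a polynomial, in a function of \<open>F\<close> without poles over the given points, that
  vanishes to high order on all branches there; by the conductor it lies in the local rings.\<close>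

lemma vanishing_function:
  assumes F: "subextension scale F" and x0: "x0 \<in> F" "x0 \<notin> constants"
    and S: "finite S" "S \<subseteq> closed_points C"
  obtains y where "y \<in> F" "y \<notin> constants" "\<And>P. P \<in> S \<Longrightarrow> y \<in> nonunits P"
proof -
  note Fsub = subextension_subalgebra[OF F]
  define \<L> where "\<L> = (\<Union>P\<in>S. {R. valuation R \<and> P \<subseteq> R})"
  have finL: "finite \<L>" unfolding \<L>_def using S finite_valuations_over by blast
  have val: "valuation L" if "L \<in> \<L>" for L using that by (auto simp: \<L>_def)
  obtain c where c: "c \<noteq> 0" "\<And>L. L \<in> \<L> \<Longrightarrow> 1 + emb c * x0 \<noteq> 0 \<and> inverse (1 + emb c * x0) \<in> L"
  proof (rule pole_free_inverse[OF finL val, of x0])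
    fix c assume "c \<noteq> 0" "\<And>L. L \<in> \<L> \<Longrightarrow> 1 + emb c * x0 \<noteq> 0 \<and> inverse (1 + emb c * x0) \<in> L"
    then show thesis by (rule that)
  qed
  define w where "w = inverse (1 + emb c * x0)"
  have wF: "w \<in> F" unfolding w_def
    using x0(1) by (intro subextension_inverse[OF F] subalgebra_closed[OF Fsub])
  have w: "w \<notin> constants"
  proof -
    have "peval [:1, c:] x0 \<notin> constants" using x0(2) c(1) by (intro peval_degree_nonconstant) auto
    then show ?thesis unfolding w_def by (intro inverse_nonconstant) (simp add: mult.commute)
  qed
  have "\<forall>L. \<exists>r. L \<in> \<L> \<longrightarrow> w - emb r \<in> nonunits L"
    using point_ring_residue[OF valuation_point_ring[OF val]] c(2) unfolding w_def by blast
  then obtain r where r: "\<And>L. L \<in> \<L> \<Longrightarrow> w - emb (r L) \<in> nonunits L" by metis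
  define q where "q = pCons 0 (\<Prod>L\<in>\<L>. [:- r L, 1:])"
  have q: "degree q > 0" using finL by (auto simp: q_def)
  define v where "v = peval q w"
  have v: "v = w * (\<Prod>L\<in>\<L>. w - emb (r L))"
    by (simp add: v_def q_def peval_prod emb_minus)
  have wL: "w \<in> L" if "L \<in> \<L>" for L using c(2)[OF that] by (simp add: w_def)
  have vm: "v \<in> nonunits L" if L: "L \<in> \<L>" for L
  proof -
    note sub = valuation_subalgebra[OF val[OF L]]
    have "v = (w * (\<Prod>L\<in>\<L> - {L}. w - emb (r L))) * (w - emb (r L))"
      using prod.remove[OF finL L, of "\<lambda>L. w - emb (r L)"] by (simp add: v mult_ac)
    then show ?thesis using wL[OF L]
      by (auto intro!: nonunits_mult[OF sub] r L subalgebra_mult[OF sub] subalgebra_prod[OF sub] subalgebra_diff[OF sub] subalgebra_emb[OF sub])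
  qed
  have "\<forall>P. \<exists>z. P \<in> S \<longrightarrow> z \<in> nonunits P \<and> z \<noteq> 0"
    using point_ring_nonunit_exists closed_point_ring S(2) by (metis subsetD)
  then obtain z where z: "\<And>P. P \<in> S \<Longrightarrow> z P \<in> nonunits P" "\<And>P. P \<in> S \<Longrightarrow> z P \<noteq> 0" by metis
  have "\<forall>P L. \<exists>N. L \<in> \<L> \<longrightarrow> (\<forall>n\<ge>N. v ^ n * inverse (z P ^ Suc g) \<in> L)"
  proof (intro allI)
    fix P L show "\<exists>N. L \<in> \<L> \<longrightarrow> (\<forall>n\<ge>N. v ^ n * inverse (z P ^ Suc g) \<in> L)"
    proof (cases "L \<in> \<L>")
      case True
      show ?thesis using nonunit_power_absorbs[OF valuation_point_ring[OF val[OF True]] vm[OF True], of "inverse (z P ^ Suc g)"] by metis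
    qed simp
  qed
  then obtain N where N: "\<And>P L n. L \<in> \<L> \<Longrightarrow> n \<ge> N P L \<Longrightarrow> v ^ n * inverse (z P ^ Suc g) \<in> L" by metis
  define n where "n = Suc (\<Sum>(P,L)\<in>S \<times> \<L>. N P L)"
  have n: "N P L \<le> n" if "P \<in> S" "L \<in> \<L>" for P L
    unfolding n_def using member_le_sum[of "(P,L)" "S \<times> \<L>" "\<lambda>(P,L). N P L"] that S(1) finL by auto
  show ?thesis
  proof (rule that[of "v ^ n"])
    show "v ^ n \<in> F" unfolding v_def using wF by (intro subalgebra_power[OF Fsub] subalgebra_peval[OF Fsub])
    have "v ^ n = peval (q ^ n) w" by (simp add: v_def peval_power)
    moreover have "q \<noteq> 0" using q by auto
    then have "degree (q ^ n) = n * degree q" by (rule degree_power_eq)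
    then have "degree (q ^ n) > 0" using q by (simp add: n_def)
    ultimately show "v ^ n \<notin> constants" using peval_degree_nonconstant[OF w] by metis
    fix P assume P: "P \<in> S"
    then have Pc: "P \<in> closed_points C" using S by blast
    note sub = C_subalgebra[OF closed_point_in_C[OF Pc]]
    have "z P ^ g * (v ^ n * inverse (z P ^ Suc g)) \<in> P"
    proof (rule conductor[OF Pc z(1)[OF P]])
      fix R assume "valuation R" "P \<subseteq> R"
      then have "R \<in> \<L>" using P by (auto simp: \<L>_def)
      then show "v ^ n * inverse (z P ^ Suc g) \<in> R" using N n P by blast
    qed
    then have "(z P ^ g * (v ^ n * inverse (z P ^ Suc g))) * z P \<in> nonunits P"
      using nonunits_mult[OF sub _ z(1)[OF P]] by blast
    moreover have "(z P ^ g * (v ^ n * inverse (z P ^ Suc g))) * z P = v ^ n"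
      using z(2)[OF P] by (simp add: field_simps)
    ultimately show "v ^ n \<in> nonunits P" by (simp only:)
  qed
qed

end

context curve_function_field
begin

text \<open>The partial sums of the power series of \<open>y\<close> in \<open>\<tau>\<close> are in \<open>F\<close>.\<close>

lemma uniformizer_expansion:
  assumes F: "subextension scale F" and P: "valuation P" and \<tau>: "uniformizer P \<tau>" "\<tau> \<in> F" and y: "y \<in> P"
  shows "\<exists>f\<in>F. (y - f) / \<tau> ^ l \<in> P"
proof (induction l)
  case 0
  show ?case using y subalgebra_0[OF subextension_subalgebra[OF F]] by (intro bexI[of _ 0]) auto
next
  case (Suc l)
  note Fsub = subextension_subalgebra[OF F]
  have t0: "\<tau> \<noteq> 0" using \<tau>(1) by (simp add: uniformizer_def)
  obtain f where f: "f \<in> F" "(y - f) / \<tau> ^ l \<in> P" using Suc by blast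
  obtain c where "(y - f) / \<tau> ^ l - emb c \<in> nonunits P" using f(2) point_ring_residue[OF valuation_point_ring[OF P]] by blast
  then have "((y - f) / \<tau> ^ l - emb c) / \<tau> \<in> P" using \<tau>(1) by (simp add: uniformizer_def)
  moreover have "((y - f) / \<tau> ^ l - emb c) / \<tau> = (y - (f + emb c * \<tau> ^ l)) / \<tau> ^ Suc l"
    using t0 by (simp add: field_simps)
  moreover have "f + emb c * \<tau> ^ l \<in> F"
    using f(1) \<tau>(2) by (intro subalgebra_add[OF Fsub] subalgebra_mult[OF Fsub] subalgebra_emb[OF Fsub] subalgebra_power[OF Fsub])
  ultimately show ?case by auto
qed

text \<open>Where \<open>F\<close> contains uniformizers, its elements approximate \<open>y\<close> at each point; approximation in
  \<open>F\<close> combines these, since the valuation rings have different traces on \<open>F\<close>.\<close>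

lemma subfield_approximation:
  assumes F: "subextension scale F" and B: "finite B" "\<And>P. P \<in> B \<Longrightarrow> valuation P"
    and inj: "inj_on (\<lambda>P. P \<inter> F) B" and \<tau>: "\<And>P. P \<in> B \<Longrightarrow> \<exists>\<tau>\<in>F. uniformizer P \<tau>"
    and y: "\<And>P. P \<in> B \<Longrightarrow> y \<in> P"
  shows "\<exists>f\<in>F. \<forall>P\<in>B. (y - f) / b \<in> P"
proof -
  note Fsub = subextension_subalgebra[OF F]
  have "\<exists>f\<in>F. (y - f) / b \<in> P" if P: "P \<in> B" for P
  proof -
    note sub = valuation_subalgebra[OF B(2)[OF P]]
    obtain \<tau> where t: "\<tau> \<in> F" "uniformizer P \<tau>" using \<tau>[OF P] by blast
    then have tm: "\<tau> \<in> nonunits P" "\<tau> \<noteq> 0" by (auto simp: uniformizer_def)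
    obtain N where N: "\<tau> ^ N * inverse b \<in> P"
      using nonunit_power_absorbs[OF valuation_point_ring[OF B(2)[OF P]] tm(1), of "inverse b"] by blast
    obtain f where f: "f \<in> F" "(y - f) / \<tau> ^ N \<in> P"
      using uniformizer_expansion[OF F B(2)[OF P] t(2,1) y[OF P], of N] by blast
    have "(y - f) / \<tau> ^ N * (\<tau> ^ N * inverse b) \<in> P" using subalgebra_mult[OF sub f(2) N] .
    moreover have "(y - f) / \<tau> ^ N * (\<tau> ^ N * inverse b) = (y - f) / b" using tm(2) by (simp add: divide_inverse)
    ultimately show ?thesis using f(1) by auto
  qed
  then obtain f where f: "\<And>P. P \<in> B \<Longrightarrow> f P \<in> F" "\<And>P. P \<in> B \<Longrightarrow> (y - f P) / b \<in> P" by metis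
  have "\<exists>e\<in>F. (e - 1) * f P / b \<in> P \<and> (\<forall>Q\<in>B - {P}. e * f P / b \<in> Q)" if P: "P \<in> B" for P
  proof (rule valuation_approximation[OF F B(1,2) inj P, of "b / f P"])
    fix e assume "e \<in> F" "(e - 1) / (b / f P) \<in> P" "\<And>L. L \<in> B - {P} \<Longrightarrow> e / (b / f P) \<in> L"
    then show ?thesis by (intro bexI[of _ e]) auto
  qed
  then obtain e where e: "\<And>P. P \<in> B \<Longrightarrow> e P \<in> F" "\<And>P. P \<in> B \<Longrightarrow> (e P - 1) * f P / b \<in> P"
    "\<And>P Q. P \<in> B \<Longrightarrow> Q \<in> B - {P} \<Longrightarrow> e P * f P / b \<in> Q" by metis
  define h where "h = (\<Sum>P\<in>B. e P * f P)"
  have "h \<in> F" unfolding h_def using e(1) f(1) by (intro subalgebra_sum[OF Fsub] subalgebra_mult[OF Fsub])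
  moreover have "(y - h) / b \<in> P" if P: "P \<in> B" for P
  proof -
    note sub = valuation_subalgebra[OF B(2)[OF P]]
    have "h = e P * f P + (\<Sum>Q\<in>B - {P}. e Q * f Q)" unfolding h_def using B(1) P by (rule sum.remove)
    then have "(y - h) / b = (y - f P) / b - (e P - 1) * f P / b - (\<Sum>Q\<in>B - {P}. e Q * f Q / b)"
      by (simp add: diff_divide_distrib add_divide_distrib sum_divide_distrib algebra_simps)
    also have "\<dots> \<in> P"
      using e f P by (intro subalgebra_diff[OF sub] subalgebra_sum[OF sub]) auto
    finally show ?thesis .
  qed
  ultimately show ?thesis by blast
qed

end

context complete_curve
begin

text \<open>A subfield that is dense at the poles of \<open>x\<close> is everything: elements of \<open>F\<close> that form a basis
  modulo \<open>1/x\<close> show \<open>[K : k(x)] \<le> [F : k(x)]\<close>.  Hence over a proper subfield some pole of \<open>x\<close> is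
  ramified or two poles have the same trace.\<close>

lemma no_unramified_subfield:
  assumes F: "subextension scale F" "F \<noteq> UNIV" and x: "x \<in> F" "x \<notin> constants"
    and val: "\<And>P. P \<in> C \<Longrightarrow> x \<notin> P \<Longrightarrow> valuation P"
    and distinct: "\<And>P Q. P \<in> C \<Longrightarrow> x \<notin> P \<Longrightarrow> Q \<in> C \<Longrightarrow> x \<notin> Q \<Longrightarrow> P \<inter> F = Q \<inter> F \<Longrightarrow> P = Q"
    and unram: "\<And>P. P \<in> C \<Longrightarrow> x \<notin> P \<Longrightarrow> \<exists>\<tau>\<in>F. uniformizer P \<tau>"
  shows False
proof -
  let ?J = "polar_ring x" and ?E = "subextension scale hull {x}"
  note Fsub = subextension_subalgebra[OF F(1)]
  note Jsub = polar_ring_subalgebra[of x]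
  define b where "b = inverse x"
  have b0: "b \<noteq> 0" using nonconstant_nonzero[OF x(2)] by (simp add: b_def)

  have bJ: "b \<in> ?J" unfolding b_def polar_ring_iff using valuation_cases[OF val] by blast
  define B where "B = {P \<in> C. x \<notin> P}"
  have dense: "\<exists>f\<in>F \<inter> ?J. \<exists>z\<in>?J. y = f + b * z" if y: "y \<in> ?J" for y
  proof -
    have "\<exists>f\<in>F. \<forall>P\<in>B. (y - f) / b \<in> P"
    proof (rule subfield_approximation[OF F(1)])
      show "finite B" unfolding B_def by (rule finite_poles)
      show "inj_on (\<lambda>P. P \<inter> F) B" using distinct by (auto simp: B_def inj_on_def)
    qed (use val unram y in \<open>auto simp: B_def polar_ring_iff\<close>)
    then obtain f where f: "f \<in> F" "\<forall>P\<in>B. (y - f) / b \<in> P" by blast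
    define z where "z = (y - f) / b"
    have z: "z \<in> ?J" using f(2) by (simp add: z_def polar_ring_iff B_def)
    have eq: "y = f + b * z" using b0 by (simp add: z_def)
    have "y - b * z \<in> ?J" using y subalgebra_mult[OF Jsub bJ z] by (rule subalgebra_diff[OF Jsub])
    then have "f \<in> ?J" using eq by simp
    then show ?thesis using f(1) z eq by blast
  qed
  \<comment> \<open>such sequences have at most \<open>[K : k(b)]\<close> members, and a longest one spans modulo \<open>b\<close>\<close>
  define ind where "ind m u \<longleftrightarrow> (\<forall>j<m. u j \<in> F \<inter> ?J) \<and>
     (\<forall>c. \<forall>z\<in>?J. (\<Sum>j<m. emb (c j) * u j) = b * z \<longrightarrow> (\<forall>j<m. c j = 0))" for m and u :: "nat \<Rightarrow> 'a"
  obtain N where N: "dep_bound b N" using dep_bound_exists inverse_nonconstant[OF x(2)] unfolding b_def by blast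
  have bound: "m \<le> N" if "ind m u" for m u
  proof (rule ccontr)
    assume mN: "\<not> m \<le> N"
    have "u j \<in> ?J" if "j \<le> N" for j using \<open>ind m u\<close> mN that by (auto simp: ind_def)
    then obtain c z where c: "\<exists>j\<le>N. c j \<noteq> 0" "z \<in> ?J" "(\<Sum>j\<le>N. emb (c j) * u j) = b * z"
      using dep_bound_mod[OF N b0 subalgebra_subspace[OF Jsub] subalgebra_mult[OF Jsub bJ], of u] by blast
    define c' where "c' j = (if j \<le> N then c j else 0)" for j
    have "(\<Sum>j<m. emb (c' j) * u j) = (\<Sum>j\<le>N. emb (c' j) * u j)"
      using mN by (intro sum.mono_neutral_right) (auto simp: c'_def)
    also have "\<dots> = (\<Sum>j\<le>N. emb (c j) * u j)" by (intro sum.cong) (auto simp: c'_def)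
    finally have "(\<Sum>j<m. emb (c' j) * u j) = b * z" using c(3) by simp
    then have "\<forall>j<m. c' j = 0" using \<open>ind m u\<close> c(2) unfolding ind_def by blast
    moreover obtain j where j: "j \<le> N" "c j \<noteq> 0" using c(1) by blast
    ultimately have "c' j = 0" using mN by simp
    then show False using j by (simp add: c'_def)
  qed
  have "{m. \<exists>u. ind m u} \<subseteq> {..N}" using bound by blast
  then have fin: "finite {m. \<exists>u. ind m u}" by (rule finite_subset) simp
  have "ind 0 (\<lambda>_. 0)" by (simp add: ind_def)
  then have ne: "{m. \<exists>u. ind m u} \<noteq> {}" by blast
  define r where "r = Max {m. \<exists>u. ind m u}"
  have "r \<in> {m. \<exists>u. ind m u}" unfolding r_def using fin ne by (rule Max_in)
  then obtain u where u: "ind r u" by blast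
  have uF: "u j \<in> F" "u j \<in> ?J" if "j < r" for j using u that by (auto simp: ind_def)
  have uind: "\<forall>j<r. c j = 0" if "z \<in> ?J" "(\<Sum>j<r. emb (c j) * u j) = b * z" for c z
    using u that unfolding ind_def by blast
  have rmax: "\<not> ind (Suc r) v" for v
  proof
    assume "ind (Suc r) v"
    then have "Suc r \<le> r" unfolding r_def using fin by (intro Max_ge) auto
    then show False by simp
  qed
  have gen: "\<exists>c. \<exists>z\<in>?J. y = (\<Sum>l<r. emb (c l) * u l) + b * z" if y: "y \<in> ?J" for y
  proof -
    obtain f z where f: "f \<in> F" "f \<in> ?J" "z \<in> ?J" "y = f + b * z" using dense[OF y] by blast
    define v where "v = u(r := f)"
    have "\<forall>j<Suc r. v j \<in> F \<inter> ?J" using f uF by (auto simp: v_def less_Suc_eq)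
    then obtain c z' j where c: "z' \<in> ?J" "(\<Sum>j<Suc r. emb (c j) * v j) = b * z'" "j < Suc r" "c j \<noteq> 0"
      using rmax[of v] unfolding ind_def by blast
    have rel: "(\<Sum>j<r. emb (c j) * u j) + emb (c r) * f = b * z'"
      using c(2) by (simp add: v_def)
    have cr: "c r \<noteq> 0"
    proof
      assume cr: "c r = 0"
      then have "\<forall>j<r. c j = 0" using rel by (intro uind[OF c(1)]) simp
      then show False using c(3,4) cr by (auto simp: less_Suc_eq)
    qed
    have "emb (c r) * f = b * z' - (\<Sum>j<r. emb (c j) * u j)" using rel by (simp add: algebra_simps)
    then have "emb (inverse (c r)) * (emb (c r) * f) = emb (inverse (c r)) * (b * z' - (\<Sum>j<r. emb (c j) * u j))" by simp
    moreover have "emb (inverse (c r)) * (emb (c r) * f) = f" using cr by (simp add: emb_inverse flip: mult.assoc)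
    ultimately have "f = emb (inverse (c r)) * (b * z' - (\<Sum>j<r. emb (c j) * u j))" by (simp only:)
    then have "f = (\<Sum>j<r. emb (- (inverse (c r) * c j)) * u j) + b * (emb (inverse (c r)) * z')"
      by (simp add: emb_minus emb_mult right_diff_distrib sum_distrib_left sum_negf mult_ac)
    then have "y = (\<Sum>j<r. emb (- (inverse (c r) * c j)) * u j) + b * (emb (inverse (c r)) * z' + z)"
      unfolding f(4) by (simp add: distrib_left)
    moreover have "emb (inverse (c r)) * z' + z \<in> ?J"
      using c(1) f(3) by (intro subalgebra_add[OF Jsub] subalgebra_mult[OF Jsub] subalgebra_emb[OF Jsub])
    ultimately show ?thesis by (intro exI[of _ "\<lambda>j. - (inverse (c r) * c j)"] bexI)
  qed
  have dep: "dep_bound x r" by (rule dep_bound_from_residues[OF x(2) val gen[unfolded b_def]])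
  have r0: "r > 0"
  proof (rule ccontr)
    assume "\<not> r > 0"
    then obtain z where z: "z \<in> ?J" "1 = b * z" using gen[OF subalgebra_1[OF Jsub]] by auto
    obtain P where P: "P \<in> closed_points C" "x \<notin> P" using pole_exists[OF x(2)] .
    note PC = closed_point_in_C[OF P(1)]
    note sub = C_subalgebra[OF PC]
    have "b \<in> nonunits P" unfolding b_def using P(2) PC valuation_cases[OF val[OF PC P(2)], of x] by (intro inverse_nonunit) auto
    moreover have "z \<in> P" using z(1) PC P(2) by (simp add: polar_ring_iff)
    ultimately have "z * b \<in> nonunits P" by (intro nonunits_mult[OF sub])
    then show False using z(2) one_not_nonunit[OF sub] by (simp add: mult.commute)
  qed
  have u0: "u 0 \<noteq> 0"
  proof
    assume z: "u 0 = 0"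
    have "(\<Sum>j<r. emb (if j = 0 then 1 else 0) * u j) = b * 0" using z by (intro trans[OF sum.neutral]) auto
    from uind[OF subalgebra_0[OF Jsub] this] show False using r0 by auto
  qed
  obtain e where e: "e \<notin> F" using F(2) by blast
  obtain p where p: "\<exists>j\<le>r. p j \<noteq> 0" "(\<Sum>j\<le>r. peval (p j) x * (if j = r then e * u 0 else u j)) = 0"
    using dep[unfolded dep_bound_def, rule_format, of "\<lambda>j. if j = r then e * u 0 else u j"] by blast
  have rel: "(\<Sum>j<r. peval (p j) x * u j) + peval (p r) x * (e * u 0) = 0"
    using p(2) by (simp add: lessThan_Suc_atMost[symmetric])
  have pF: "peval (p j) x \<in> F" for j using subalgebra_peval[OF Fsub x(1)] .
  have pr: "peval (p r) x = 0"
  proof (rule ccontr)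
    assume pr: "peval (p r) x \<noteq> 0"
    have "peval (p r) x * u 0 * e = - (\<Sum>j<r. peval (p j) x * u j)"
      using rel by (simp add: eq_neg_iff_add_eq_0 algebra_simps)
    then have "e = - (\<Sum>j<r. peval (p j) x * u j) / (peval (p r) x * u 0)"
      using pr u0 by (metis mult_eq_0_iff nonzero_mult_div_cancel_left)
    also have "\<dots> \<in> F"
      using pF uF r0 by (intro subextension_divide[OF F(1)] subalgebra_uminus[OF Fsub] subalgebra_sum[OF Fsub] subalgebra_mult[OF Fsub]) auto
    finally show False using e by blast
  qed
  have "\<forall>j\<in>{..<r}. peval (p j) x = 0"
  proof (rule independent_from_residues[OF x(2) val, where u = u])
    show "\<forall>j\<in>{..<r}. c j = 0" if "y \<in> ?J" "(\<Sum>j<r. emb (c j) * u j) = inverse x * y" for c y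
      using uind[of y c] that by (simp add: b_def)
    show "peval (p j) x \<in> ?E" for j
      by (intro subalgebra_peval[OF subextension_subalgebra[OF subextension_hull]] hull_inc) simp
    show "(\<Sum>j<r. peval (p j) x * u j) = 0" using rel pr by simp
  qed (use uF in auto)
  then have "p j = 0" if "j \<le> r" for j
    using that pr by (cases "j = r") (auto simp: peval_eq_0_iff[OF x(2)])
  then show False using p(1) by blast
qed

end

context dualized_curve
begin

text \<open>By global generation, the condition on the quotients says that \<open>s 0\<close> generates \<open>\<omega>\<close> at \<open>P\<close>.\<close>

definition good_point :: "'a set \<Rightarrow> bool" where
  "good_point P \<longleftrightarrow> P \<in> closed_points C \<and> valuation P \<and> (\<forall>i<g. s i / s 0 \<in> P)"

lemma s0: "s 0 \<noteq> 0" "s 0 \<in> V"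
  using s_nonzero[of 0] s_in_V[of 0] genus_ge_2 by auto

lemma good_point_omega:
  assumes "good_point P"
  shows "h \<in> \<omega> P \<longleftrightarrow> h / s 0 \<in> P"
proof -
  have P: "P \<in> closed_points C" "\<And>i. i < g \<Longrightarrow> s i / s 0 \<in> P" using assms by (auto simp: good_point_def)
  note sub = C_subalgebra[OF closed_point_in_C[OF P(1)]]
  have "is_submodule P {h. h / s 0 \<in> P}"
    unfolding is_submodule_def using subalgebra_0[OF sub] subalgebra_add[OF sub] subalgebra_mult[OF sub]
    by (auto simp: add_divide_distrib simp flip: times_divide_eq_right)
  then have "\<omega> P \<subseteq> {h. h / s 0 \<in> P}"
    unfolding globally_generated[OF P(1)] using P(2) by (intro generated_module_least) auto
  moreover have "h \<in> \<omega> P" if "h / s 0 \<in> P"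
  proof -
    have "s 0 \<in> \<omega> P" using s0(2) section_iff closed_point_in_C[OF P(1)] by blast
    then have "h / s 0 * s 0 \<in> \<omega> P" using submodule_mult[OF omega_submodule'[OF P(1)] that] by blast
    then show ?thesis using s0(1) by simp
  qed
  ultimately show ?thesis by blast
qed

lemma section_ratio_in_model_field:
  assumes "h \<in> V"
  shows "h / s 0 \<in> model_field"
proof -
  obtain a where a: "h = (\<Sum>l<g. emb (a l) * s l)" using V_coordinates[OF assms] .
  note sub = subextension_subalgebra[OF model_field(1)]
  have "h / s 0 = (\<Sum>l<g. emb (a l) * (s l / s 0))" by (simp add: a sum_divide_distrib)
  also have "\<dots> \<in> model_field"
    using model_field(2) genus_ge_2 by (intro subalgebra_sum[OF sub] subalgebra_mult[OF sub] subalgebra_emb[OF sub]) auto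
  finally show ?thesis .
qed

text \<open>If \<open>h/\<pi>\<close> has residue \<open>0\<close>, so do all its multiples by elements of \<open>P\<close>, because \<open>h\<close> has no
  residue; local duality then applies.\<close>

lemma section_vanishes_if_residue_zero:
  assumes P: "good_point P" and pi: "uniformizer P \<pi>" and h: "h \<in> V" and res: "residue P (h / \<pi>) = 0"
  shows "h / s 0 \<in> nonunits P"
proof -
  have Pc: "P \<in> closed_points C" and v: "valuation P" using P by (auto simp: good_point_def)
  note sub = valuation_subalgebra[OF v]
  have pm: "\<pi> \<in> nonunits P" "\<pi> \<noteq> 0" using pi by (auto simp: uniformizer_def)
  have hP: "h \<in> \<omega> P" using h section_iff closed_point_in_C[OF Pc] by blast
  have "h / \<pi> \<in> \<omega> P"
  proof (rule local_duality[OF Pc])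
    fix c assume "c \<in> P"
    then obtain c0 where c0: "c - emb c0 \<in> nonunits P" using point_ring_residue[OF valuation_point_ring[OF v]] by blast
    then have "(c - emb c0) / \<pi> \<in> P" using pi by (simp add: uniformizer_def)
    then have "(c - emb c0) / \<pi> * h \<in> \<omega> P" using submodule_mult[OF omega_submodule'[OF Pc] _ hP] by blast
    moreover have "c * (h / \<pi>) = emb c0 * (h / \<pi>) + (c - emb c0) / \<pi> * h" using pm(2) by (simp add: field_simps)
    ultimately show "residue P (c * (h / \<pi>)) = 0"
      using residue_add[OF Pc, of "emb c0 * (h / \<pi>)"] residue_emb[OF Pc, of c0 "h / \<pi>"] residue_regular[OF Pc] res
      by (simp only: add_0_right mult_zero_right)
  qed
  then have "h / \<pi> / s 0 \<in> P" using good_point_omega[OF P] by blast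
  then have "h / \<pi> / s 0 * \<pi> \<in> nonunits P" using nonunits_mult[OF sub _ pm(1)] by blast
  then show ?thesis using pm(2) by simp
qed

text \<open>If every section that vanishes at \<open>P\<close> satisfies a second condition, given by the residue of
  \<open>h/q\<close> at \<open>Q\<close>, then the two conditions are proportional.  The corresponding combination of polar
  parts is orthogonal to \<open>V\<close>, so by duality a function has exactly these polar parts.\<close>

lemma function_with_polar_parts:
  assumes P: "good_point P" and pi: "uniformizer P \<pi>" and Q: "good_point Q"
    and imp: "\<And>h. h \<in> V \<Longrightarrow> h / s 0 \<in> nonunits P \<Longrightarrow> h / s 0 / q \<in> Q"
  obtains x c where "residue Q (s 0 / q) = c * residue P (s 0 / \<pi>)"
    "\<And>R. R \<in> closed_points C \<Longrightarrow> skyscraper Q (1 / q) R - emb c * skyscraper P (1 / \<pi>) R - x \<in> R"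
proof -
  have Pc: "P \<in> closed_points C" and Qc: "Q \<in> closed_points C" and v: "valuation P" using P Q by (auto simp: good_point_def)
  define c where "c = residue Q (s 0 / q) / residue P (s 0 / \<pi>)"
  have rP: "residue P (s 0 / \<pi>) \<noteq> 0"
  proof
    assume "residue P (s 0 / \<pi>) = 0"
    then have "s 0 / s 0 \<in> nonunits P" using section_vanishes_if_residue_zero[OF P pi s0(2)] by blast
    then show False using s0(1) one_not_nonunit[OF valuation_subalgebra[OF v]] by simp
  qed
  have proportional: "residue Q (h / q) = c * residue P (h / \<pi>)" if h: "h \<in> V" for h
  proof -
    define a where "a = residue P (h / \<pi>) / residue P (s 0 / \<pi>)"
    define h' where "h' = h - emb a * s 0"
    have h'V: "h' \<in> V" unfolding h'_def using h s0(2) by (intro subspace_diff[OF V_subspace]) (auto simp: scale_eq[symmetric] intro: subspace_scale[OF V_subspace])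
    have eq: "h' / z = h / z - emb a * (s 0 / z)" for z by (simp add: h'_def diff_divide_distrib)
    have "residue P (h' / \<pi>) = 0"
      unfolding eq residue_diff[OF Pc] residue_emb[OF Pc] using rP by (simp add: a_def)
    then have "h' / s 0 / q \<in> Q" using imp[OF h'V] section_vanishes_if_residue_zero[OF P pi h'V] by blast
    then have "h' / q \<in> \<omega> Q" using good_point_omega[OF Q, of "h' / q"] by (simp add: divide_divide_eq_left mult.commute)
    then have "residue Q (h' / q) = 0" by (rule residue_regular[OF Qc])
    then have "residue Q (h / q) = a * residue Q (s 0 / q)"
      unfolding eq residue_diff[OF Qc] residue_emb[OF Qc] by simp
    then show ?thesis by (simp add: a_def c_def)
  qed
  define a where "a R = skyscraper Q (1 / q) R - emb c * skyscraper P (1 / \<pi>) R" for R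
  have aa: "a \<in> adeles1" unfolding a_def
    by (intro adeles1_diff adeles1_mult adeles1_skyscraper Pc Qc)
  have "trace (\<lambda>R. h * a R) = 0" if h: "h \<in> V" for h
  proof -
    have "(\<lambda>R. h * a R) = (\<lambda>R. skyscraper Q (h / q) R - emb c * skyscraper P (h / \<pi>) R)"
      by (auto simp: a_def skyscraper_def algebra_simps)
    then have "trace (\<lambda>R. h * a R) = residue Q (h / q) - c * residue P (h / \<pi>)"
      using trace_diff[OF adeles1_skyscraper[OF Qc] adeles1_mult[OF adeles1_skyscraper[OF Pc]]]
        trace_emb[OF adeles1_skyscraper[OF Pc]] by (simp add: residue_def)
    then show ?thesis using proportional[OF h] by simp
  qed
  then have "a \<in> cob1 (\<lambda>P. P)" by (rule coboundary_if_orthogonal[OF aa])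
  then obtain x where "\<And>R. R \<in> closed_points C \<Longrightarrow> a R - x \<in> R" unfolding cob1_def by blast
  then show ?thesis using that[of c x] proportional[OF s0(2)] by (simp add: a_def)
qed

lemma simple_pole:
  assumes P: "valuation P" and pi: "uniformizer P \<pi>" and c: "c \<noteq> 0" and x: "emb c / \<pi> - x \<in> P"
  shows "x \<notin> P" "y \<in> nonunits P \<Longrightarrow> x * y \<in> P"
proof -
  note sub = valuation_subalgebra[OF P]
  have pm: "\<pi> \<in> nonunits P" "\<pi> \<noteq> 0" using pi by (auto simp: uniformizer_def)
  show "x \<notin> P"
  proof
    assume "x \<in> P"
    then have "emb c / \<pi> - x + x \<in> P" using x by (intro subalgebra_add[OF sub])
    then have "emb c / \<pi> \<in> P" by simp
    then have "emb c / \<pi> * \<pi> \<in> nonunits P" by (rule nonunits_mult[OF sub _ pm(1)])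
    then show False using pm(2) c nonunits_emb[OF sub] by simp
  qed
  assume y: "y \<in> nonunits P"
  then have "y / \<pi> \<in> P" "y \<in> P" using pi nonunits_subset by (auto simp: uniformizer_def)
  then have "emb c * (y / \<pi>) - (emb c / \<pi> - x) * y \<in> P"
    using subalgebra_diff[OF sub subalgebra_mult[OF sub subalgebra_emb[OF sub]] subalgebra_mult[OF sub x]] by blast
  then show "x * y \<in> P" by (simp add: algebra_simps)
qed

text \<open>Two points that the canonical map identifies are the simple poles of a function.\<close>

lemma hyperelliptic_if_points_identified:
  assumes P: "good_point P" and Q: "good_point Q" and ne: "P \<noteq> Q" and tr: "P \<inter> model_field = Q \<inter> model_field"
  shows "hyperelliptic scale C"
proof -
  have Pc: "P \<in> closed_points C" and v: "valuation P" and Qc: "Q \<in> closed_points C" and w: "valuation Q"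
    using P Q by (auto simp: good_point_def)
  note subP = valuation_subalgebra[OF v] and subQ = valuation_subalgebra[OF w]
  note prP = valuation_point_ring[OF v] and prQ = valuation_point_ring[OF w]
  obtain \<pi> where pi: "uniformizer P \<pi>" using uniformizer_exists[OF v] .
  obtain \<rho> where rho: "uniformizer Q \<rho>" using uniformizer_exists[OF w] .
  have "h / s 0 / \<rho> \<in> Q" if h: "h \<in> V" "h / s 0 \<in> nonunits P" for h
  proof -
    have F: "h / s 0 \<in> model_field" "inverse (h / s 0) \<in> model_field"
      using section_ratio_in_model_field[OF h(1)] subextension_inverse[OF model_field(1)] by blast+
    have "h / s 0 \<in> nonunits Q" using h(2) F tr unfolding nonunits_iff by blast
    then show ?thesis using rho unfolding uniformizer_def by blast
  qed
  note vanish = this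
  obtain x c where c: "residue Q (s 0 / \<rho>) = c * residue P (s 0 / \<pi>)"
    and x: "\<And>R. R \<in> closed_points C \<Longrightarrow> skyscraper Q (1 / \<rho>) R - emb c * skyscraper P (1 / \<pi>) R - x \<in> R"
  proof (rule function_with_polar_parts[OF P pi Q, of \<rho>])
    show "h / s 0 / \<rho> \<in> Q" if "h \<in> V" "h / s 0 \<in> nonunits P" for h using vanish that .
    fix x c assume "residue Q (s 0 / \<rho>) = c * residue P (s 0 / \<pi>)"
      "\<And>R. R \<in> closed_points C \<Longrightarrow> skyscraper Q (1 / \<rho>) R - emb c * skyscraper P (1 / \<pi>) R - x \<in> R"
    then show thesis by (rule that)
  qed
  have "residue Q (s 0 / \<rho>) \<noteq> 0"
  proof
    assume "residue Q (s 0 / \<rho>) = 0"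
    then have "s 0 / s 0 \<in> nonunits Q" using section_vanishes_if_residue_zero[OF Q rho s0(2)] by blast
    then show False using s0(1) one_not_nonunit[OF subQ] by simp
  qed
  then have c0: "- c \<noteq> 0" using c by auto
  have xP: "emb (- c) / \<pi> - x \<in> P" using x[OF Pc] ne by (simp add: skyscraper_def emb_minus)
  have xQ: "emb 1 / \<rho> - x \<in> Q" using x[OF Qc] ne by (simp add: skyscraper_def)
  note poleP = simple_pole[OF v pi c0 xP] and poleQ = simple_pole[OF w rho one_neq_zero xQ]
  have reg: "x \<in> R" if R: "R \<in> C" "R \<noteq> P" "R \<noteq> Q" for R
  proof (cases "R = UNIV")
    case False
    then have Rc: "R \<in> closed_points C" using R(1) by (simp add: closed_points_def)
    then have "- x \<in> R" using x[OF Rc] R by (simp add: skyscraper_def)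
    then have "- (- x) \<in> R" by (rule subalgebra_uminus[OF C_subalgebra[OF R(1)]])
    then show ?thesis by simp
  qed simp
  have J: "y \<in> polar_ring x \<longleftrightarrow> y \<in> P \<and> y \<in> Q" for y
    unfolding polar_ring_iff using reg poleP(1) poleQ(1) closed_point_in_C Pc Qc by blast
  have xnc: "x \<notin> constants" using poleP(1) subalgebra_emb[OF subP] by (auto simp: constants_iff)
  have x0: "x \<noteq> 0" using nonconstant_nonzero[OF xnc] .
  have bP: "inverse x \<in> nonunits P" and bQ: "inverse x \<in> nonunits Q"
    using poleP(1) poleQ(1) valuation_cases[OF v, of x] valuation_cases[OF w, of x] x0 by (auto simp: nonunits_iff)
  obtain u where u: "u - 1 \<in> nonunits P" "u \<in> nonunits Q"
  proof (rule separating_element[OF subextension_UNIV, of "{Q}" P])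
    fix u assume "u - 1 \<in> nonunits P" "\<And>L. L \<in> {Q} \<Longrightarrow> u \<in> nonunits L"
    then show thesis using that by blast
  qed (use v w ne in auto)
  have uP: "u \<in> P" using subalgebra_add[OF subP, of "u - 1" 1] u(1) nonunits_subset[of P] subalgebra_1[OF subP] by auto
  have uQ: "u \<in> Q" using u(2) nonunits_subset by blast
  show ?thesis
  proof (rule hyperelliptic_if_residue_degree_two[OF xnc])
    show "valuation R" if "R \<in> C" "x \<notin> R" for R using reg[OF that(1)] that(2) v w by blast
    show "u \<in> polar_ring x" using uP uQ J by blast
    show "\<exists>c d. \<exists>z\<in>polar_ring x. y = emb c + emb d * u + inverse x * z" if y: "y \<in> polar_ring x" for y
    proof -
      have yPQ: "y \<in> P" "y \<in> Q" using y J by auto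
      obtain a where a: "y - emb a \<in> nonunits Q" using point_ring_residue[OF prQ yPQ(2)] by blast
      have "y - emb a \<in> P" using yPQ(1) by (intro subalgebra_diff[OF subP] subalgebra_emb[OF subP])
      then obtain d where d: "y - emb a - emb d \<in> nonunits P" using point_ring_residue[OF prP] by blast
      define m where "m = y - emb a - emb d * u"
      have "m = (y - emb a - emb d) - emb d * (u - 1)" by (simp add: m_def algebra_simps)
      then have mP: "m \<in> nonunits P"
        using point_ring_diff[OF prP d nonunits_mult[OF subP subalgebra_emb[OF subP] u(1)]] by simp
      have mQ: "m \<in> nonunits Q" unfolding m_def
        using point_ring_diff[OF prQ a nonunits_mult[OF subQ subalgebra_emb[OF subQ] u(2)]] .
      have "x * m \<in> polar_ring x" using poleP(2)[OF mP] poleQ(2)[OF mQ] J by blast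
      moreover have "y = emb a + emb d * u + inverse x * (x * m)" using x0 by (simp add: m_def flip: mult.assoc)
      ultimately show ?thesis by blast
    qed
    show "u \<noteq> emb d + inverse x * z" if "z \<in> polar_ring x" for d z
    proof
      assume eq: "u = emb d + inverse x * z"
      have zP: "z * inverse x \<in> nonunits P" and zQ: "z * inverse x \<in> nonunits Q"
        using that J bP bQ by (auto intro: nonunits_mult[OF subP] nonunits_mult[OF subQ])
      have "emb d = u - z * inverse x" using eq by (simp add: mult.commute)
      then have "emb d \<in> nonunits Q" using point_ring_diff[OF prQ u(2) zQ] by simp
      then have "d = 0" using nonunits_emb[OF subQ] by blast
      then have "1 = z * inverse x - (u - 1)" using eq by (simp add: mult.commute)
      then have "1 \<in> nonunits P" using point_ring_diff[OF prP zP u(1)] by simp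
      then show False using one_not_nonunit[OF subP] by blast
    qed
  qed
qed

text \<open>A point at which the canonical map is ramified is the double pole of a function.\<close>

lemma hyperelliptic_if_ramified:
  assumes P: "good_point P" and pi: "uniformizer P \<pi>"
    and ram: "\<And>y. y \<in> model_field \<Longrightarrow> y \<in> nonunits P \<Longrightarrow> y / \<pi>\<^sup>2 \<in> P"
  shows "hyperelliptic scale C"
proof -
  have Pc: "P \<in> closed_points C" and v: "valuation P" using P by (auto simp: good_point_def)
  note sub = valuation_subalgebra[OF v]
  note pr = valuation_point_ring[OF v]
  have pm: "\<pi> \<in> nonunits P" "\<pi> \<noteq> 0" using pi by (auto simp: uniformizer_def)
  have pP: "\<pi> \<in> P" using pm(1) nonunits_subset by blast
  obtain x c where x: "\<And>R. R \<in> closed_points C \<Longrightarrow> skyscraper P (1 / \<pi>\<^sup>2) R - emb c * skyscraper P (1 / \<pi>) R - x \<in> R"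
  proof (rule function_with_polar_parts[OF P pi P, of "\<pi>\<^sup>2"])
    show "h / s 0 / \<pi>\<^sup>2 \<in> P" if "h \<in> V" "h / s 0 \<in> nonunits P" for h
      using ram[OF section_ratio_in_model_field] that by blast
    fix x c assume "\<And>R. R \<in> closed_points C \<Longrightarrow> skyscraper P (1 / \<pi>\<^sup>2) R - emb c * skyscraper P (1 / \<pi>) R - x \<in> R"
    then show thesis by (rule that)
  qed
  define v0 where "v0 = 1 / \<pi>\<^sup>2 - emb c / \<pi> - x"
  have v0: "v0 \<in> P" using x[OF Pc] by (simp add: v0_def skyscraper_def)
  have xv: "x = 1 / \<pi>\<^sup>2 - emb c / \<pi> - v0" by (simp add: v0_def)
  have xpi: "x * \<pi> = 1 / \<pi> - emb c - v0 * \<pi>"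
    using pm(2) unfolding xv by (simp add: left_diff_distrib power2_eq_square)
  have xpi2: "x * \<pi>\<^sup>2 = 1 - emb c * \<pi> - v0 * \<pi>\<^sup>2"
    using pm(2) unfolding xv by (simp add: left_diff_distrib power2_eq_square)
  have npi: "1 / \<pi> \<notin> P" using pm by (simp add: nonunits_iff divide_inverse)
  have xpi_out: "x * \<pi> \<notin> P"
  proof
    assume "x * \<pi> \<in> P"
    then have "x * \<pi> + emb c + v0 * \<pi> \<in> P"
      using v0 pP by (intro subalgebra_add[OF sub] subalgebra_mult[OF sub v0] subalgebra_emb[OF sub])
    then show False using npi xpi by simp
  qed
  have xP: "x \<notin> P" using xpi_out subalgebra_mult[OF sub _ pP] by blast
  have xpi2_in: "x * \<pi>\<^sup>2 \<in> P" unfolding xpi2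
    using v0 pP by (intro subalgebra_diff[OF sub] subalgebra_mult[OF sub] subalgebra_emb[OF sub] subalgebra_1[OF sub] subalgebra_power[OF sub])
  have reg: "x \<in> R" if R: "R \<in> C" "R \<noteq> P" for R
  proof (cases "R = UNIV")
    case False
    then have Rc: "R \<in> closed_points C" using R(1) by (simp add: closed_points_def)
    then have "- x \<in> R" using x[OF Rc] R by (simp add: skyscraper_def)
    then have "- (- x) \<in> R" by (rule subalgebra_uminus[OF C_subalgebra[OF R(1)]])
    then show ?thesis by simp
  qed simp
  have J: "y \<in> polar_ring x \<longleftrightarrow> y \<in> P" for y
    unfolding polar_ring_iff using reg xP closed_point_in_C Pc by blast
  have xnc: "x \<notin> constants" using xP subalgebra_emb[OF sub] by (auto simp: constants_iff)
  have x0: "x \<noteq> 0" using nonconstant_nonzero[OF xnc] .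
  have b: "inverse x \<in> nonunits P" using xP valuation_cases[OF v, of x] x0 by (auto simp: nonunits_iff)
  show ?thesis
  proof (rule hyperelliptic_if_residue_degree_two[OF xnc])
    show "valuation R" if "R \<in> C" "x \<notin> R" for R using reg[OF that(1)] that(2) v by blast
    show "\<pi> \<in> polar_ring x" using pP J by blast
    show "\<exists>c d. \<exists>z\<in>polar_ring x. y = emb c + emb d * \<pi> + inverse x * z" if y: "y \<in> polar_ring x" for y
    proof -
      obtain a where a: "y - emb a \<in> nonunits P" using point_ring_residue[OF pr] y J by blast
      then have "(y - emb a) / \<pi> \<in> P" using pi by (simp add: uniformizer_def)
      then obtain d where "(y - emb a) / \<pi> - emb d \<in> nonunits P" using point_ring_residue[OF pr] by blast
      then have z: "((y - emb a) / \<pi> - emb d) / \<pi> \<in> P" using pi by (simp add: uniformizer_def)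
      define z where "z = ((y - emb a) / \<pi> - emb d) / \<pi>"
      have eq: "y = emb a + emb d * \<pi> + z * \<pi>\<^sup>2" using pm(2) by (simp add: z_def field_simps power2_eq_square)
      have "x * \<pi>\<^sup>2 * z \<in> polar_ring x" using subalgebra_mult[OF sub xpi2_in z] J by (simp add: z_def)
      moreover have "y = emb a + emb d * \<pi> + inverse x * (x * \<pi>\<^sup>2 * z)" using eq x0 by (simp add: mult_ac)
      ultimately show ?thesis by blast
    qed
    show "\<pi> \<noteq> emb d + inverse x * z" if "z \<in> polar_ring x" for d z
    proof
      assume eq: "\<pi> = emb d + inverse x * z"
      have zP: "z \<in> P" using that J by blast
      have "emb d = \<pi> - z * inverse x" using eq by (simp add: mult.commute)
      then have "emb d \<in> nonunits P" using point_ring_diff[OF pr pm(1) nonunits_mult[OF sub zP b]] by simp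
      then have "d = 0" using nonunits_emb[OF sub] by blast
      then have "x * \<pi> = z" using eq x0 by simp
      then show False using xpi_out zP by simp
    qed
  qed
qed

lemma finite_bad_points: "finite {P \<in> closed_points C. \<not> good_point P}"
proof -
  have "{P \<in> closed_points C. \<not> good_point P} \<subseteq>
      {P \<in> closed_points C. \<not> valuation P} \<union> (\<Union>i<g. {P \<in> C. s i / s 0 \<notin> P})"
    by (auto simp: good_point_def closed_points_def)
  then show ?thesis using finite_nonvaluation_points finite_poles by (auto intro: finite_subset)
qed

lemma section_ratio_nonconstant: "s 1 / s 0 \<notin> constants"
proof
  assume "s 1 / s 0 \<in> constants"
  then obtain c where "s 1 / s 0 = emb c" by (auto simp: constants_iff)
  then have eq: "s 1 = emb c * s 0" using s0(1) by (metis nonzero_eq_divide_eq)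
  define a where "a l = (if l = 0 then - c else if l = 1 then 1 else 0)" for l :: nat
  have "(\<Sum>l<g. emb (a l) * s l) = (\<Sum>l\<in>{0,1}. emb (a l) * s l)"
    using genus_ge_2 by (intro sum.mono_neutral_right) (auto simp: a_def)
  also have "\<dots> = 0" using eq by (simp add: a_def emb_minus)
  finally show False using V_combination_nonzero[of 1 a] genus_ge_2 by (simp add: a_def)
qed

text \<open>The function \<open>x = 1/(1 - y)\<close> is regular at the bad points because \<open>y\<close> vanishes there, so all its
  poles are good points.\<close>

lemma not_birational_hyperelliptic:
  assumes "model_field \<noteq> UNIV"
  shows "hyperelliptic scale C"
proof -
  note F = model_field(1)
  note Fsub = subextension_subalgebra[OF F]
  let ?S = "{P \<in> closed_points C. \<not> good_point P}"
  have x0F: "s 1 / s 0 \<in> model_field" using model_field(2)[of 1 0] genus_ge_2 by simp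
  obtain y where y: "y \<in> model_field" "y \<notin> constants" "\<And>P. P \<in> ?S \<Longrightarrow> y \<in> nonunits P"
  proof (rule vanishing_function[OF F x0F section_ratio_nonconstant finite_bad_points])
    fix y assume "y \<in> model_field" "y \<notin> constants" "\<And>P. P \<in> ?S \<Longrightarrow> y \<in> nonunits P"
    then show thesis by (rule that)
  qed auto
  define x where "x = inverse (1 - y)"
  have xF: "x \<in> model_field" unfolding x_def using y(1) by (intro subextension_inverse[OF F] subalgebra_diff[OF Fsub] subalgebra_1[OF Fsub])
  have "peval [:1, -1:] y \<notin> constants" using y(2) by (intro peval_degree_nonconstant) auto
  then have xnc: "x \<notin> constants" unfolding x_def by (intro inverse_nonconstant) (simp add: emb_minus)
  have good: "good_point P" if P: "P \<in> C" "x \<notin> P" for P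
  proof (rule ccontr)
    assume "\<not> good_point P"
    moreover have Pc: "P \<in> closed_points C" using P by (rule not_in_closed)
    ultimately have "- y \<in> nonunits P" using y(3) point_ring_uminus[OF closed_point_ring[OF Pc]] by blast
    then have "inverse (- y + emb 1) \<in> P"
      using point_ring_unit_add(3)[OF closed_point_ring[OF Pc] _ one_neq_zero] by blast
    moreover have "- y + emb 1 = 1 - y" by simp
    ultimately show False using P(2) unfolding x_def by (simp only:)
  qed
  show ?thesis
  proof (rule ccontr)
    assume nh: "\<not> hyperelliptic scale C"
    show False
    proof (rule no_unramified_subfield[OF F assms xF xnc])
      show "valuation P" if "P \<in> C" "x \<notin> P" for P using good[OF that] by (simp add: good_point_def)
      show "P = Q" if "P \<in> C" "x \<notin> P" "Q \<in> C" "x \<notin> Q" "P \<inter> model_field = Q \<inter> model_field" for P Q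
        using hyperelliptic_if_points_identified[OF good good] that nh by blast
      show "\<exists>\<tau>\<in>model_field. uniformizer P \<tau>" if P: "P \<in> C" "x \<notin> P" for P
      proof -
        have v: "valuation P" using good[OF P] by (simp add: good_point_def)
        note sub = valuation_subalgebra[OF v]
        obtain \<pi> where pi: "uniformizer P \<pi>" using uniformizer_exists[OF v] .
        then have p0: "\<pi> \<noteq> 0" by (simp add: uniformizer_def)
        obtain \<tau> where t: "\<tau> \<in> model_field" "\<tau> \<in> nonunits P" "\<tau> / \<pi>\<^sup>2 \<notin> P"
          using hyperelliptic_if_ramified[OF good[OF P] pi] nh by blast
        have "\<tau> / \<pi> \<in> P" using pi t(2) by (simp add: uniformizer_def)
        moreover have "\<tau> / \<pi> \<notin> nonunits P"
        proof
          assume "\<tau> / \<pi> \<in> nonunits P"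
          then have "\<tau> / \<pi> / \<pi> \<in> P" using pi unfolding uniformizer_def by blast
          then show False using t(3) by (simp add: power2_eq_square)
        qed
        ultimately have inv: "inverse (\<tau> / \<pi>) \<in> P" by (rule unit_inverse)
        have t0: "\<tau> \<noteq> 0" using t(3) subalgebra_0[OF sub] by auto
        have "z / \<tau> \<in> P" if "z \<in> nonunits P" for z
        proof -
          have "z / \<pi> * inverse (\<tau> / \<pi>) \<in> P"
            using that pi inv by (intro subalgebra_mult[OF sub]) (auto simp: uniformizer_def)
          then show ?thesis using p0 by (simp add: field_simps)
        qed
        then show ?thesis using t t0 by (auto simp: uniformizer_def)
      qed
    qed
  qed
qed

end

theorem proposition2p13:
  fixes scale :: "'k::alg_closed_field \<Rightarrow> 'a::field \<Rightarrow> 'a"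
    and C :: "'a set set"
    and g :: nat
    and \<omega> :: "'a set \<Rightarrow> 'a set"
    and t :: "('a set \<Rightarrow> nat \<Rightarrow> 'a) \<Rightarrow> 'k"
    and s :: "nat \<Rightarrow> 'a"
  assumes "complete_integral_curve scale C"
    and "has_arithmetic_genus scale C g" and "g \<ge> 2"
    and "dualizing_sheaf scale C \<omega> t"
    and "basis_of scale (global_sections C \<omega>) g s"
  shows "has_map_degree (normalization C) (canonical_model scale C \<omega> g s) 1
           \<longleftrightarrow> \<not> hyperelliptic scale C"
proof -
  interpret dualized_curve scale C g \<omega> t s
    using assms by unfold_locales (auto simp: complete_integral_curve_def)
  show ?thesis
    unfolding canonical_map_birational_iff
    using hyperelliptic_not_birational not_birational_hyperelliptic by blast
qed

end
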